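(* Let $V$ be a finite-dimensional Euclidean vector space and $I\subset\mathbb{R}$ an interval. Let $R_n(t)$, $t\in I$, be a sequence of smooth families of symmetric endomorphisms of $V$ converging in the $\mathcal{C}^0$ topology to a smooth family $R(t)$ of symmetric endomorphisms. Let $W_n$ be isotropic subspaces of the space of $R_n$-Jacobi fields that converge to an isotropic subspace $W$ of the space of $R$-Jacobi fields. Let $I_0=[a,b]\subset I$ be a compact interval and assume that $f^{W_n}(a)=f^W(a)$ and $f^{W_n}(b)=f^W(b)$ for all $n$ large enough. Then $\mathrm{ind}_W(I_0)\ge \mathrm{ind}_{W_n}(I_0)$ for all $n$ large enough. If all $W_n$ are Lagrangian, then this inequality becomes an equality (for all $n$ large enough).
   Context: For a smooth family $R(t)$, $t\in I$, of symmetric endomorphisms of $V$, $R$-Jacobi fields are the solutions $J:I\to V$ of $Y''+R(t)Y=0$. Their space carries the symplectic form $\omega(J_1,J_2)=\langle J_1(t),J_2'(t)\rangle-\langle J_1'(t),J_2(t)\rangle$, independent of $t$. For a subspace $W$, $W^{\perp}$ is the $\omega$-orthogonal complement; $W$ is isotropic if $W\subset W^\perp$ and Lagrangian if $W=W^\perp$. For isotropic $W$ and $t\in I$ let $W^t=\{J\in W\mid J(t)=0\}$ and $f^W(t)=\dim(W^t)$ (the $W$-focal index). For a subinterval $I_0\subset I$, $\mathrm{ind}_W(I_0)=\sum_{t\in I_0}f^W(t)$. Convergence in the $\mathcal{C}^0$ topology means uniform convergence on compact subintervals of $I$. Convergence $W_n\to W$ means $\dim W_n=\dim W$ for all large $n$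 and, for some (equivalently any) $t_0\in I$, the images of $W_n$ under $J\mapsto(J(t_0),J'(t_0))$ converge to the image of $W$ in the Grassmannian of subspaces of $V\times V$. *)

theory Defs
  imports "HOL-Analysis.Analysis" "HOL-Library.Function_Algebras"
begin

text \<open>
  Pointwise scaling, so that \<^term>\<open>subspace\<close> and \<^term>\<open>dim\<close> apply to spaces of
  vector-valued functions.
\<close>

instantiation "fun" :: (type, real_vector) real_vector
begin

definition scaleR_fun :: "real \<Rightarrow> ('a \<Rightarrow> 'b) \<Rightarrow> 'a \<Rightarrow> 'b"
  where "scaleR_fun c f = (\<lambda>x. c *\<^sub>R f x)"

instance
  by standard (simp_all add: scaleR_fun_def fun_eq_iff algebra_simps)

end

text \<open>All derivatives on \<open>I\<close> are taken within \<open>I\<close>, hence one-sided at end points in \<open>I\<close>.\<close>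

definition smooth_on :: "real set \<Rightarrow> (real \<Rightarrow> 'b::real_normed_vector) \<Rightarrow> bool"
  where "smooth_on I f \<longleftrightarrow>
    (\<exists>D :: nat \<Rightarrow> real \<Rightarrow> 'b. (\<forall>t\<in>I. D 0 t = f t) \<and>
      (\<forall>k. \<forall>t\<in>I. (D k has_vector_derivative D (Suc k) t) (at t within I)))"

definition symmetric_endo :: "('a::real_inner \<Rightarrow>\<^sub>L 'a) \<Rightarrow> bool"
  where "symmetric_endo A \<longleftrightarrow>
    (\<forall>x y. blinfun_apply A x \<bullet> y = x \<bullet> blinfun_apply A y)"

definition smooth_symmetric_family :: "real set \<Rightarrow> (real \<Rightarrow> 'a::real_inner \<Rightarrow>\<^sub>L 'a) \<Rightarrow> bool"
  where "smooth_symmetric_family I R \<longleftrightarrow> smooth_on I R \<and> (\<forall>t\<in>I. symmetric_endo (R t))"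

definition C0_converges ::
  "real set \<Rightarrow> (nat \<Rightarrow> real \<Rightarrow> 'b::metric_space) \<Rightarrow> (real \<Rightarrow> 'b) \<Rightarrow> bool"
  where "C0_converges I Rn R \<longleftrightarrow>
    (\<forall>c d. {c..d} \<subseteq> I \<longrightarrow> uniform_limit {c..d} Rn R sequentially)"

definition vel :: "real set \<Rightarrow> (real \<Rightarrow> 'a::real_normed_vector) \<Rightarrow> real \<Rightarrow> 'a"
  where "vel I J t = vector_derivative J (at t within I)"

text \<open>
  A map \<open>I \<rightarrow> V\<close> is represented by a total function that vanishes outside \<open>I\<close>, so that
  distinct elements below are distinct maps on \<open>I\<close> and dimensions come out right.
\<close>

definition jacobi_fields ::
  "real set \<Rightarrow> (real \<Rightarrow> 'a::real_normed_vector \<Rightarrow>\<^sub>L 'a) \<Rightarrow> (real \<Rightarrow> 'a) set"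
  where "jacobi_fields I R =
    {J. (\<forall>t. t \<notin> I \<longrightarrow> J t = 0) \<and>
        (\<forall>t\<in>I. (J has_vector_derivative vel I J t) (at t within I) \<and>
                (vel I J has_vector_derivative - blinfun_apply (R t) (J t)) (at t within I))}"

text \<open>
  The symplectic form is the common value over \<open>t \<in> I\<close>; see \<open>symp_eq\<close> below for
  the independence of \<open>t\<close>.
\<close>

definition symp :: "real set \<Rightarrow> (real \<Rightarrow> 'a::real_inner) \<Rightarrow> (real \<Rightarrow> 'a) \<Rightarrow> real"
  where "symp I J1 J2 = (THE c. \<forall>t\<in>I. J1 t \<bullet> vel I J2 t - vel I J1 t \<bullet> J2 t = c)"

lemma symp_eq:
  fixes R :: "real \<Rightarrow> 'a::real_inner \<Rightarrow>\<^sub>L 'a"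
  assumes I: "is_interval I"
    and R: "\<And>t. t \<in> I \<Longrightarrow> symmetric_endo (R t)"
    and J1: "J1 \<in> jacobi_fields I R" and J2: "J2 \<in> jacobi_fields I R"
    and t: "t \<in> I"
  shows "symp I J1 J2 = J1 t \<bullet> vel I J2 t - vel I J1 t \<bullet> J2 t"
proof -
  let ?w = "\<lambda>t. J1 t \<bullet> vel I J2 t - vel I J1 t \<bullet> J2 t"
  have "(?w has_derivative (\<lambda>h. 0)) (at s within I)" if s: "s \<in> I" for s
  proof -
    have d: "(J1 has_derivative (\<lambda>h. h *\<^sub>R vel I J1 s)) (at s within I)"
            "(J2 has_derivative (\<lambda>h. h *\<^sub>R vel I J2 s)) (at s within I)"
            "(vel I J1 has_derivative (\<lambda>h. h *\<^sub>R - blinfun_apply (R s) (J1 s))) (at s within I)"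
            "(vel I J2 has_derivative (\<lambda>h. h *\<^sub>R - blinfun_apply (R s) (J2 s))) (at s within I)"
      using J1 J2 s by (auto simp: jacobi_fields_def has_vector_derivative_def)
    have sym: "J1 s \<bullet> blinfun_apply (R s) (J2 s) = blinfun_apply (R s) (J1 s) \<bullet> J2 s"
      using R[OF s] by (simp add: symmetric_endo_def)
    show ?thesis
      by (rule derivative_eq_intros d refl)+ (simp add: fun_eq_iff sym algebra_simps)
  qed
  then obtain c where c: "\<And>s. s \<in> I \<Longrightarrow> ?w s = c"
    using has_derivative_zero_constant[of I ?w] I is_interval_convex by blast
  show ?thesis
    unfolding symp_def by (rule the_equality) (use c t in auto)
qed

definition symp_orth ::
  "real set \<Rightarrow> (real \<Rightarrow> 'a::real_inner \<Rightarrow>\<^sub>L 'a) \<Rightarrow> (real \<Rightarrow> 'a) set \<Rightarrow> (real \<Rightarrow> 'a) set"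
  where "symp_orth I R W = {J \<in> jacobi_fields I R. \<forall>K\<in>W. symp I J K = 0}"

definition isotropic ::
  "real set \<Rightarrow> (real \<Rightarrow> 'a::real_inner \<Rightarrow>\<^sub>L 'a) \<Rightarrow> (real \<Rightarrow> 'a) set \<Rightarrow> bool"
  where "isotropic I R W \<longleftrightarrow>
    subspace W \<and> W \<subseteq> jacobi_fields I R \<and> W \<subseteq> symp_orth I R W"

definition lagrangian ::
  "real set \<Rightarrow> (real \<Rightarrow> 'a::real_inner \<Rightarrow>\<^sub>L 'a) \<Rightarrow> (real \<Rightarrow> 'a) set \<Rightarrow> bool"
  where "lagrangian I R W \<longleftrightarrow>
    subspace W \<and> W \<subseteq> jacobi_fields I R \<and> W = symp_orth I R W"

definition focal_index :: "(real \<Rightarrow> 'a::real_vector) set \<Rightarrow> real \<Rightarrow> nat"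
  where "focal_index W t = dim {J \<in> W. J t = 0}"

text \<open>
  An unordered sum in \<^typ>\<open>enat\<close>: it always exists, and is \<open>\<infinity>\<close> if infinitely many
  terms are nonzero.
\<close>

definition ind :: "(real \<Rightarrow> 'a::real_vector) set \<Rightarrow> real set \<Rightarrow> enat"
  where "ind W I0 = (\<Sum>\<^sub>\<infinity>t\<in>I0. enat (focal_index W t))"

text \<open>
  The metric inducing the topology of the Grassmannian: the operator norm distance of
  the orthogonal projections onto two linear subspaces.
\<close>

definition grassmann_dist :: "'b::euclidean_space set \<Rightarrow> 'b set \<Rightarrow> real"
  where "grassmann_dist S T = onorm (\<lambda>x. closest_point S x - closest_point T x)"

definition phase :: "real set \<Rightarrow> real \<Rightarrow> (real \<Rightarrow> 'a::real_normed_vector) \<Rightarrow> 'a \<times> 'a"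
  where "phase I t J = (J t, vel I J t)"

definition subspaces_converge ::
  "real set \<Rightarrow> (nat \<Rightarrow> (real \<Rightarrow> 'a::euclidean_space) set) \<Rightarrow> (real \<Rightarrow> 'a) set \<Rightarrow> bool"
  where "subspaces_converge I Wn W \<longleftrightarrow>
    (\<forall>\<^sub>F n in sequentially. dim (Wn n) = dim W) \<and>
    (\<exists>t0\<in>I. (\<lambda>n. grassmann_dist (phase I t0 ` Wn n) (phase I t0 ` W)) \<longlonglongrightarrow> 0)"

end

theory Submission
  imports Defs
begin

text \<open>
  Upper bound. If fields \<open>J\<^sub>0, \<dots>, J\<^sub>m\<close> of \<open>W\<^sub>n\<close> vanish at times close to \<open>s\<close>, Rolle's theorem
  applied to \<open>\<langle>J\<^sub>i, J\<^sub>j'\<rangle>\<close>, which by isotropy vanishes at the zeros of \<open>J\<^sub>i\<close> and of \<open>J\<^sub>j\<close>, shows that the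
  velocities are almost orthogonal. Hence in the limit they give \<open>m + 1\<close> independent elements
  of \<open>W\<close> vanishing at \<open>s\<close>, so near \<open>s\<close> the space \<open>W\<^sub>n\<close> has at most \<open>f\<^sup>W(s)\<close> focal points,
  counted with multiplicity; now use compactness of \<open>[a,b]\<close>.

  Lower bound. If \<open>W\<close> is Lagrangian, then \<open>J' - \<kappa> J\<close> has no zero at \<open>s\<close> for \<open>0 \<noteq> J \<in> W\<close> and all but
  finitely many \<open>\<kappa>\<close>. The radical of the quadratic form \<open>\<langle>J, J' - \<kappa> J\<rangle>\<close> on \<open>W\<close> at times near \<open>s\<close> is then
  the space of fields vanishing at that time, and there the form increases. So its negative index
  drops by \<open>f\<^sup>W(s)\<close> across \<open>s\<close>. The indices at two nearby nonfocal times are stable, and they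
  can only change along \<open>W\<^sub>n\<close> at focal points, by at most the dimension of the radical.
\<close>

section \<open>Linear differential equations\<close>

text \<open>The spaces \<open>W\<close> and \<open>Wn n\<close> consist of solutions of different
  equations. Initial data at a fixed time \<open>t0\<close> place them all in the one space V x V,
  where convergence of subspaces is operator norm convergence of orthogonal projections; these
  projections also carry subspaces of \<open>W\<close> over to \<open>Wn n\<close>. Most stability
  claims are not quantitative: failure for large \<open>n\<close> and times near \<open>s\<close>
  yields unit parameters, and the limit of a convergent subsequence contradicts a property of the
  limit space. For this reason convergence is stated along arbitrary indices tending to infinity and
  along moving times.

  The slope \<kappa> is there because the radical of <J, J'> also contains the fields with J' = 0 at
  the given time. Along \<open>Wn n\<close> the direction in which the index changes at a focal time
  is never examined: a bound by the nullity suffices. At an interior time \<open>s\<close> the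
  indices on both sides are compared; at \<open>a\<close> and \<open>b\<close> one side is missing,
  and the assumption on the end points replaces the comparison.\<close>

text \<open>Uniform convergence and bounds are available on compact subintervals only, while
  derivatives are taken within \<open>I\<close>, which may or may not contain its end points. The
  compact interval is made to extend strictly past \<open>t\<close> on each side where
  \<open>I\<close> does, so the two filters at \<open>t\<close> agree.\<close>

lemma interval_compact_neighbourhood:
  fixes I :: "real set"
  assumes I: "is_interval I" and t: "t \<in> I" and t0: "t0 \<in> I"
  obtains c d where "{c..d} \<subseteq> I" "t \<in> {c..d}" "t0 \<in> {c..d}"
    "at t within I = at t within {c..d}"
proof -
  obtain c where c: "c \<in> I" "c \<le> t" "c \<le> t0" "\<And>x. x \<in> I \<Longrightarrow> x < t \<Longrightarrow> c < t"
  proof (cases "\<exists>x\<in>I. x < t")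
    case True
    then obtain x where "x \<in> I" "x < t" by blast
    then show ?thesis using t0 by (intro that[of "min x t0"]) (auto simp: min_def)
  next
    case False
    then show ?thesis using t t0 by (intro that[of t]) auto
  qed
  obtain d where d: "d \<in> I" "t \<le> d" "t0 \<le> d" "\<And>x. x \<in> I \<Longrightarrow> t < x \<Longrightarrow> t < d"
  proof (cases "\<exists>x\<in>I. t < x")
    case True
    then obtain x where "x \<in> I" "t < x" by blast
    then show ?thesis using t0 by (intro that[of "max x t0"]) (auto simp: max_def)
  next
    case False
    then show ?thesis using t t0 by (intro that[of t]) auto
  qed
  have sub: "{c..d} \<subseteq> I"
    using mem_is_interval_1_I[OF I c(1) d(1)] by auto
  define U where "U = (if c < t then {c<..} else UNIV) \<inter> (if t < d then {..<d} else UNIV)"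
  have "at t within I = at t within {c..d}"
  proof (rule at_within_nhd[of t U])
    show "t \<in> U" "open U" by (auto simp: U_def)
    show "I \<inter> U - {t} = {c..d} \<inter> U - {t}"
    proof (intro set_eqI iffI)
      fix x assume x: "x \<in> I \<inter> U - {t}"
      then show "x \<in> {c..d} \<inter> U - {t}"
        using c(4)[of x] d(4)[of x] c(2) d(2)
        by (cases x t rule: linorder_cases) (auto simp: U_def split: if_splits)
    qed (use sub in auto)
  qed
  then show thesis using that sub c d by auto
qed

lemma has_vector_derivative_within_intervalI:
  fixes I :: "real set"
  assumes "is_interval I" "t \<in> I" "t0 \<in> I"
    and "\<And>c d. {c..d} \<subseteq> I \<Longrightarrow> t0 \<in> {c..d} \<Longrightarrow> t \<in> {c..d} \<Longrightarrow>
      (f has_vector_derivative f') (at t within {c..d})"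
  shows "(f has_vector_derivative f') (at t within I)"
  using interval_compact_neighbourhood[OF assms(1-3)] assms(4) by metis

lemma antiderivative_on_interval:
  fixes f :: "real \<Rightarrow> 'e::banach"
  assumes I: "is_interval I" and t0: "t0 \<in> I" and f: "continuous_on I f"
  obtains F where "F t0 = 0" "\<And>t. t \<in> I \<Longrightarrow> (F has_vector_derivative f t) (at t within I)"
\<comment> \<open>An integral over an empty or one-point interval is 0, so the difference is the
  oriented integral from \<open>t0\<close> to \<open>u\<close> on either side of
  \<open>t0\<close>.\<close>
proof (rule that[of "\<lambda>u. integral {t0..u} f - integral {u..t0} f"])
  let ?F = "\<lambda>u. integral {t0..u} f - integral {u..t0} f"
  show "?F t0 = 0" by simp
  fix t assume t: "t \<in> I"
  show "(?F has_vector_derivative f t) (at t within I)"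
  proof (rule has_vector_derivative_within_intervalI[OF I t t0])
    fix c d assume cd: "{c..d} \<subseteq> I" "t0 \<in> {c..d}" "t \<in> {c..d}"
    have fc: "continuous_on {c..d} f" using continuous_on_subset[OF f cd(1)] .
    have int: "f integrable_on {x..y}" if "{x..y} \<subseteq> {c..d}" for x y
      using that by (intro integrable_continuous_real continuous_on_subset[OF fc])
    have eq: "integral {c..u} f - integral {c..t0} f = ?F u" if "u \<in> {c..d}" for u
    proof (cases "t0 \<le> u")
      case True
      then have "integral {c..t0} f + integral {t0..u} f = integral {c..u} f"
        using cd that by (intro Henstock_Kurzweil_Integration.integral_combine int) auto
      moreover have "integral {u..t0} f = 0"
        using True by (cases "u = t0") auto
      ultimately show ?thesis by (simp add: algebra_simps)
    next
      case False
      then have "integral {c..u} f + integral {u..t0} f = integral {c..t0} f"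
        using cd that by (intro Henstock_Kurzweil_Integration.integral_combine int) auto
      then show ?thesis using False by (simp add: algebra_simps)
    qed
    have "((\<lambda>u. integral {c..u} f - integral {c..t0} f) has_vector_derivative f t - 0)
        (at t within {c..d})"
      by (rule has_vector_derivative_diff integral_has_vector_derivative[OF fc cd(3)]
          has_vector_derivative_const)+
    then show "(?F has_vector_derivative f t) (at t within {c..d})"
      using has_vector_derivative_transform[OF cd(3) eq[symmetric]] by simp
  qed
qed

text \<open>The weight \<open>exp (2 M |t - t0|)\<close> makes Picard's operator a contraction with factor
  \<open>1/2\<close> on any compact interval.\<close>

lemma picard_step_bound:
  fixes F :: "real \<Rightarrow> 'e::euclidean_space"
  assumes F: "\<And>t. t \<in> {c..d} \<Longrightarrow> (F has_vector_derivative f t) (at t within {c..d})"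
    and F0: "F t0 = 0" and t0: "t0 \<in> {c..d}" and t: "t \<in> {c..d}"
    and M: "M > 0" and f: "\<And>s. s \<in> {c..d} \<Longrightarrow> norm (f s) \<le> M * (C * exp (2 * M * \<bar>s - t0\<bar>))"
    and C: "C \<ge> 0"
  shows "norm (F t) \<le> C / 2 * exp (2 * M * \<bar>t - t0\<bar>)"
proof -
  have cont: "continuous_on {c..d} F"
    using F by (meson continuous_on_eq_continuous_within has_vector_derivative_continuous)
  have int: "(F has_vector_derivative f x) (at x)" if "c < x" "x < d" for x
    using F[of x] that by (simp add: at_within_Icc_at)
  consider "t0 < t" | "t < t0" | "t = t0" by linarith
  then show ?thesis
  proof cases
    case 1
    let ?\<phi> = "\<lambda>s. C / 2 * exp (2 * M * (s - t0))"
    have "norm (F t - F t0) \<le> ?\<phi> t - ?\<phi> t0"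
    proof (rule differentiable_bound_general[OF 1])
      show "continuous_on {t0..t} F" using cont t0 t by (auto intro: continuous_on_subset)
      show "continuous_on {t0..t} ?\<phi>" by (intro continuous_intros)
      fix x assume x: "t0 < x" "x < t"
      show "(F has_vector_derivative f x) (at x)" using int x t0 t by auto
      show "(?\<phi> has_vector_derivative M * (C * exp (2 * M * (x - t0)))) (at x)"
        unfolding has_real_derivative_iff_has_vector_derivative[symmetric]
        by (auto intro!: derivative_eq_intros)
      show "norm (f x) \<le> M * (C * exp (2 * M * (x - t0)))" using f[of x] x t0 t by auto
    qed
    then show ?thesis using 1 F0 C by auto
  next
    case 2
    let ?\<phi> = "\<lambda>s. - (C / 2 * exp (2 * M * (t0 - s)))"
    have "norm (F t0 - F t) \<le> ?\<phi> t0 - ?\<phi> t"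
    proof (rule differentiable_bound_general[OF 2])
      show "continuous_on {t..t0} F" using cont t0 t by (auto intro: continuous_on_subset)
      show "continuous_on {t..t0} ?\<phi>" by (intro continuous_intros)
      fix x assume x: "t < x" "x < t0"
      show "(F has_vector_derivative f x) (at x)" using int x t0 t by auto
      show "(?\<phi> has_vector_derivative M * (C * exp (2 * M * (t0 - x)))) (at x)"
        unfolding has_real_derivative_iff_has_vector_derivative[symmetric]
        by (auto intro!: derivative_eq_intros)
      show "norm (f x) \<le> M * (C * exp (2 * M * (t0 - x)))" using f[of x] x t0 t by auto
    qed
    then show ?thesis using 2 F0 C by (auto simp: abs_if)
  qed (use F0 C in auto)
qed

lemma compact_interval_bound:
  fixes A :: "real \<Rightarrow> 'b::real_normed_vector"
  assumes "continuous_on I A" "{c..d} \<subseteq> I"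
  obtains M where "M > 0" "\<And>t. t \<in> {c..d} \<Longrightarrow> norm (A t) \<le> M"
proof -
  have "compact (A ` {c..d})"
    using assms by (intro compact_continuous_image continuous_on_subset[OF assms(1)]) auto
  then obtain M where "\<forall>x \<in> A ` {c..d}. norm x \<le> M"
    using compact_imp_bounded bounded_iff by metis
  then show thesis by (intro that[of "max M 1"]) (auto simp: le_max_iff_disj)
qed

text \<open>Picard iteration written as a series: \<open>T k\<close> is the k-fold iterated integral
  of the constant \<open>z\<close>, and the sum of all \<open>T k\<close> is the solution. The terms
  live on all of \<open>I\<close>; convergence and differentiation of the series are proved on each
  compact subinterval containing \<open>t0\<close>.\<close>

lemma linear_ode_exists:
  fixes A :: "real \<Rightarrow> 'e::euclidean_space \<Rightarrow>\<^sub>L 'e"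
  assumes I: "is_interval I" and t0: "t0 \<in> I" and A: "continuous_on I A"
  obtains Y where "Y t0 = z" "\<And>t. t \<in> I \<Longrightarrow> (Y has_vector_derivative A t (Y t)) (at t within I)"
proof -
  define nxt where "nxt g = (SOME F. F t0 = 0 \<and> (\<forall>t\<in>I. (F has_vector_derivative A t (g t)) (at t within I)))"
    for g :: "real \<Rightarrow> 'e"
  have nxt: "nxt g t0 = 0 \<and> (\<forall>t\<in>I. (nxt g has_vector_derivative A t (g t)) (at t within I))"
    if "continuous_on I g" for g
  proof -
    have "continuous_on I (\<lambda>t. A t (g t))" using A that by (intro continuous_intros)
    from antiderivative_on_interval[OF I t0 this]
    have "\<exists>F. F t0 = 0 \<and> (\<forall>t\<in>I. (F has_vector_derivative A t (g t)) (at t within I))" by metis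
    from someI_ex[OF this] show ?thesis unfolding nxt_def .
  qed
  define T where "T k = (nxt ^^ k) (\<lambda>_. z)" for k
  have T0: "T 0 = (\<lambda>_. z)" and TS: "T (Suc k) = nxt (T k)" for k by (auto simp: T_def)
  have Tc: "continuous_on I (T k)" for k
  proof (induction k)
    case (Suc k)
    then show ?case using nxt[OF Suc] unfolding TS
      by (meson continuous_on_eq_continuous_within has_vector_derivative_continuous)
  qed (simp add: T0)
  have TSt0: "T (Suc k) t0 = 0" for k using nxt[OF Tc[of k]] by (simp add: TS)
  have Td: "(T (Suc k) has_vector_derivative A t (T k t)) (at t within I)" if "t \<in> I" for k t
    using nxt[OF Tc[of k]] that by (simp add: TS)
  define Y where "Y t = (\<Sum>k. T k t)" for t
  have cpt: "(Y has_vector_derivative A t (Y t)) (at t within {c..d}) \<and> Y t0 = z"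
    if cd: "{c..d} \<subseteq> I" "t0 \<in> {c..d}" and t: "t \<in> {c..d}" for c d t
  proof -
    obtain M where M: "M > 0" "\<And>t. t \<in> {c..d} \<Longrightarrow> norm (A t) \<le> M"
      using compact_interval_bound[OF A cd(1)] by blast
    have Tb: "norm (T k t) \<le> norm z / 2 ^ k * exp (2 * M * \<bar>t - t0\<bar>)" if "t \<in> {c..d}" for k t
      using that
    proof (induction k arbitrary: t)
      case 0
      have "exp (2 * M * \<bar>t - t0\<bar>) \<ge> 1" using M by simp
      then show ?case by (simp add: T0 mult_le_cancel_left1)
    next
      case (Suc k)
      have "norm (T (Suc k) t) \<le> (norm z / 2 ^ k) / 2 * exp (2 * M * \<bar>t - t0\<bar>)"
      proof (rule picard_step_bound[where F = "T (Suc k)" and f = "\<lambda>s. A s (T k s)" and c = c and d = d])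
        show "(T (Suc k) has_vector_derivative A s (T k s)) (at s within {c..d})"
          if "s \<in> {c..d}" for s
          using Td[of s k] that cd by (blast intro: has_vector_derivative_within_subset)
        show "norm (A s (T k s)) \<le> M * (norm z / 2 ^ k * exp (2 * M * \<bar>s - t0\<bar>))"
          if "s \<in> {c..d}" for s
          using norm_blinfun[of "A s" "T k s"] mult_mono[OF M(2)[OF that] Suc.IH[OF that]] M(1)
          by auto
      qed (use TSt0 cd M Suc.prems in auto)
      then show ?case by (simp add: mult.commute)
    qed
    define K where "K = norm z * exp (2 * M * (d - c))"
    have Tb': "norm (T k t) \<le> K * (1/2) ^ k" if "t \<in> {c..d}" for k t
    proof -
      have "exp (2 * M * \<bar>t - t0\<bar>) \<le> exp (2 * M * (d - c))" using that cd M by auto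
      then have "norm z / 2 ^ k * exp (2 * M * \<bar>t - t0\<bar>) \<le> norm z / 2 ^ k * exp (2 * M * (d - c))"
        by (intro mult_left_mono) auto
      then show ?thesis using Tb[OF that, of k]
        by (simp add: K_def power_divide mult.commute)
    qed
    have sm: "summable (\<lambda>k. K * (1/2::real) ^ k)" by (intro summable_mult summable_geometric) auto
    have ul: "uniform_limit {c..d} (\<lambda>n t. \<Sum>k<n. T k t) Y sequentially"
      unfolding Y_def using Tb' sm by (intro Weierstrass_m_test) auto
    have sums: "(\<lambda>k. T k s) sums Y s" if "s \<in> {c..d}" for s
      using tendsto_uniform_limitI[OF ul that] by (simp add: sums_def)
    have Y0: "Y t0 = z"
    proof -
      have "(\<lambda>k. T k t0) sums z"
      proof -
        have "T k t0 = (if k = 0 then z else 0)" for k using TSt0 T0 by (cases k) auto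
        then show ?thesis using sums_single[of 0 "\<lambda>_. z"] by (simp add: eq_commute[of 0])
      qed
      then show ?thesis using sums[OF cd(2)] sums_unique2 by blast
    qed
    define f' where "f' k s h = (case k of 0 \<Rightarrow> 0 | Suc j \<Rightarrow> h *\<^sub>R A s (T j s))" for k s h
    have "\<exists>g. \<forall>s\<in>{c..d}. (\<lambda>n. T n s) sums (g s) \<and>
        (g has_derivative (\<lambda>h. h *\<^sub>R A s (Y s))) (at s within {c..d})"
    proof (rule has_derivative_series[where f = T and f' = f' and x = t0 and l = "Y t0"])
      show "(T n has_derivative f' n x) (at x within {c..d})" if "x \<in> {c..d}" for n x
      proof (cases n)
        case (Suc k)
        then show ?thesis using Td[of x k] that cd unfolding f'_def has_vector_derivative_def
          using has_derivative_subset[OF _ cd(1)] by (auto simp: subset_eq)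
      qed (auto simp: f'_def[abs_def] T0)
      fix e :: real assume e: "e > 0"
      have "\<forall>\<^sub>F n in sequentially. \<forall>x\<in>{c..d}. dist (\<Sum>k<n. T k x) (Y x) < e / M"
        using ul e M(1) unfolding uniform_limit_iff by auto
      then have "\<forall>\<^sub>F n in sequentially. \<forall>x\<in>{c..d}. \<forall>h.
          norm (sum (\<lambda>i. f' i x h) {..<Suc n} - h *\<^sub>R A x (Y x)) \<le> e * norm h"
      proof eventually_elim
        case (elim n)
        show ?case
        proof (intro ballI allI)
          fix x h assume x: "x \<in> {c..d}"
          \<comment> \<open>The constant term has derivative 0 and every later term has derivative
            \<open>A\<close> applied to its predecessor, so the first \<open>n + 1\<close>
            derivatives add up to \<open>A\<close> of the first \<open>n\<close> terms.\<close>
          have "sum (\<lambda>i. f' i x h) {..<Suc n} = h *\<^sub>R A x (\<Sum>k<n. T k x)"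
            unfolding sum.lessThan_Suc_shift
            by (simp add: f'_def blinfun.sum_right scaleR_sum_right)
          then have "sum (\<lambda>i. f' i x h) {..<Suc n} - h *\<^sub>R A x (Y x) = h *\<^sub>R A x ((\<Sum>k<n. T k x) - Y x)"
            by (simp add: blinfun.diff_right scaleR_diff_right)
          moreover have "norm (A x ((\<Sum>k<n. T k x) - Y x)) \<le> M * (e / M)"
            using norm_blinfun[of "A x" "(\<Sum>k<n. T k x) - Y x"] M(1)
              mult_mono[OF M(2)[OF x] less_imp_le[OF elim[rule_format, OF x, unfolded dist_norm]]]
            by auto
          ultimately show "norm (sum (\<lambda>i. f' i x h) {..<Suc n} - h *\<^sub>R A x (Y x)) \<le> e * norm h"
            using M(1) by (auto simp: mult.commute[of e] intro!: mult_left_mono)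
        qed
      qed
      then show "\<forall>\<^sub>F n in sequentially. \<forall>x\<in>{c..d}. \<forall>h.
          norm (sum (\<lambda>i. f' i x h) {..<n} - h *\<^sub>R A x (Y x)) \<le> e * norm h"
        by (subst (asm) eventually_sequentially_Suc)
    qed (use cd sums in auto)
    then obtain g where g: "\<And>s. s \<in> {c..d} \<Longrightarrow> (\<lambda>n. T n s) sums (g s)"
        "\<And>s. s \<in> {c..d} \<Longrightarrow> (g has_derivative (\<lambda>h. h *\<^sub>R A s (Y s))) (at s within {c..d})"
      by blast
    have gY: "g s = Y s" if "s \<in> {c..d}" for s using g(1) sums that sums_unique2 by blast
    show ?thesis unfolding has_vector_derivative_def
      using has_derivative_transform[OF t gY[symmetric] g(2)[OF t]] Y0 by blast
  qed
  show thesis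
  proof
    show "Y t0 = z" using cpt[of t0 t0 t0] t0 by auto
    show "(Y has_vector_derivative A t (Y t)) (at t within I)" if "t \<in> I" for t
      by (rule has_vector_derivative_within_intervalI[OF I that t0]) (use cpt in blast)
  qed
qed

text \<open>For \<open>\<phi> = |u|\<^sup>2\<close> the hypothesis gives \<open>|\<phi>'| \<le> (2M + 1)(\<phi> + \<delta>\<^sup>2)\<close>; squaring avoids
  differentiating the norm.\<close>

lemma gronwall_square:
  fixes u :: "real \<Rightarrow> 'e::real_inner"
  assumes u: "\<And>t. t \<in> {c..d} \<Longrightarrow> (u has_vector_derivative u' t) (at t within {c..d})"
    and b: "\<And>t. t \<in> {c..d} \<Longrightarrow> norm (u' t) \<le> M * norm (u t) + \<delta>"
    and M: "M \<ge> 0" and t0: "t0 \<in> {c..d}" and t: "t \<in> {c..d}"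
  shows "(norm (u t))\<^sup>2 + \<delta>\<^sup>2 \<le> ((norm (u t0))\<^sup>2 + \<delta>\<^sup>2) * exp ((2 * M + 1) * \<bar>t - t0\<bar>)"
proof -
  define L where "L = 2 * M + 1"
  define \<phi> where "\<phi> t = u t \<bullet> u t + \<delta>\<^sup>2" for t
  have d\<phi>: "(\<phi> has_derivative (\<lambda>h. h * (2 * (u s \<bullet> u' s)))) (at s within {c..d})"
    if s: "s \<in> {c..d}" for s
    unfolding \<phi>_def using u[OF s] unfolding has_vector_derivative_def
    by (auto intro!: derivative_eq_intros simp: inner_commute algebra_simps fun_eq_iff)
  have b\<phi>: "\<bar>2 * (u s \<bullet> u' s)\<bar> \<le> L * \<phi> s" if s: "s \<in> {c..d}" for s
  proof -
    have "\<bar>u s \<bullet> u' s\<bar> \<le> norm (u s) * norm (u' s)" by (rule Cauchy_Schwarz_ineq2)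
    also have "\<dots> \<le> norm (u s) * (M * norm (u s) + \<delta>)" using b[OF s] by (intro mult_left_mono) auto
    finally have "\<bar>2 * (u s \<bullet> u' s)\<bar> \<le> 2 * M * (norm (u s))\<^sup>2 + 2 * norm (u s) * \<delta>"
      by (simp add: algebra_simps power2_eq_square)
    moreover have "2 * norm (u s) * \<delta> \<le> (norm (u s))\<^sup>2 + \<delta>\<^sup>2" by (rule sum_squares_bound)
    moreover have "0 \<le> 2 * M * \<delta>\<^sup>2" using M by simp
    ultimately show ?thesis
      by (simp add: L_def \<phi>_def algebra_simps dot_square_norm)
  qed
  \<comment> \<open>Used with \<open>k = - L\<close> to the right of \<open>t0\<close> and
    \<open>k = L\<close> to the left; by \<open>b\<phi>\<close> the product is nonincreasing in the
    first case and nondecreasing in the second.\<close>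
  have g: "((\<lambda>t. \<phi> t * exp (k * t)) has_derivative
      (\<lambda>h. h * ((2 * (u s \<bullet> u' s) + k * \<phi> s) * exp (k * s)))) (at s within {c..d})"
    if s: "s \<in> {c..d}" for s k
    by (auto intro!: derivative_eq_intros d\<phi>[OF s] simp: algebra_simps fun_eq_iff)
  have key: "\<phi> t \<le> \<phi> t0 * exp (L * \<bar>t - t0\<bar>)"
  proof -
    consider "t0 < t" | "t < t0" | "t = t0" by linarith
    then show ?thesis
    proof cases
      case 1
      obtain x where x: "x \<in> {t0<..<t}" "\<phi> t * exp (- L * t) - \<phi> t0 * exp (- L * t0)
          = (t - t0) * ((2 * (u x \<bullet> u' x) + - L * \<phi> x) * exp (- L * x))"
        using mvt_simple[OF 1, of "\<lambda>t. \<phi> t * exp (- L * t)", OF has_derivative_subset[OF g]] t0 t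
        by (auto simp: subset_eq)
      have "2 * (u x \<bullet> u' x) + - L * \<phi> x \<le> 0" using b\<phi>[of x] x t t0 by auto
      then have "\<phi> t * exp (- L * t) \<le> \<phi> t0 * exp (- L * t0)"
        using x 1 by (smt (verit) exp_gt_zero mult_nonneg_nonneg mult_nonpos_nonneg mult_nonneg_nonpos)
      then have "\<phi> t * exp (- L * t) * exp (L * t) \<le> \<phi> t0 * exp (- L * t0) * exp (L * t)"
        by (intro mult_right_mono) auto
      then show ?thesis using 1 by (simp add: mult.assoc flip: exp_add) (simp add: algebra_simps)
    next
      case 2
      obtain x where x: "x \<in> {t<..<t0}" "\<phi> t0 * exp (L * t0) - \<phi> t * exp (L * t)
          = (t0 - t) * ((2 * (u x \<bullet> u' x) + L * \<phi> x) * exp (L * x))"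
        using mvt_simple[OF 2, of "\<lambda>t. \<phi> t * exp (L * t)", OF has_derivative_subset[OF g]] t0 t
        by (auto simp: subset_eq)
      have "2 * (u x \<bullet> u' x) + L * \<phi> x \<ge> 0" using b\<phi>[of x] x t t0 by auto
      then have "\<phi> t * exp (L * t) \<le> \<phi> t0 * exp (L * t0)"
        using x 2 by (smt (verit) exp_gt_zero mult_nonneg_nonneg)
      then have "\<phi> t * exp (L * t) * exp (- L * t) \<le> \<phi> t0 * exp (L * t0) * exp (- L * t)"
        by (intro mult_right_mono) auto
      then show ?thesis using 2 by (simp add: mult.assoc flip: exp_add) (simp add: algebra_simps)
    qed simp
  qed
  then show ?thesis by (simp add: \<phi>_def L_def dot_square_norm)
qed

section \<open>Nullities of a path of quadratic forms\<close>

text \<open>A failure for every radius \<open>1 / Suc k\<close> and threshold \<open>k\<close> gives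
  a sequence of counterexamples. Its indices satisfy \<open>\<nu> k \<ge> k\<close> but need not
  increase, hence the premise may rely only on their tending to infinity.\<close>

lemma near_by_sequences2:
  fixes s :: real
  assumes "\<And>\<nu> \<tau>. filterlim \<nu> at_top sequentially \<Longrightarrow> (\<And>k::nat. \<tau> k \<in> T) \<Longrightarrow> \<tau> \<longlonglongrightarrow> s \<Longrightarrow>
    \<forall>\<^sub>F k in sequentially. P (\<nu> k :: nat) (\<tau> k)"
  shows "\<exists>\<delta>>0. \<exists>n0. \<forall>n\<ge>n0. \<forall>t\<in>T. \<bar>t - s\<bar> < \<delta> \<longrightarrow> P n t"
proof (rule ccontr)
  assume neg: "\<not> ?thesis"
  have "\<exists>n\<ge>k. \<exists>t\<in>T. \<bar>t - s\<bar> < 1 / Suc k \<and> \<not> P n t" for k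
  proof -
    have "1 / real (Suc k) > 0" by simp
    then show ?thesis using neg by blast
  qed
  then obtain \<nu> \<tau> where \<tau>: "\<And>k. \<tau> k \<in> T" "\<And>k. \<bar>\<tau> k - s\<bar> < 1 / Suc k"
      "\<And>k. \<not> P (\<nu> k) (\<tau> k)" "\<And>k. \<nu> k \<ge> k" by metis
  have "(\<lambda>k. \<tau> k - s) \<longlonglongrightarrow> 0"
    by (rule Lim_null_comparison[OF _ LIMSEQ_Suc[OF lim_1_over_n]])
      (use \<tau>(2) in \<open>auto intro!: always_eventually less_imp_le\<close>)
  then have lim: "\<tau> \<longlonglongrightarrow> s" by (simp add: LIM_zero_iff)
  have "filterlim \<nu> at_top sequentially"
    by (rule filterlim_at_top_mono[OF filterlim_ident]) (simp add: \<tau>(4))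
  from assms[OF this \<tau>(1) lim] \<tau>(3) show False by simp
qed

lemma near_by_sequences:
  fixes s :: real
  assumes "\<And>\<tau>. (\<And>k::nat. \<tau> k \<in> T) \<Longrightarrow> \<tau> \<longlonglongrightarrow> s \<Longrightarrow> \<forall>\<^sub>F k in sequentially. P (\<tau> k)"
  shows "\<exists>\<delta>>0. \<forall>t\<in>T. \<bar>t - s\<bar> < \<delta> \<longrightarrow> P t"
  using near_by_sequences2[of T s "\<lambda>_. P"] assms by blast

text \<open>Bad vectors form a cone, so nonzero ones can be normalized, and compactness of the unit
  sphere supplies a unit limit along a subsequence. Positivity of forms and nondegeneracy of slopes
  are thereby reduced to statements about the limit alone.\<close>

lemma eventually_zero_by_compactness:
  fixes bad :: "nat \<Rightarrow> 'e::euclidean_space \<Rightarrow> bool"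
  assumes scale: "\<And>k z c. bad k z \<Longrightarrow> c > 0 \<Longrightarrow> bad k (c *\<^sub>R z)"
    and lim: "\<And>r \<zeta> z. strict_mono r \<Longrightarrow> (\<And>k. bad (r k) (\<zeta> k)) \<Longrightarrow> \<zeta> \<longlonglongrightarrow> z \<Longrightarrow> norm z = 1 \<Longrightarrow> False"
  shows "\<forall>\<^sub>F k in sequentially. \<forall>z. bad k z \<longrightarrow> z = 0"
proof (rule ccontr)
  assume "\<not> ?thesis"
  from not_eventually_sequentiallyD[OF this]
  have "\<exists>r::nat \<Rightarrow> nat. strict_mono r \<and> (\<forall>k. \<exists>z. bad (r k) z \<and> z \<noteq> 0)" by simp
  then obtain r :: "nat \<Rightarrow> nat" where r: "strict_mono r" "\<forall>k. \<exists>z. bad (r k) z \<and> z \<noteq> 0"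
    by blast
  from r(2) obtain \<zeta> where \<zeta>: "\<And>k. bad (r k) (\<zeta> k)" "\<And>k. \<zeta> k \<noteq> 0" by metis
  define \<xi> where "\<xi> k = (1 / norm (\<zeta> k)) *\<^sub>R \<zeta> k" for k
  have \<xi>: "bad (r k) (\<xi> k)" "\<xi> k \<in> sphere 0 1" for k
    using \<zeta> scale by (auto simp: \<xi>_def)
  obtain z r' where r': "z \<in> sphere 0 1" "strict_mono r'" "(\<xi> \<circ> r') \<longlonglongrightarrow> z"
    using compact_sphere[of "0::'e" 1] \<xi>(2) unfolding compact_def by metis
  show False
    using lim[of "r \<circ> r'" "\<xi> \<circ> r'" z] r(1) r' \<xi>(1) by (auto simp: strict_mono_o)
qed

text \<open>Unit vectors of \<open>U\<close> with nonpositive value at times tending to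
  \<open>s\<close> would accumulate at a unit vector of \<open>U\<close> with nonpositive value at
  \<open>s\<close>.\<close>

lemma positive_nearby:
  fixes q :: "real \<Rightarrow> 'e::euclidean_space \<Rightarrow> real"
  assumes hom: "\<And>t c z. q t (c *\<^sub>R z) = c\<^sup>2 * q t z"
    and cont: "\<And>\<tau> \<zeta> z. (\<And>k::nat. \<tau> k \<in> T) \<Longrightarrow> \<tau> \<longlonglongrightarrow> s \<Longrightarrow> \<zeta> \<longlonglongrightarrow> z \<Longrightarrow>
      (\<lambda>k. q (\<tau> k) (\<zeta> k)) \<longlonglongrightarrow> q s z"
    and U: "subspace U" and pos: "\<And>z. z \<in> U \<Longrightarrow> z \<noteq> 0 \<Longrightarrow> 0 < q s z"
  shows "\<exists>\<delta>>0. \<forall>t\<in>T. \<bar>t - s\<bar> < \<delta> \<longrightarrow> (\<forall>z\<in>U. z \<noteq> 0 \<longrightarrow> 0 < q t z)"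
proof (rule near_by_sequences)
  fix \<tau> :: "nat \<Rightarrow> real" assume \<tau>: "\<And>k. \<tau> k \<in> T" "\<tau> \<longlonglongrightarrow> s"
  have "\<forall>\<^sub>F k in sequentially. \<forall>z. z \<in> U \<and> q (\<tau> k) z \<le> 0 \<longrightarrow> z = 0"
  proof (rule eventually_zero_by_compactness)
    fix k z and c :: real assume "z \<in> U \<and> q (\<tau> k) z \<le> 0" "c > 0"
    then show "c *\<^sub>R z \<in> U \<and> q (\<tau> k) (c *\<^sub>R z) \<le> 0"
      using U by (auto simp: hom subspace_scale mult_le_0_iff)
  next
    fix r :: "nat \<Rightarrow> nat" and \<zeta> z
    assume r: "strict_mono r" and \<zeta>: "\<And>k. \<zeta> k \<in> U \<and> q (\<tau> (r k)) (\<zeta> k) \<le> 0"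
      and z: "\<zeta> \<longlonglongrightarrow> z" "norm z = 1"
    have "(\<lambda>k. q ((\<tau> \<circ> r) k) (\<zeta> k)) \<longlonglongrightarrow> q s z"
      using \<tau> z(1) LIMSEQ_subseq_LIMSEQ[OF \<tau>(2) r] by (intro cont) (auto simp: o_def)
    then have "q s z \<le> 0" using \<zeta> by (intro LIMSEQ_le_const2) auto
    moreover have "z \<in> U"
      using closed_sequentially[OF closed_subspace[OF U]] \<zeta> z(1) by blast
    ultimately show False using pos[of z] z(2) by force
  qed
  then show "\<forall>\<^sub>F k in sequentially. \<forall>z\<in>U. z \<noteq> 0 \<longrightarrow> 0 < q (\<tau> k) z"
    by eventually_elim force
qed

lemma dim_Int_trivial_le:
  fixes S N M :: "'e::euclidean_space set"
  assumes "subspace N" "subspace M" "subspace S" "N \<subseteq> S" "M \<subseteq> S" "N \<inter> M \<subseteq> {0}"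
  shows "dim N + dim M \<le> dim S"
proof -
  have "dim {x + y |x y. x \<in> N \<and> y \<in> M} \<le> dim S"
    using assms by (intro dim_subset) (auto intro: subspace_add)
  moreover have "dim (N \<inter> M) = 0" using assms(6) by auto
  ultimately show ?thesis using dim_sums_Int[OF assms(1,2)] by linarith
qed

section \<open>Negative index and radical of a bilinear form\<close>

definition negative_on :: "('e::real_vector \<Rightarrow> 'e \<Rightarrow> real) \<Rightarrow> 'e set \<Rightarrow> 'e set \<Rightarrow> bool"
  where "negative_on b S N \<longleftrightarrow> subspace N \<and> N \<subseteq> S \<and> (\<forall>z\<in>N. z \<noteq> 0 \<longrightarrow> b z z < 0)"

text \<open>The Morse index, defined variationally rather than by eigenvalues: a single negative
  subspace bounds it from below, and a single nonnegative subspace bounds it from above by its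
  codimension.\<close>

definition negdim :: "('e::real_vector \<Rightarrow> 'e \<Rightarrow> real) \<Rightarrow> 'e set \<Rightarrow> nat"
  where "negdim b S = Max {dim N |N. negative_on b S N}"

definition radical :: "('e \<Rightarrow> 'e \<Rightarrow> real) \<Rightarrow> 'e set \<Rightarrow> 'e set"
  where "radical b S = {z \<in> S. \<forall>w\<in>S. b z w = 0}"

lemma finite_negative_dims:
  fixes S :: "'e::euclidean_space set"
  shows "finite {dim N |N. negative_on b S N}"
  by (rule finite_subset[of _ "{..DIM('e)}"]) (auto simp: dim_subset_UNIV)

lemma negdim_ge:
  fixes S :: "'e::euclidean_space set"
  shows "negative_on b S N \<Longrightarrow> dim N \<le> negdim b S"
  unfolding negdim_def by (rule Max_ge[OF finite_negative_dims]) blast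

lemma negdim_attained:
  fixes S :: "'e::euclidean_space set"
  assumes "subspace S"
  obtains N where "negative_on b S N" "dim N = negdim b S"
proof -
  have "negative_on b S {0}"
    using assms by (auto simp: negative_on_def subspace_0)
  then have "negdim b S \<in> {dim N |N. negative_on b S N}"
    unfolding negdim_def by (intro Max_in finite_negative_dims) blast
  then show thesis using that by force
qed

lemma subspace_annihilator:
  assumes b: "bilinear b" and S: "subspace S"
  shows "subspace {z \<in> S. \<forall>w\<in>N. b z w = 0}"
  using S b
  by (auto simp: subspace_def bilinear_ladd bilinear_lzero bilinear_lmul)

lemma subspace_radical: "bilinear b \<Longrightarrow> subspace S \<Longrightarrow> subspace (radical b S)"
  unfolding radical_def by (rule subspace_annihilator)

lemma dim_annihilator_ge:
  fixes S N :: "'e::euclidean_space set" and b :: "'e \<Rightarrow> 'e \<Rightarrow> real"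
  assumes b: "bilinear b" and S: "subspace S" and N: "subspace N"
  shows "dim S \<le> dim {z \<in> S. \<forall>w\<in>N. b z w = 0} + dim N"
proof -
  \<comment> \<open>\<open>G w\<close> is the Riesz representative of the functional
    \<open>\<lambda>z. b z w\<close>, which turns the annihilator of \<open>N\<close> into the part
    of \<open>S\<close> orthogonal to the image of \<open>N\<close>.\<close>
  define G where "G w = (\<Sum>i\<in>Basis. b i w *\<^sub>R i)" for w
  have G: "linear G"
    unfolding G_def using b
    by (intro linearI) (auto simp: bilinear_radd bilinear_rmul scaleR_add_left sum.distrib scaleR_sum_right)
  have bG: "b z w = G w \<bullet> z" for z w
  proof -
    have lin: "linear (\<lambda>x. b x w)" using b by (simp add: bilinear_def)
    have "b z w = b (\<Sum>i\<in>Basis. (z \<bullet> i) *\<^sub>R i) w" by (simp add: euclidean_representation)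
    also have "\<dots> = (\<Sum>i\<in>Basis. (z \<bullet> i) * b i w)"
      by (simp add: linear_sum[OF lin] linear_scale[OF lin])
    also have "\<dots> = G w \<bullet> z"
      unfolding G_def inner_sum_left by (intro sum.cong) (simp_all add: inner_commute mult.commute)
    finally show ?thesis .
  qed
  define A where "A = {y. \<forall>x\<in>G ` N. orthogonal x y}"
  have sA: "subspace A" unfolding A_def by (rule subspace_orthogonal_to_vectors)
  have "dim A + dim (G ` N) = DIM('e)"
    using dim_subspace_orthogonal_to_vectors[OF linear_subspace_image[OF G N] subspace_UNIV]
    by (simp add: A_def)
  moreover have "dim (G ` N) \<le> dim N" by (rule dim_image_le[OF G])
  moreover have "dim {x + y |x y. x \<in> S \<and> y \<in> A} + dim (S \<inter> A) = dim S + dim A"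
    by (rule dim_sums_Int[OF S sA])
  moreover have "dim {x + y |x y. x \<in> S \<and> y \<in> A} \<le> DIM('e)" by (rule dim_subset_UNIV)
  moreover have "S \<inter> A = {z \<in> S. \<forall>w\<in>N. b z w = 0}"
    by (auto simp: A_def bG orthogonal_def)
  ultimately show ?thesis by simp
qed

text \<open>\<open>N\<close> is a negative subspace of maximal dimension and \<open>M\<close> its
  annihilator in \<open>S\<close>. A vector of \<open>M\<close> with negative value could be added
  to \<open>N\<close>, so the form is nonnegative on \<open>M\<close>; a null vector of a
  nonnegative form pairs to zero with all of \<open>M\<close>, and by construction with
  \<open>N\<close>.\<close>

lemma negative_decomposition:
  fixes S :: "'e::euclidean_space set" and b :: "'e \<Rightarrow> 'e \<Rightarrow> real"
  assumes b: "bilinear b" and S: "subspace S"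
    and sym: "\<And>z w. z \<in> S \<Longrightarrow> w \<in> S \<Longrightarrow> b z w = b w z"
  obtains N M where "negative_on b S N" "dim N = negdim b S" "subspace M" "M \<subseteq> S"
    "dim N + dim M = dim S" "\<And>z. z \<in> M \<Longrightarrow> b z z \<ge> 0"
    "\<And>z. z \<in> M \<Longrightarrow> b z z = 0 \<Longrightarrow> z \<in> radical b S" "radical b S \<subseteq> M"
    "\<And>z w. z \<in> N \<Longrightarrow> w \<in> M \<Longrightarrow> b z w = 0"
proof -
  obtain N where N: "negative_on b S N" "dim N = negdim b S" using negdim_attained[OF S] .
  then have sN: "subspace N" "N \<subseteq> S" and neg: "\<And>z. z \<in> N \<Longrightarrow> z \<noteq> 0 \<Longrightarrow> b z z < 0"
    by (auto simp: negative_on_def)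
  define M where "M = {z \<in> S. \<forall>w\<in>N. b z w = 0}"
  have sM: "subspace M" "M \<subseteq> S" unfolding M_def using subspace_annihilator[OF b S] by auto
  have MN: "b z w = 0" "b w z = 0" if "z \<in> N" "w \<in> M" for z w
    using that sym[of z w] sN by (auto simp: M_def)
  have NM: "N \<inter> M \<subseteq> {0}" using neg MN by force
  have dims: "dim N + dim M = dim S"
    using dim_Int_trivial_le[OF sN(1) sM(1) S sN(2) sM(2) NM] dim_annihilator_ge[OF b S sN(1)]
    by (simp add: M_def)
  have expand: "b (w + c *\<^sub>R z) (w + c *\<^sub>R z) = b w w + c * (b w z + b z w) + c\<^sup>2 * b z z" for w z c
    using b by (simp add: bilinear_ladd bilinear_radd bilinear_lmul bilinear_rmul
        algebra_simps power2_eq_square)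
  have nonneg: "b z z \<ge> 0" if z: "z \<in> M" for z
  proof (rule ccontr)
    assume "\<not> ?thesis"
    then have bz: "b z z < 0" by simp
    then have zN: "z \<notin> N" using NM z b by (force simp: bilinear_lzero)
    have zS: "z \<in> S" using z sM by blast
    have "negative_on b S (span (insert z N))"
      unfolding negative_on_def
    proof (intro conjI ballI impI)
      show "span (insert z N) \<subseteq> S" using sN zS S by (intro span_minimal) auto
      fix x assume x: "x \<in> span (insert z N)" "x \<noteq> 0"
      then obtain c where c: "x - c *\<^sub>R z \<in> N"
        using sN(1) by (auto simp: span_insert span_eq_iff[THEN iffD2])
      define w where "w = x - c *\<^sub>R z"
      have xw: "x = w + c *\<^sub>R z" and w: "w \<in> N" using c by (auto simp: w_def)
      have "b x x = b w w + c\<^sup>2 * b z z" unfolding xw expand using MN[OF w z] by simp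
      moreover have "c\<^sup>2 * b z z < 0" if "c \<noteq> 0" using bz that by (simp add: mult_less_0_iff)
      moreover have "b w w < 0" if "c = 0" using neg[OF w] x(2) that xw by auto
      moreover have "b w w \<le> 0" using neg[OF w] b by (cases "w = 0") (auto simp: bilinear_lzero less_imp_le)
      ultimately show "b x x < 0" by (cases "c = 0") auto
    qed simp
    then have "dim (span (insert z N)) \<le> dim N" using negdim_ge N by metis
    then show False using zN sN(1) by (simp add: dim_insert span_eq_iff[THEN iffD2])
  qed
  have SNM: "{x + y |x y. x \<in> N \<and> y \<in> M} = S"
  proof (rule subspace_dim_equal)
    show "subspace {x + y |x y. x \<in> N \<and> y \<in> M}" using subspace_sums sN sM by blast
    show "{x + y |x y. x \<in> N \<and> y \<in> M} \<subseteq> S" using sN sM S by (auto intro: subspace_add)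
    have "dim (N \<inter> M) = 0" using NM by auto
    then show "dim S \<le> dim {x + y |x y. x \<in> N \<and> y \<in> M}"
      using dim_sums_Int[OF sN(1) sM(1)] dims by linarith
  qed (rule S)
  have null: "z \<in> radical b S" if z: "z \<in> M" "b z z = 0" for z
  proof -
    have zS: "z \<in> S" using z sM by blast
    have zM: "b z w = 0" if w: "w \<in> M" for w
    proof (rule ccontr)
      assume nz: "b z w \<noteq> 0"
      have wS: "w \<in> S" using w sM by blast
      \<comment> \<open>Since \<open>z\<close> is null, the form along
        \<open>w + c *\<^sub>R z\<close> is affine in \<open>c\<close>; this value of
        \<open>c\<close> makes it \<open>-1\<close>, contradicting nonnegativity on
        \<open>M\<close>.\<close>
      define c where "c = - (b w w + 1) / (2 * b z w)"
      have "0 \<le> b (w + c *\<^sub>R z) (w + c *\<^sub>R z)"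
        using sM(1) z w by (intro nonneg subspace_add subspace_scale)
      also have "\<dots> = b w w + c * (2 * b z w)" unfolding expand using z sym[OF wS zS] by simp
      also have "\<dots> = -1" using nz by (simp add: c_def field_simps)
      finally show False by simp
    qed
    have "b z x = 0" if "x \<in> S" for x
    proof -
      obtain u v where "x = u + v" "u \<in> N" "v \<in> M" using \<open>x \<in> S\<close> SNM by blast
      then show ?thesis using b zM MN[of u z] z by (simp add: bilinear_radd)
    qed
    then show ?thesis using zS by (simp add: radical_def)
  qed
  have "radical b S \<subseteq> M" using sN by (auto simp: radical_def M_def)
  then show thesis using that N sM dims nonneg null MN(1) by blast
qed

text \<open>Adding to the negative index at time \<open>t\<close> the nullities met up to and including \<open>t\<close> gives a
  locally, hence globally, nondecreasing function.\<close>

lemma spectral_flow_le: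
  fixes b :: "real \<Rightarrow> 'e::euclidean_space \<Rightarrow> 'e \<Rightarrow> real"
  assumes cd: "c \<le> d" and S: "subspace S" and b: "\<And>t. bilinear (b t)"
    and sym: "\<And>t z w. t \<in> {c..d} \<Longrightarrow> z \<in> S \<Longrightarrow> w \<in> S \<Longrightarrow> b t z w = b t w z"
    and cont: "\<And>s \<tau> \<zeta> z. s \<in> {c..d} \<Longrightarrow> (\<And>k::nat. \<tau> k \<in> {c..d}) \<Longrightarrow> \<tau> \<longlonglongrightarrow> s \<Longrightarrow> \<zeta> \<longlonglongrightarrow> z \<Longrightarrow>
      (\<lambda>k. b (\<tau> k) (\<zeta> k) (\<zeta> k)) \<longlonglongrightarrow> b s z z"
    and F: "finite F" and rad: "\<And>t. t \<in> {c..d} \<Longrightarrow> t \<notin> F \<Longrightarrow> dim (radical (b t) S) = 0"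
  shows "negdim (b c) S \<le> negdim (b d) S + (\<Sum>t\<in>F. dim (radical (b t) S))"
proof -
  define i where "i t = negdim (b t) S" for t
  define k where "k t = dim (radical (b t) S)" for t
  have hom: "b t (x *\<^sub>R z) (x *\<^sub>R z) = x\<^sup>2 * b t z z" for t x z
    using b[of t] by (simp add: bilinear_lmul bilinear_rmul power2_eq_square)
  have lower: "\<exists>\<delta>>0. \<forall>t\<in>{c..d}. \<bar>t - s\<bar> < \<delta> \<longrightarrow> i s \<le> i t" if s: "s \<in> {c..d}" for s
  proof -
    obtain N where N: "negative_on (b s) S N" "dim N = i s"
      using negdim_attained[OF S] unfolding i_def by blast
    have "\<exists>\<delta>>0. \<forall>t\<in>{c..d}. \<bar>t - s\<bar> < \<delta> \<longrightarrow> (\<forall>z\<in>N. z \<noteq> 0 \<longrightarrow> 0 < - b t z z)"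
    proof (rule positive_nearby[where q = "\<lambda>t z. - b t z z"])
      show "- b t (x *\<^sub>R z) (x *\<^sub>R z) = x\<^sup>2 * - b t z z" for t x z by (simp add: hom)
      show "subspace N" "\<And>z. z \<in> N \<Longrightarrow> z \<noteq> 0 \<Longrightarrow> 0 < - b s z z"
        using N(1) by (auto simp: negative_on_def)
      fix \<tau> :: "nat \<Rightarrow> real" and \<zeta> :: "nat \<Rightarrow> 'e" and z
      assume lim: "\<And>k. \<tau> k \<in> {c..d}" "\<tau> \<longlonglongrightarrow> s" "\<zeta> \<longlonglongrightarrow> z"
      show "(\<lambda>k. - b (\<tau> k) (\<zeta> k) (\<zeta> k)) \<longlonglongrightarrow> - b s z z"
        by (rule tendsto_minus[OF cont[OF s lim]])
    qed
    then obtain \<delta> where \<delta>: "\<delta> > 0"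
        "\<And>t z. t \<in> {c..d} \<Longrightarrow> \<bar>t - s\<bar> < \<delta> \<Longrightarrow> z \<in> N \<Longrightarrow> z \<noteq> 0 \<Longrightarrow> b t z z < 0" by force
    have "i s \<le> i t" if "t \<in> {c..d}" "\<bar>t - s\<bar> < \<delta>" for t
    proof -
      have "negative_on (b t) S N" using N(1) \<delta>(2)[OF that] by (auto simp: negative_on_def)
      then show ?thesis using negdim_ge N(2) unfolding i_def by metis
    qed
    then show ?thesis using \<delta>(1) by blast
  qed
  have upper: "\<exists>\<delta>>0. \<forall>t\<in>{c..d}. \<bar>t - s\<bar> < \<delta> \<longrightarrow> i t \<le> i s + k s" if s: "s \<in> {c..d}" for s
  proof -
    obtain N M where NM: "negative_on (b s) S N" "dim N = negdim (b s) S" "subspace M" "M \<subseteq> S"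
      "dim N + dim M = dim S" "\<And>z. z \<in> M \<Longrightarrow> b s z z \<ge> 0"
      "\<And>z. z \<in> M \<Longrightarrow> b s z z = 0 \<Longrightarrow> z \<in> radical (b s) S" "radical (b s) S \<subseteq> M"
      "\<And>z w. z \<in> N \<Longrightarrow> w \<in> M \<Longrightarrow> b s z w = 0"
      by (rule negative_decomposition[OF b[of s] S]) (erule (1) sym[OF s], rule that)
    \<comment> \<open>\<open>P\<close> complements the radical inside \<open>M\<close>, so the form
      at \<open>s\<close> is positive definite on it and stays so nearby. A negative subspace then
      meets \<open>P\<close> trivially, and the codimension of \<open>P\<close> in \<open>S\<close>
      is \<open>i s + k s\<close>.\<close>
    define P where "P = {y \<in> M. \<forall>x\<in>radical (b s) S. orthogonal x y}"
    have P: "subspace P" "P \<subseteq> M"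
      unfolding P_def using NM(3)
      by (auto simp: subspace_def orthogonal_clauses)
    have dP: "dim P + k s = dim M"
      unfolding P_def k_def
      using dim_subspace_orthogonal_to_vectors[OF subspace_radical[OF b S] NM(3,8)] .
    have "\<exists>\<delta>>0. \<forall>t\<in>{c..d}. \<bar>t - s\<bar> < \<delta> \<longrightarrow> (\<forall>z\<in>P. z \<noteq> 0 \<longrightarrow> 0 < b t z z)"
    proof (rule positive_nearby[where q = "\<lambda>t z. b t z z", OF hom cont[OF s] P(1)])
      fix z assume z: "z \<in> P" "z \<noteq> 0"
      then have "z \<notin> radical (b s) S" by (auto simp: P_def orthogonal_def)
      then show "0 < b s z z" using NM(6,7)[of z] P(2) z by force
    qed
    then obtain \<delta> where \<delta>: "\<delta> > 0"
        "\<And>t z. t \<in> {c..d} \<Longrightarrow> \<bar>t - s\<bar> < \<delta> \<Longrightarrow> z \<in> P \<Longrightarrow> z \<noteq> 0 \<Longrightarrow> 0 < b t z z" by force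
    have "i t \<le> i s + k s" if t: "t \<in> {c..d}" "\<bar>t - s\<bar> < \<delta>" for t
    proof -
      obtain N' where N': "negative_on (b t) S N'" "dim N' = i t"
        using negdim_attained[OF S] unfolding i_def by blast
      have "N' \<inter> P \<subseteq> {0}" using \<delta>(2)[OF t] N'(1) by (force simp: negative_on_def)
      then have "dim N' + dim P \<le> dim S"
        using N'(1) P NM(4) S by (intro dim_Int_trivial_le) (auto simp: negative_on_def)
      then show ?thesis using N'(2) dP NM(2,5) by (simp add: i_def)
    qed
    then show ?thesis using \<delta>(1) by blast
  qed
  define G where "G t = i t + sum k {x \<in> F. x \<le> t}" for t
  have "c \<le> c \<and> d \<le> d \<and> c \<le> d \<longrightarrow> G c \<le> G d"
  \<comment> \<open>Bisection: a transitive relation between end points that holds for all short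
    intervals around each point holds for the whole interval.\<close>
  proof (rule Bolzano[OF cd, where P = "\<lambda>u v. c \<le> u \<and> v \<le> d \<and> u \<le> v \<longrightarrow> G u \<le> G v"])
    fix x assume x: "c \<le> x" "x \<le> d"
    obtain d1 where d1: "d1 > 0" "\<And>t. t \<in> {c..d} \<Longrightarrow> \<bar>t - x\<bar> < d1 \<Longrightarrow> i x \<le> i t"
      using lower[of x] x by force
    obtain d2 where d2: "d2 > 0" "\<And>t. t \<in> {c..d} \<Longrightarrow> \<bar>t - x\<bar> < d2 \<Longrightarrow> i t \<le> i x + k x"
      using upper[of x] x by force
    have "G u \<le> G v" if uv: "u \<le> x" "x \<le> v" "v - u < min d1 d2" "c \<le> u" "v \<le> d" for u v
    proof -
      \<comment> \<open>From the left into \<open>x\<close> the index can fall by at most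
        \<open>k x\<close>, which the sum in \<open>G\<close> gains exactly at \<open>x\<close>. To
        the right of \<open>x\<close> the index cannot fall below \<open>i x\<close>, because a
        negative subspace remains negative.\<close>
      have "G u \<le> G x"
      proof (cases "u = x")
        case False
        have "i u \<le> i x + k x" using d2(2)[of u] uv x by auto
        moreover have "sum k {y \<in> F. y \<le> u} + k x \<le> sum k {y \<in> F. y \<le> x}"
        proof (cases "x \<in> F")
          case True
          have "sum k {y \<in> F. y \<le> u} + k x = sum k (insert x {y \<in> F. y \<le> u})"
            using F False uv by (subst sum.insert) auto
          also have "\<dots> \<le> sum k {y \<in> F. y \<le> x}"
            using F True uv by (intro sum_mono2) auto
          finally show ?thesis .
        next
          case nF: False
          then have "k x = 0" using rad[of x] x by (simp add: k_def)
          moreover have "sum k {y \<in> F. y \<le> u} \<le> sum k {y \<in> F. y \<le> x}"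
            using F uv by (intro sum_mono2) auto
          ultimately show ?thesis by simp
        qed
        ultimately show ?thesis by (simp add: G_def)
      qed simp
      also have "i x \<le> i v" using d1(2)[of v] uv x by auto
      then have "G x \<le> G v"
        unfolding G_def using F uv by (intro add_mono sum_mono2) auto
      finally show ?thesis .
    qed
    then show "\<exists>\<delta>>0. \<forall>u v. u \<le> x \<and> x \<le> v \<and> v - u < \<delta> \<longrightarrow>
        (c \<le> u \<and> v \<le> d \<and> u \<le> v \<longrightarrow> G u \<le> G v)"
      using d1(1) d2(1) by (intro exI[of _ "min d1 d2"]) auto
  qed auto
  then have "i c \<le> G d" using cd by (simp add: G_def)
  also have "\<dots> \<le> i d + sum k F" unfolding G_def using F by (intro add_mono sum_mono2) auto
  finally show ?thesis by (simp add: i_def k_def)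
qed

section \<open>Focal points of a limit: upper bound\<close>

lemma common_convergent_subsequence:
  fixes \<zeta> :: "nat \<Rightarrow> nat \<Rightarrow> 'e::euclidean_space"
  assumes "\<And>k i. i < m \<Longrightarrow> norm (\<zeta> k i) = 1"
  obtains r z where "strict_mono (r::nat \<Rightarrow> nat)" "\<And>i. i < m \<Longrightarrow> (\<lambda>k. \<zeta> (r k) i) \<longlonglongrightarrow> z i"
proof -
  have "\<exists>r z. strict_mono (r::nat \<Rightarrow> nat) \<and> (\<forall>i<m. (\<lambda>k. \<zeta> (r k) i) \<longlonglongrightarrow> z i)"
    using assms
  proof (induction m)
    case 0
    then show ?case using strict_mono_id by blast
  next
    case (Suc m)
    then obtain r z where r: "strict_mono (r::nat \<Rightarrow> nat)" "\<forall>i<m. (\<lambda>k. \<zeta> (r k) i) \<longlonglongrightarrow> z i" by auto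
    have "\<forall>k. \<zeta> (r k) m \<in> sphere 0 1" using Suc.prems by simp
    then obtain l r' where r': "strict_mono r'" "((\<lambda>k. \<zeta> (r k) m) \<circ> r') \<longlonglongrightarrow> l"
      using compact_sphere[of "0::'e" 1] unfolding compact_def by metis
    have "(\<lambda>k. \<zeta> ((r \<circ> r') k) i) \<longlonglongrightarrow> (z(m := l)) i" if "i < Suc m" for i
    proof (cases "i = m")
      case False
      then have "(\<lambda>k. \<zeta> (r k) i) \<longlonglongrightarrow> z i" using r(2) that by simp
      from LIMSEQ_subseq_LIMSEQ[OF this r'(1)] False show ?thesis by (simp add: o_def)
    qed (use r'(2) in \<open>simp add: o_def\<close>)
    moreover have "strict_mono (r \<circ> r')" using r(1) r'(1) by (rule strict_mono_o)
    ultimately show ?case by blast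
  qed
  then show thesis using that by blast
qed

definition focal_space :: "(real \<Rightarrow> 'e \<Rightarrow> 'a::zero) \<Rightarrow> 'e set \<Rightarrow> real \<Rightarrow> 'e set"
  where "focal_space X S t = {z \<in> S. X t z = 0}"

text \<open>The parameter space \<open>'e\<close> indexes the Jacobi fields: \<open>X t z\<close> and \<open>V t z\<close> are the value and
  the velocity at time \<open>t\<close> of the field with parameter \<open>z\<close>, and \<open>S\<close> is the parameter set of an
  isotropic space.\<close>

locale jacobi_flow =
  fixes I :: "real set" and R :: "real \<Rightarrow> 'a::euclidean_space \<Rightarrow>\<^sub>L 'a"
    and X V :: "real \<Rightarrow> 'e::euclidean_space \<Rightarrow> 'a" and S :: "'e set"
  assumes interval: "is_interval I"
    and linear_X: "linear (X t)" and linear_V: "linear (V t)"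
    and deriv_X: "t \<in> I \<Longrightarrow> ((\<lambda>t. X t z) has_vector_derivative V t z) (at t within I)"
    and deriv_V: "t \<in> I \<Longrightarrow> ((\<lambda>t. V t z) has_vector_derivative - R t (X t z)) (at t within I)"
    and inj: "t \<in> I \<Longrightarrow> X t z = 0 \<Longrightarrow> V t z = 0 \<Longrightarrow> z = 0"
    and cont_R: "continuous_on I R"
    and subspace_S: "subspace S"
    and isotropic: "t \<in> I \<Longrightarrow> z \<in> S \<Longrightarrow> w \<in> S \<Longrightarrow> X t z \<bullet> V t w = V t z \<bullet> X t w"
begin

lemma between_in: "u \<in> I \<Longrightarrow> v \<in> I \<Longrightarrow> min u v \<le> x \<Longrightarrow> x \<le> max u v \<Longrightarrow> x \<in> I"
  by (cases "u \<le> v") (simp_all add: mem_is_interval_1_I[OF interval, of u v x]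
      mem_is_interval_1_I[OF interval, of v u x])

text \<open>Kept symmetric in \<open>u\<close> and \<open>v\<close>, so that its uses need not
  distinguish which of the two times comes first.\<close>

lemma mean_value:
  fixes h h' :: "real \<Rightarrow> real"
  assumes "u \<in> I" "v \<in> I" "\<And>t. t \<in> I \<Longrightarrow> (h has_vector_derivative h' t) (at t within I)"
  obtains \<xi> where "\<xi> \<in> I" "min u v \<le> \<xi>" "\<xi> \<le> max u v" "h v - h u = (v - u) * h' \<xi>"
proof -
  note goal = that
  have *: thesis if uv: "u' < v'" "{u', v'} = {u, v}" for u' v'
  proof -
    have sub: "{u'..v'} \<subseteq> I" using between_in[OF assms(1,2)] that by (auto simp: doubleton_eq_iff)
    have "(h has_derivative (\<lambda>x. x * h' t)) (at t within {u'..v'})" if "u' \<le> t" "t \<le> v'" for t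
      using assms(3)[of t] sub that has_derivative_subset[OF _ sub]
      unfolding has_vector_derivative_def by (auto simp: subset_eq)
    then obtain x where "x \<in> {u'<..<v'}" "h v' - h u' = (v' - u') * h' x"
      using mvt_simple[where f = h and f' = "\<lambda>t x. x * h' t", OF uv(1)] by blast
    moreover have "x \<in> I" using calculation sub by auto
    ultimately show thesis using uv by (intro goal[of x]) (auto simp: doubleton_eq_iff algebra_simps)
  qed
  consider "u < v" | "v < u" | "u = v" by linarith
  then show thesis
    by cases (use * in blast, use * in blast, use that[of u] assms in simp)
qed

lemma
  shows X_zero [simp]: "X t 0 = 0" and V_zero [simp]: "V t 0 = 0"
    and X_scale: "X t (c *\<^sub>R z) = c *\<^sub>R X t z" and V_scale: "V t (c *\<^sub>R z) = c *\<^sub>R V t z"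
  using linear_X linear_V by (simp_all add: linear_0 linear_scale)

text \<open>Joint continuity in time and parameter: expansion in a basis reduces it to continuity in
  time of finitely many fields.\<close>

lemma linear_family_tendsto:
  fixes Y :: "real \<Rightarrow> 'e \<Rightarrow> 'a"
  assumes Y: "\<And>t. linear (Y t)" and c: "\<And>z. continuous_on I (\<lambda>t. Y t z)"
    and t: "\<And>k::nat. \<tau> k \<in> I" "t \<in> I" "\<tau> \<longlonglongrightarrow> t" "\<zeta> \<longlonglongrightarrow> z"
  shows "(\<lambda>k. Y (\<tau> k) (\<zeta> k)) \<longlonglongrightarrow> Y t z"
proof -
  have eq: "Y t z = (\<Sum>i\<in>Basis. (z \<bullet> i) *\<^sub>R Y t i)" for t z
  proof -
    have "Y t (\<Sum>i\<in>Basis. (z \<bullet> i) *\<^sub>R i) = (\<Sum>i\<in>Basis. (z \<bullet> i) *\<^sub>R Y t i)"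
      by (simp add: linear_sum[OF Y] linear_scale[OF Y])
    then show ?thesis by (simp add: euclidean_representation)
  qed
  have "(\<lambda>k. Y (\<tau> k) i) \<longlonglongrightarrow> Y t i" for i
    using c[of i] t unfolding continuous_on_sequentially by (auto simp: o_def)
  then have "(\<lambda>k. \<Sum>i\<in>Basis. (\<zeta> k \<bullet> i) *\<^sub>R Y (\<tau> k) i) \<longlonglongrightarrow> (\<Sum>i\<in>Basis. (z \<bullet> i) *\<^sub>R Y t i)"
    using t(4) by (intro tendsto_sum tendsto_scaleR tendsto_inner tendsto_const)
  then show ?thesis by (simp only: eq[symmetric])
qed

lemma continuous_X: "continuous_on I (\<lambda>t. X t z)"
  using deriv_X by (meson continuous_on_eq_continuous_within has_vector_derivative_continuous)

lemma continuous_V: "continuous_on I (\<lambda>t. V t z)"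
  using deriv_V by (meson continuous_on_eq_continuous_within has_vector_derivative_continuous)

lemmas tendsto_X = linear_family_tendsto[OF linear_X continuous_X]
  and tendsto_V = linear_family_tendsto[OF linear_V continuous_V]

lemma tendsto_R: "(\<And>k::nat. \<tau> k \<in> I) \<Longrightarrow> t \<in> I \<Longrightarrow> \<tau> \<longlonglongrightarrow> t \<Longrightarrow> (\<lambda>k. R (\<tau> k)) \<longlonglongrightarrow> R t"
  using cont_R unfolding continuous_on_sequentially by (auto simp: o_def)

lemma subspace_focal_space: "subspace (focal_space X S t)"
  using subspace_S linear_X[of t] unfolding focal_space_def
  by (auto simp: subspace_def linear_add X_scale)

lemma inj_on_V: "t \<in> I \<Longrightarrow> inj_on (V t) (focal_space X S t)"
proof (rule inj_onI)
  fix x y assume t: "t \<in> I" and xy: "x \<in> focal_space X S t" "y \<in> focal_space X S t" "V t x = V t y"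
  have "X t (x - y) = 0" "V t (x - y) = 0"
    using xy linear_X linear_V by (auto simp: focal_space_def linear_diff)
  then show "x = y" using inj[OF t] by fastforce
qed

text \<open>An orthogonal basis of the space of velocities is pulled back along the injective map
  \<open>V t\<close>. The parameters are normalized and not the velocities, because limits will be
  extracted on the unit sphere of parameters; rescaling preserves orthogonality.\<close>

lemma velocity_orthogonal_basis:
  assumes t: "t \<in> I"
  obtains B where "finite B" "card B = dim (focal_space X S t)" "B \<subseteq> focal_space X S t"
    "\<And>z. z \<in> B \<Longrightarrow> norm z = 1" "\<And>z w. z \<in> B \<Longrightarrow> w \<in> B \<Longrightarrow> z \<noteq> w \<Longrightarrow> V t z \<bullet> V t w = 0"
proof -
  let ?K = "focal_space X S t"
  have sC: "subspace (V t ` ?K)" by (rule linear_subspace_image[OF linear_V subspace_focal_space])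
  obtain C where C: "0 \<notin> C" "C \<subseteq> V t ` ?K" "pairwise orthogonal C" "independent C"
      "card C = dim (V t ` ?K)"
    using orthogonal_basis_subspace[OF sC] by metis
  have dimC: "dim (V t ` ?K) = dim ?K"
    using inj_on_V[OF t] subspace_focal_space
    by (intro dim_image_eq[OF linear_V]) (simp add: span_eq_iff[THEN iffD2])
  define g where "g = inv_into ?K (V t)"
  have g: "g c \<in> ?K" "V t (g c) = c" "g c \<noteq> 0" if "c \<in> C" for c
  proof -
    show "g c \<in> ?K" "V t (g c) = c"
      using C(2) that unfolding g_def by (auto intro: inv_into_into f_inv_into_f)
    then show "g c \<noteq> 0" using C(1) that by auto
  qed
  define e where "e c = (1 / norm (g c)) *\<^sub>R g c" for c
  have Ve: "V t (e c) = (1 / norm (g c)) *\<^sub>R c" if "c \<in> C" for c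
    using g[OF that] by (simp add: e_def V_scale)
  have orth: "V t (e c) \<bullet> V t (e c') = 0" if "c \<in> C" "c' \<in> C" "c \<noteq> c'" for c c'
    using C(3) that by (simp add: Ve pairwise_def orthogonal_def)
  have "inj_on e C"
  proof (rule inj_onI, rule ccontr)
    fix c c' assume c: "c \<in> C" "c' \<in> C" "e c = e c'" "c \<noteq> c'"
    then have "V t (e c) = 0" using orth[of c c'] by simp
    then show False using Ve[OF c(1)] g[OF c(1)] C(1) c(1) by auto
  qed
  show thesis
  proof (rule that[of "e ` C"])
    show "finite (e ` C)" using C(4) by (simp add: independent_imp_finite)
    show "card (e ` C) = dim ?K" using card_image[OF \<open>inj_on e C\<close>] C(5) dimC by simp
    show "e ` C \<subseteq> ?K" using g(1) subspace_scale[OF subspace_focal_space] by (auto simp: e_def)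
    show "norm z = 1" if "z \<in> e ` C" for z using that g(3) by (auto simp: e_def)
    show "V t z \<bullet> V t w = 0" if "z \<in> e ` C" "w \<in> e ` C" "z \<noteq> w" for z w
      using that orth by blast
  qed
qed

text \<open>Rolle's theorem for \<open>\<langle>X z, V w\<rangle>\<close>, which vanishes at \<open>u\<close> and, by isotropy, at \<open>v\<close>.\<close>

lemma rolle_velocities:
  assumes uv: "u \<in> I" "v \<in> I" and zw: "z \<in> S" "w \<in> S" "X u z = 0" "X v w = 0"
    and eq: "u = v \<Longrightarrow> V u z \<bullet> V u w = 0"
  obtains \<xi> where "\<xi> \<in> I" "min u v \<le> \<xi>" "\<xi> \<le> max u v" "V \<xi> z \<bullet> V \<xi> w = X \<xi> z \<bullet> R \<xi> (X \<xi> w)"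
proof (cases "u = v")
  case True
  then show ?thesis using that[of u] assms by simp
next
  case False
  have "((\<lambda>t. X t z \<bullet> V t w) has_vector_derivative V t z \<bullet> V t w - X t z \<bullet> R t (X t w)) (at t within I)"
    if "t \<in> I" for t
    using deriv_X[OF that, of z] deriv_V[OF that, of w] unfolding has_vector_derivative_def
    by (auto intro!: derivative_eq_intros simp: algebra_simps fun_eq_iff)
  from mean_value[OF uv this] obtain \<xi> where \<xi>: "\<xi> \<in> I" "min u v \<le> \<xi>" "\<xi> \<le> max u v"
    "X v z \<bullet> V v w - X u z \<bullet> V u w = (v - u) * (V \<xi> z \<bullet> V \<xi> w - X \<xi> z \<bullet> R \<xi> (X \<xi> w))" by metis
  have "X v z \<bullet> V v w = 0" using isotropic[OF uv(2) zw(1,2)] zw(4) by simp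
  then show ?thesis using \<xi> zw(3) False that by simp
qed

end

text \<open>Convergence with moving time and moving parameter, along any indices tending to
  infinity, is the form in which compactness arguments use it. The two halves of the convergence of
  subspaces are separated: \<open>limit_in_S\<close> says that limits of parameters from
  \<open>Sn n\<close> lie in \<open>S\<close>, while the maps \<open>P n\<close> approximate every
  element of \<open>S\<close> from within \<open>Sn n\<close>.\<close>

locale jacobi_flow_limit = jacobi_flow I R X V S
  for I :: "real set" and R :: "real \<Rightarrow> 'a::euclidean_space \<Rightarrow>\<^sub>L 'a"
    and X V :: "real \<Rightarrow> 'e::euclidean_space \<Rightarrow> 'a" and S :: "'e set" +
  fixes Rn :: "nat \<Rightarrow> real \<Rightarrow> 'a \<Rightarrow>\<^sub>L 'a" and Xn Vn :: "nat \<Rightarrow> real \<Rightarrow> 'e \<Rightarrow> 'a"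
    and Sn :: "nat \<Rightarrow> 'e set" and P :: "nat \<Rightarrow> 'e \<Rightarrow> 'e"
  assumes flow: "jacobi_flow I (Rn n) (Xn n) (Vn n) (Sn n)"
    and conv_X: "filterlim \<nu> at_top sequentially \<Longrightarrow> (\<And>k. \<tau> k \<in> I) \<Longrightarrow> t \<in> I \<Longrightarrow> \<tau> \<longlonglongrightarrow> t \<Longrightarrow> \<zeta> \<longlonglongrightarrow> z \<Longrightarrow>
      (\<lambda>k. Xn (\<nu> k) (\<tau> k) (\<zeta> k)) \<longlonglongrightarrow> X t z"
    and conv_V: "filterlim \<nu> at_top sequentially \<Longrightarrow> (\<And>k. \<tau> k \<in> I) \<Longrightarrow> t \<in> I \<Longrightarrow> \<tau> \<longlonglongrightarrow> t \<Longrightarrow> \<zeta> \<longlonglongrightarrow> z \<Longrightarrow>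
      (\<lambda>k. Vn (\<nu> k) (\<tau> k) (\<zeta> k)) \<longlonglongrightarrow> V t z"
    and conv_R: "filterlim \<nu> at_top sequentially \<Longrightarrow> (\<And>k. \<tau> k \<in> I) \<Longrightarrow> t \<in> I \<Longrightarrow> \<tau> \<longlonglongrightarrow> t \<Longrightarrow>
      (\<lambda>k. Rn (\<nu> k) (\<tau> k)) \<longlonglongrightarrow> R t"
    and limit_in_S: "filterlim \<nu> at_top sequentially \<Longrightarrow> (\<And>k. \<zeta> k \<in> Sn (\<nu> k)) \<Longrightarrow> \<zeta> \<longlonglongrightarrow> z \<Longrightarrow> z \<in> S"
    and linear_P: "linear (P n)" and P_in: "z \<in> S \<Longrightarrow> P n z \<in> Sn n"
    and conv_P: "filterlim \<nu> at_top sequentially \<Longrightarrow> \<zeta> \<longlonglongrightarrow> z \<Longrightarrow> z \<in> S \<Longrightarrow> (\<lambda>k. P (\<nu> k) (\<zeta> k)) \<longlonglongrightarrow> z"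
begin

text \<open>A sequence violating the bound yields \<open>dim (focal_space X S s) + 1\<close> sequences of unit
  parameters with zeros tending to \<open>s\<close>. By \<open>rolle_velocities\<close> the velocities of
  the limit fields, which vanish at \<open>s\<close>, are pairwise orthogonal.\<close>

lemma focal_upper_local:
  assumes s: "s \<in> I"
  shows "\<exists>\<epsilon>>0. \<exists>n0. \<forall>n\<ge>n0. \<forall>F. finite F \<longrightarrow> F \<subseteq> I \<longrightarrow> (\<forall>t\<in>F. \<bar>t - s\<bar> < \<epsilon>) \<longrightarrow>
    (\<Sum>t\<in>F. dim (focal_space (Xn n) (Sn n) t)) \<le> dim (focal_space X S s)"
proof (rule ccontr)
  define m where "m = dim (focal_space X S s)"
  assume neg: "\<not> ?thesis"
  define Q where "Q k n F \<longleftrightarrow> k \<le> n \<and> finite F \<and> F \<subseteq> I \<and> (\<forall>t\<in>F. \<bar>t - s\<bar> < 1 / Suc k) \<and>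
      Suc m \<le> (\<Sum>t\<in>F. dim (focal_space (Xn n) (Sn n) t))" for k n F
  have "\<exists>n F. Q k n F" for k
  proof -
    have "1 / real (Suc k) > 0" by simp
    then have "\<not> (\<forall>n\<ge>k. \<forall>F. finite F \<longrightarrow> F \<subseteq> I \<longrightarrow> (\<forall>t\<in>F. \<bar>t - s\<bar> < 1 / Suc k) \<longrightarrow>
        (\<Sum>t\<in>F. dim (focal_space (Xn n) (Sn n) t)) \<le> m)"
      using neg unfolding m_def by blast
    then show ?thesis unfolding Q_def by (metis not_less_eq_eq)
  qed
  then obtain \<nu> F where Q: "\<And>k. Q k (\<nu> k) (F k)" by metis
  then have \<nu>: "\<And>k. \<nu> k \<ge> k" and F: "\<And>k. finite (F k)" "\<And>k. F k \<subseteq> I"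
      "\<And>k t. t \<in> F k \<Longrightarrow> \<bar>t - s\<bar> < 1 / Suc k"
      "\<And>k. Suc m \<le> (\<Sum>t\<in>F k. dim (focal_space (Xn (\<nu> k)) (Sn (\<nu> k)) t))"
    by (auto simp: Q_def)
  \<comment> \<open>\<open>e\<close> lists \<open>m + 1\<close> pairs of a focal time and a unit
    parameter vanishing there. Orthogonality of the velocities at a common time is recorded because
    Rolle's theorem says nothing when the two zeros coincide.\<close>
  define E where "E k e \<longleftrightarrow> (\<forall>i\<le>m. fst (e i) \<in> F k \<and>
      snd (e i) \<in> focal_space (Xn (\<nu> k)) (Sn (\<nu> k)) (fst (e i)) \<and> norm (snd (e i)) = 1 \<and>
      (\<forall>j\<le>m. i \<noteq> j \<longrightarrow> fst (e i) = fst (e j) \<longrightarrow>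
        Vn (\<nu> k) (fst (e i)) (snd (e i)) \<bullet> Vn (\<nu> k) (fst (e i)) (snd (e j)) = 0))"
    for k and e :: "nat \<Rightarrow> real \<times> 'e"
  have "\<exists>e. E k e" for k
  proof -
    interpret n: jacobi_flow I "Rn (\<nu> k)" "Xn (\<nu> k)" "Vn (\<nu> k)" "Sn (\<nu> k)" by (rule flow)
    let ?K = "focal_space (Xn (\<nu> k)) (Sn (\<nu> k))"
    define OB where "OB t B \<longleftrightarrow> finite B \<and> card B = dim (?K t) \<and> B \<subseteq> ?K t \<and> (\<forall>z\<in>B. norm z = 1) \<and>
        (\<forall>z\<in>B. \<forall>w\<in>B. z \<noteq> w \<longrightarrow> Vn (\<nu> k) t z \<bullet> Vn (\<nu> k) t w = 0)" for t B
    have "\<exists>B. OB t B" if "t \<in> I" for t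
      unfolding OB_def by (rule n.velocity_orthogonal_basis[OF that]) blast
    then obtain B where "\<And>t. t \<in> I \<Longrightarrow> OB t (B t)" by metis
    then have B: "\<And>t. t \<in> I \<Longrightarrow> finite (B t)" "\<And>t. t \<in> I \<Longrightarrow> card (B t) = dim (?K t)"
        "\<And>t. t \<in> I \<Longrightarrow> B t \<subseteq> ?K t" "\<And>t z. t \<in> I \<Longrightarrow> z \<in> B t \<Longrightarrow> norm z = 1"
        "\<And>t z w. t \<in> I \<Longrightarrow> z \<in> B t \<Longrightarrow> w \<in> B t \<Longrightarrow> z \<noteq> w \<Longrightarrow> Vn (\<nu> k) t z \<bullet> Vn (\<nu> k) t w = 0"
      by (auto simp: OB_def)
    have fin: "finite (Sigma (F k) B)" using F(1,2) B(1) by (intro finite_SigmaI) auto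
    have "card (Sigma (F k) B) = (\<Sum>t\<in>F k. dim (?K t))"
      using F(1)[of k] F(2)[of k] B(1,2) by (subst card_SigmaI) (auto intro!: sum.cong)
    then have "card {..m} \<le> card (Sigma (F k) B)" using F(4)[of k] by simp
    then obtain e where e: "e ` {..m} \<subseteq> Sigma (F k) B" "inj_on e {..m}"
      using card_le_inj[OF _ fin, of "{..m}"] by auto
    have mem: "fst (e i) \<in> F k" "snd (e i) \<in> B (fst (e i))" "fst (e i) \<in> I" if "i \<le> m" for i
    proof -
      have "e i \<in> Sigma (F k) B" using e(1) that by blast
      then show "fst (e i) \<in> F k" "snd (e i) \<in> B (fst (e i))" by auto
      then show "fst (e i) \<in> I" using F(2) by blast
    qed
    have mem': "snd (e i) \<in> ?K (fst (e i))" "norm (snd (e i)) = 1" if "i \<le> m" for i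
      using mem[OF that] B(3,4) by blast+
    have orth: "Vn (\<nu> k) (fst (e i)) (snd (e i)) \<bullet> Vn (\<nu> k) (fst (e i)) (snd (e j)) = 0"
      if "i \<le> m" "j \<le> m" "i \<noteq> j" "fst (e i) = fst (e j)" for i j
    proof (rule B(5))
      have "e i \<noteq> e j" using e(2) that by (auto dest: inj_onD)
      then show "snd (e i) \<noteq> snd (e j)" using that(4) by (metis prod_eqI)
    qed (use mem[OF that(1)] mem[OF that(2)] that(4) in auto)
    then have "E k e" unfolding E_def using mem(1) mem' by blast
    then show ?thesis by blast
  qed
  then obtain e where E: "\<And>k. E k (e k)" by metis
  then have e: "\<And>k i. i \<le> m \<Longrightarrow> fst (e k i) \<in> F k"
      "\<And>k i. i \<le> m \<Longrightarrow> snd (e k i) \<in> focal_space (Xn (\<nu> k)) (Sn (\<nu> k)) (fst (e k i))"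
      "\<And>k i. i \<le> m \<Longrightarrow> norm (snd (e k i)) = 1"
      "\<And>k i j. i \<le> m \<Longrightarrow> j \<le> m \<Longrightarrow> i \<noteq> j \<Longrightarrow> fst (e k i) = fst (e k j) \<Longrightarrow>
        Vn (\<nu> k) (fst (e k i)) (snd (e k i)) \<bullet> Vn (\<nu> k) (fst (e k i)) (snd (e k j)) = 0"
    unfolding E_def by blast+
  obtain r z where r: "strict_mono r" and z: "\<And>i. i < Suc m \<Longrightarrow> (\<lambda>k. snd (e (r k) i)) \<longlonglongrightarrow> z i"
    using common_convergent_subsequence[of "Suc m" "\<lambda>k i. snd (e k i)"] e(3) by (metis less_Suc_eq_le)
  define \<mu> where "\<mu> = \<nu> \<circ> r"
  define \<tau> where "\<tau> i k = fst (e (r k) i)" for i k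
  define \<zeta> where "\<zeta> i k = snd (e (r k) i)" for i k
  have "filterlim \<nu> at_top sequentially"
    by (rule filterlim_at_top_mono[OF filterlim_ident]) (simp add: \<nu>)
  then have \<mu>: "filterlim \<mu> at_top sequentially"
    unfolding \<mu>_def o_def by (rule filterlim_compose) (rule filterlim_subseq[OF r])
  have near: "\<xi> \<longlonglongrightarrow> s" if "\<And>k. \<bar>\<xi> k - s\<bar> < 1 / Suc (r k)" for \<xi>
  proof -
    have "(\<lambda>k. \<xi> k - s) \<longlonglongrightarrow> 0"
    proof (rule Lim_null_comparison[OF _ LIMSEQ_subseq_LIMSEQ[OF LIMSEQ_Suc[OF lim_1_over_n] r]])
      show "\<forall>\<^sub>F k in sequentially. norm (\<xi> k - s) \<le> ((\<lambda>n. 1 / of_nat (Suc n)) \<circ> r) k"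
        using that by (auto intro!: always_eventually less_imp_le)
    qed
    then show ?thesis by (simp add: LIM_zero_iff)
  qed
  have \<tau>I: "\<tau> i k \<in> I" "\<bar>\<tau> i k - s\<bar> < 1 / Suc (r k)" if "i \<le> m" for i k
    using e(1)[OF that] F(2,3) by (auto simp: \<tau>_def)
  have \<zeta>: "\<zeta> i k \<in> Sn (\<mu> k)" "Xn (\<mu> k) (\<tau> i k) (\<zeta> i k) = 0" if "i \<le> m" for i k
    using e(2)[OF that, of "r k"] by (auto simp: \<zeta>_def \<tau>_def \<mu>_def focal_space_def)
  have z: "\<zeta> i \<longlonglongrightarrow> z i" if "i \<le> m" for i
    using z[of i] that by (simp add: \<zeta>_def[abs_def])
  have zS: "z i \<in> S" if "i \<le> m" for i by (rule limit_in_S[OF \<mu> \<zeta>(1)[OF that] z[OF that]])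
  have nz: "z i \<noteq> 0" if "i \<le> m" for i
  proof -
    have "(\<lambda>k. norm (\<zeta> i k)) \<longlonglongrightarrow> norm (z i)" by (rule tendsto_norm[OF z[OF that]])
    then have "norm (z i) = 1" using e(3)[OF that] by (simp add: \<zeta>_def LIMSEQ_const_iff)
    then show ?thesis by auto
  qed
  have Xz: "X s (z i) = 0" if "i \<le> m" for i
  proof -
    have "(\<lambda>k. Xn (\<mu> k) (\<tau> i k) (\<zeta> i k)) \<longlonglongrightarrow> X s (z i)"
      using \<tau>I[OF that] by (intro conv_X \<mu> s near z that) auto
    then show ?thesis using \<zeta>(2)[OF that] by (simp add: LIMSEQ_const_iff)
  qed
  have orth: "V s (z i) \<bullet> V s (z j) = 0" if ij: "i \<le> m" "j \<le> m" "i \<noteq> j" for i j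
  proof -
    \<comment> \<open>The intermediate times depend on the pair \<open>i\<close>, \<open>j\<close>,
      but they lie between two zeros and so tend to \<open>s\<close>. There the right-hand side
      vanishes in the limit, since \<open>X s (z i) = 0\<close>.\<close>
    have "\<exists>\<xi>. \<xi> \<in> I \<and> \<bar>\<xi> - s\<bar> < 1 / real (Suc (r k)) \<and> Vn (\<mu> k) \<xi> (\<zeta> i k) \<bullet> Vn (\<mu> k) \<xi> (\<zeta> j k) =
        Xn (\<mu> k) \<xi> (\<zeta> i k) \<bullet> blinfun_apply (Rn (\<mu> k) \<xi>) (Xn (\<mu> k) \<xi> (\<zeta> j k))" for k
    proof -
      interpret n: jacobi_flow I "Rn (\<mu> k)" "Xn (\<mu> k)" "Vn (\<mu> k)" "Sn (\<mu> k)" by (rule flow)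
      have eq: "Vn (\<mu> k) (\<tau> i k) (\<zeta> i k) \<bullet> Vn (\<mu> k) (\<tau> i k) (\<zeta> j k) = 0" if "\<tau> i k = \<tau> j k"
        using e(4)[OF ij, of "r k"] that by (simp add: \<tau>_def \<zeta>_def \<mu>_def)
      obtain \<xi> where "\<xi> \<in> I" "min (\<tau> i k) (\<tau> j k) \<le> \<xi>" "\<xi> \<le> max (\<tau> i k) (\<tau> j k)"
        "Vn (\<mu> k) \<xi> (\<zeta> i k) \<bullet> Vn (\<mu> k) \<xi> (\<zeta> j k) = Xn (\<mu> k) \<xi> (\<zeta> i k) \<bullet> blinfun_apply (Rn (\<mu> k) \<xi>) (Xn (\<mu> k) \<xi> (\<zeta> j k))"
        using n.rolle_velocities[OF \<tau>I(1)[OF ij(1)] \<tau>I(1)[OF ij(2)] \<zeta>(1)[OF ij(1)] \<zeta>(1)[OF ij(2)]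
            \<zeta>(2)[OF ij(1)] \<zeta>(2)[OF ij(2)] eq] by blast
      moreover have "\<bar>\<xi> - s\<bar> < 1 / Suc (r k)"
        using calculation \<tau>I(2)[OF ij(1), of k] \<tau>I(2)[OF ij(2), of k] by linarith
      ultimately show ?thesis by blast
    qed
    then obtain \<xi> where \<xi>: "\<And>k. \<xi> k \<in> I" "\<And>k. \<bar>\<xi> k - s\<bar> < 1 / real (Suc (r k))"
      "\<And>k. Vn (\<mu> k) (\<xi> k) (\<zeta> i k) \<bullet> Vn (\<mu> k) (\<xi> k) (\<zeta> j k) =
        Xn (\<mu> k) (\<xi> k) (\<zeta> i k) \<bullet> blinfun_apply (Rn (\<mu> k) (\<xi> k)) (Xn (\<mu> k) (\<xi> k) (\<zeta> j k))" by metis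
    have Vl: "(\<lambda>k. Vn (\<mu> k) (\<xi> k) (\<zeta> l k)) \<longlonglongrightarrow> V s (z l)" if "l \<le> m" for l
      by (rule conv_V[OF \<mu> \<xi>(1) s near[OF \<xi>(2)] z[OF that]])
    have Xl: "(\<lambda>k. Xn (\<mu> k) (\<xi> k) (\<zeta> l k)) \<longlonglongrightarrow> X s (z l)" if "l \<le> m" for l
      by (rule conv_X[OF \<mu> \<xi>(1) s near[OF \<xi>(2)] z[OF that]])
    have Rl: "(\<lambda>k. Rn (\<mu> k) (\<xi> k)) \<longlonglongrightarrow> R s"
      by (rule conv_R[OF \<mu> \<xi>(1) s near[OF \<xi>(2)]])
    have "(\<lambda>k. Vn (\<mu> k) (\<xi> k) (\<zeta> i k) \<bullet> Vn (\<mu> k) (\<xi> k) (\<zeta> j k)) \<longlonglongrightarrow> V s (z i) \<bullet> V s (z j)"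
      by (rule tendsto_inner[OF Vl[OF ij(1)] Vl[OF ij(2)]])
    moreover have "(\<lambda>k. Xn (\<mu> k) (\<xi> k) (\<zeta> i k) \<bullet> blinfun_apply (Rn (\<mu> k) (\<xi> k)) (Xn (\<mu> k) (\<xi> k) (\<zeta> j k)))
        \<longlonglongrightarrow> X s (z i) \<bullet> R s (X s (z j))"
      by (rule tendsto_inner[OF Xl[OF ij(1)]
            bounded_bilinear.tendsto[OF bounded_bilinear_blinfun_apply Rl Xl[OF ij(2)]]])
    ultimately have "V s (z i) \<bullet> V s (z j) = X s (z i) \<bullet> R s (X s (z j))"
      unfolding \<xi>(3) by (rule LIMSEQ_unique)
    then show ?thesis using Xz[OF ij(1)] by simp
  qed
  have Vnz: "V s (z i) \<noteq> 0" if "i \<le> m" for i using inj[OF s Xz[OF that]] nz[OF that] by blast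
  let ?D = "(\<lambda>i. V s (z i)) ` {..m}"
  have "inj_on (\<lambda>i. V s (z i)) {..m}"
  proof (rule inj_onI, rule ccontr)
    fix i j assume "i \<in> {..m}" "j \<in> {..m}" "V s (z i) = V s (z j)" "i \<noteq> j"
    then show False using orth[of i j] Vnz[of j] by simp
  qed
  then have "card ?D = Suc m" by (simp add: card_image)
  moreover have "independent ?D"
  proof (rule pairwise_orthogonal_independent)
    have "V s (z i) \<bullet> V s (z j) = 0" if "i \<le> m" "j \<le> m" "V s (z i) \<noteq> V s (z j)" for i j
      using orth[OF that(1,2)] that(3) by (cases "i = j") auto
    then show "pairwise orthogonal ?D" unfolding pairwise_def orthogonal_def by blast
    show "0 \<notin> ?D" using Vnz by force
  qed
  moreover have "?D \<subseteq> V s ` focal_space X S s"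
    using zS Xz by (auto simp: focal_space_def)
  ultimately have "Suc m \<le> dim (V s ` focal_space X S s)"
    using independent_card_le_dim[of ?D "V s ` focal_space X S s"] by simp
  also have "\<dots> \<le> m" unfolding m_def by (rule dim_image_le[OF linear_V])
  finally show False by simp
qed

end

section \<open>Focal points of a limit: lower bound\<close>

text \<open>Symmetric on an isotropic space. A field with
  \<open>V t z = \<kappa> *\<^sub>R X t z\<close> belongs to the radical whether or not it vanishes
  at \<open>t\<close>; \<kappa> is a free parameter so that such fields can be avoided.\<close>

definition slope_form ::
  "(real \<Rightarrow> 'e \<Rightarrow> 'a::real_inner) \<Rightarrow> (real \<Rightarrow> 'e \<Rightarrow> 'a) \<Rightarrow> real \<Rightarrow> real \<Rightarrow> 'e \<Rightarrow> 'e \<Rightarrow> real"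
  where "slope_form X V \<kappa> t z w = X t z \<bullet> (V t w - \<kappa> *\<^sub>R X t w)"

context jacobi_flow
begin

text \<open>Makes results about limits applicable to a single flow, in particular the upper bound,
  which then yields finiteness of focal times.\<close>

lemma constant_limit: "jacobi_flow_limit I R X V S (\<lambda>_. R) (\<lambda>_. X) (\<lambda>_. V) (\<lambda>_. S) (\<lambda>_ z. z)"
proof (intro jacobi_flow_limit.intro jacobi_flow_limit_axioms.intro jacobi_flow_axioms)
  show "z \<in> S" if "\<And>k::nat. \<zeta> k \<in> S" "\<zeta> \<longlonglongrightarrow> z" for \<zeta> z
    using closed_sequentially[OF closed_subspace[OF subspace_S]] that by blast
qed (auto intro: tendsto_X tendsto_V tendsto_R bounded_linear.linear[OF bounded_linear_ident])

text \<open>If fields in \<open>S\<close> have slopes \<kappa> and \<mu> at \<open>s\<close>,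
  isotropy makes \<kappa> and \<mu> times the inner product of their values equal. Values for
  distinct slopes are thus orthogonal and nonzero, and only finitely many such vectors fit into a
  finite-dimensional space.\<close>

lemma ex_nondegenerate_slope:
  assumes s: "s \<in> I"
  shows "\<exists>\<kappa>. \<forall>z\<in>S. V s z = \<kappa> *\<^sub>R X s z \<longrightarrow> z = 0"
proof (rule ccontr)
  assume "\<not> ?thesis"
  then obtain z where z: "\<And>\<kappa>. z \<kappa> \<in> S" "\<And>\<kappa>. V s (z \<kappa>) = \<kappa> *\<^sub>R X s (z \<kappa>)" "\<And>\<kappa>. z \<kappa> \<noteq> 0"
    by metis
  have nz: "X s (z \<kappa>) \<noteq> 0" for \<kappa> using z(2,3)[of \<kappa>] inj[OF s, of "z \<kappa>"] by auto
  have orth: "X s (z \<kappa>) \<bullet> X s (z \<mu>) = 0" if "\<kappa> \<noteq> \<mu>" for \<kappa> \<mu>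
    using isotropic[OF s z(1)[of \<kappa>] z(1)[of \<mu>]] that by (simp add: z(2))
  have "inj (\<lambda>\<kappa>. X s (z \<kappa>))"
  proof (rule injI, rule ccontr)
    fix \<kappa> \<mu> assume "X s (z \<kappa>) = X s (z \<mu>)" "\<kappa> \<noteq> \<mu>"
    then show False using orth[of \<kappa> \<mu>] nz[of \<mu>] by simp
  qed
  moreover have "independent (range (\<lambda>\<kappa>. X s (z \<kappa>)))"
  proof (rule pairwise_orthogonal_independent)
    have "X s (z \<kappa>) \<bullet> X s (z \<mu>) = 0" if "X s (z \<kappa>) \<noteq> X s (z \<mu>)" for \<kappa> \<mu>
      using orth[of \<kappa> \<mu>] that by (cases "\<kappa> = \<mu>") auto
    then show "pairwise orthogonal (range (\<lambda>\<kappa>. X s (z \<kappa>)))" unfolding pairwise_def orthogonal_def by blast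
    show "0 \<notin> range (\<lambda>\<kappa>. X s (z \<kappa>))" using nz by force
  qed
  ultimately have "finite (UNIV :: real set)"
    using independent_imp_finite finite_imageD by blast
  then show False using infinite_UNIV_char_0 by blast
qed

lemma bilinear_slope_form: "bilinear (slope_form X V \<kappa> t)"
  unfolding bilinear_def slope_form_def
  using linear_X[of t] linear_V[of t]
  by (auto intro!: linearI simp: linear_add linear_scale algebra_simps inner_add_left inner_diff_right)

lemma slope_form_sym:
  "t \<in> I \<Longrightarrow> z \<in> S \<Longrightarrow> w \<in> S \<Longrightarrow> slope_form X V \<kappa> t z w = slope_form X V \<kappa> t w z"
  using isotropic[of t z w] by (simp add: slope_form_def inner_diff_right inner_commute)

text \<open>This is where half-dimensionality enters: \<open>T\<close> is injective on
  \<open>S\<close>, and equality of dimensions makes it surjective. A vector of the radical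
  therefore has a value orthogonal to the whole space.\<close>

lemma radical_slope_form:
  assumes t: "t \<in> I" and dim: "dim S = DIM('a)"
    and nondeg: "\<And>z. z \<in> S \<Longrightarrow> V t z = \<kappa> *\<^sub>R X t z \<Longrightarrow> z = 0"
  shows "radical (slope_form X V \<kappa> t) S = focal_space X S t"
proof -
  define T where "T z = V t z - \<kappa> *\<^sub>R X t z" for z
  have T: "linear T"
    unfolding T_def using linear_V[of t] linear_X[of t]
    by (auto intro!: linearI simp: linear_add linear_scale algebra_simps)
  have "inj_on T S"
  proof (rule inj_onI)
    fix x y assume "x \<in> S" "y \<in> S" "T x = T y"
    then have "x - y \<in> S" "T (x - y) = 0" using subspace_S T by (auto simp: subspace_diff linear_diff)
    then show "x = y" using nondeg[of "x - y"] by (simp add: T_def)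
  qed
  then have "dim (T ` S) = DIM('a)"
    using dim subspace_S by (subst dim_image_eq[OF T]) (simp_all add: span_eq_iff[THEN iffD2])
  then have TS: "T ` S = UNIV"
    using linear_subspace_image[OF T subspace_S] dim_eq_full span_eq_iff by metis
  show ?thesis
  proof (intro set_eqI iffI)
    fix z assume z: "z \<in> radical (slope_form X V \<kappa> t) S"
    obtain w where w: "w \<in> S" "T w = X t z" using TS by (metis UNIV_I imageE)
    then have "X t z \<bullet> X t z = 0" using z by (auto simp: radical_def slope_form_def T_def)
    then show "z \<in> focal_space X S t" using z by (simp add: focal_space_def radical_def)
  qed (simp add: focal_space_def radical_def slope_form_def)
qed

lemma slope_form_deriv:
  assumes "t \<in> I"
  shows "((\<lambda>t. slope_form X V \<kappa> t z z) has_vector_derivative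
    V t z \<bullet> (V t z - \<kappa> *\<^sub>R X t z) - X t z \<bullet> (R t (X t z) + \<kappa> *\<^sub>R V t z)) (at t within I)"
  using deriv_X[OF assms, of z] deriv_V[OF assms, of z]
  unfolding has_vector_derivative_def slope_form_def
  by (auto intro!: derivative_eq_intros simp: algebra_simps fun_eq_iff inner_diff_right inner_add_right)

lemma tendsto_slope_form:
  assumes "\<And>k::nat. \<tau> k \<in> I" "t \<in> I" "\<tau> \<longlonglongrightarrow> t" "\<zeta> \<longlonglongrightarrow> z"
  shows "(\<lambda>k. slope_form X V \<kappa> (\<tau> k) (\<zeta> k) (\<zeta> k)) \<longlonglongrightarrow> slope_form X V \<kappa> t z z"
  unfolding slope_form_def
  by (rule tendsto_inner tendsto_diff tendsto_scaleR tendsto_const tendsto_X[OF assms] tendsto_V[OF assms])+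

lemma slope_form_scale: "slope_form X V \<kappa> t (c *\<^sub>R z) (c *\<^sub>R z) = c\<^sup>2 * slope_form X V \<kappa> t z z"
  by (simp add: slope_form_def X_scale V_scale power2_eq_square algebra_simps)

text \<open>On null vectors with \<open>X s z = 0\<close> the form increases with speed \<open>|V s z|\<^sup>2 > 0\<close>.
  The sign \<open>\<sigma>\<close> selects the side of \<open>s\<close>.\<close>

lemma slope_form_definite_nearby:
  assumes s: "s \<in> I" and U: "subspace U" and \<sigma>: "\<sigma> = 1 \<or> \<sigma> = -1"
    and semi: "\<And>z. z \<in> U \<Longrightarrow> 0 \<le> \<sigma> * slope_form X V \<kappa> s z z"
    and null: "\<And>z. z \<in> U \<Longrightarrow> slope_form X V \<kappa> s z z = 0 \<Longrightarrow> X s z = 0"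
  shows "\<exists>\<delta>>0. \<forall>t\<in>I. \<bar>t - s\<bar> < \<delta> \<longrightarrow> 0 < \<sigma> * (t - s) \<longrightarrow>
    (\<forall>z\<in>U. z \<noteq> 0 \<longrightarrow> 0 < \<sigma> * slope_form X V \<kappa> t z z)"
proof (rule near_by_sequences)
  let ?q = "\<lambda>t z. slope_form X V \<kappa> t z z"
  fix \<tau> :: "nat \<Rightarrow> real" assume \<tau>: "\<And>k. \<tau> k \<in> I" "\<tau> \<longlonglongrightarrow> s"
  have "\<forall>\<^sub>F k in sequentially. \<forall>z. z \<in> U \<and> 0 < \<sigma> * (\<tau> k - s) \<and> \<sigma> * ?q (\<tau> k) z \<le> 0 \<longrightarrow> z = 0"
  proof (rule eventually_zero_by_compactness)
    fix k z and c :: real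
    assume *: "z \<in> U \<and> 0 < \<sigma> * (\<tau> k - s) \<and> \<sigma> * ?q (\<tau> k) z \<le> 0" "c > 0"
    have "\<sigma> * ?q (\<tau> k) (c *\<^sub>R z) = c\<^sup>2 * (\<sigma> * ?q (\<tau> k) z)" by (simp add: slope_form_scale)
    also have "\<dots> \<le> 0" by (rule mult_nonneg_nonpos) (use * in auto)
    finally show "c *\<^sub>R z \<in> U \<and> 0 < \<sigma> * (\<tau> k - s) \<and> \<sigma> * ?q (\<tau> k) (c *\<^sub>R z) \<le> 0"
      using U * by (simp add: subspace_scale)
  next
    fix r :: "nat \<Rightarrow> nat" and \<zeta> z
    assume r: "strict_mono r"
      and \<zeta>: "\<And>k. \<zeta> k \<in> U \<and> 0 < \<sigma> * (\<tau> (r k) - s) \<and> \<sigma> * ?q (\<tau> (r k)) (\<zeta> k) \<le> 0"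
      and z: "\<zeta> \<longlonglongrightarrow> z" "norm z = 1"
    have lim: "(\<lambda>k. \<tau> (r k)) \<longlonglongrightarrow> s" using LIMSEQ_subseq_LIMSEQ[OF \<tau>(2) r] by (simp add: o_def)
    have zU: "z \<in> U" using closed_sequentially[OF closed_subspace[OF U]] \<zeta> z(1) by blast
    have "(\<lambda>k. \<sigma> * ?q (\<tau> (r k)) (\<zeta> k)) \<longlonglongrightarrow> \<sigma> * ?q s z"
      by (rule tendsto_mult[OF tendsto_const tendsto_slope_form[OF \<tau>(1) s lim z(1)]])
    then have "\<sigma> * ?q s z \<le> 0" using \<zeta> by (intro LIMSEQ_le_const2) auto
    then have "?q s z = 0" using semi[OF zU] \<sigma> by auto
    then have X0: "X s z = 0" using null zU by blast
    let ?q' = "\<lambda>t z. V t z \<bullet> (V t z - \<kappa> *\<^sub>R X t z) - X t z \<bullet> (blinfun_apply (R t) (X t z) + \<kappa> *\<^sub>R V t z)"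
    \<comment> \<open>The form times \<sigma> is nonnegative at \<open>s\<close> and nonpositive at
      \<open>\<tau> (r k)\<close>, and \<open>\<tau> (r k) - s\<close> has the sign of \<sigma>. The
      mean value theorem thus gives a nonpositive derivative in between, whose limit is the square
      of the norm of \<open>V s z\<close>.\<close>
    have "\<exists>\<xi>. \<xi> \<in> I \<and> \<bar>\<xi> - s\<bar> \<le> \<bar>\<tau> (r k) - s\<bar> \<and> ?q' \<xi> (\<zeta> k) \<le> 0" for k
    proof -
      obtain \<xi> where \<xi>: "\<xi> \<in> I" "min s (\<tau> (r k)) \<le> \<xi>" "\<xi> \<le> max s (\<tau> (r k))"
        "?q (\<tau> (r k)) (\<zeta> k) - ?q s (\<zeta> k) = (\<tau> (r k) - s) * ?q' \<xi> (\<zeta> k)"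
        using mean_value[OF s \<tau>(1) slope_form_deriv] by metis
      have "\<sigma> * (\<tau> (r k) - s) * ?q' \<xi> (\<zeta> k) = \<sigma> * ?q (\<tau> (r k)) (\<zeta> k) - \<sigma> * ?q s (\<zeta> k)"
        by (simp only: \<xi>(4) mult.assoc flip: right_diff_distrib)
      also have "\<dots> \<le> 0" using \<zeta>[of k] semi[of "\<zeta> k"] by linarith
      finally have "?q' \<xi> (\<zeta> k) \<le> 0" using \<zeta>[of k] by (metis mult_le_0_iff not_less)
      moreover have "\<bar>\<xi> - s\<bar> \<le> \<bar>\<tau> (r k) - s\<bar>" using \<xi>(2,3) by linarith
      ultimately show ?thesis using \<xi>(1) by blast
    qed
    then obtain \<xi> where \<xi>: "\<And>k. \<xi> k \<in> I" "\<And>k. \<bar>\<xi> k - s\<bar> \<le> \<bar>\<tau> (r k) - s\<bar>"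
        "\<And>k. ?q' (\<xi> k) (\<zeta> k) \<le> 0" by metis
    have "(\<lambda>k. \<xi> k - s) \<longlonglongrightarrow> 0"
    proof (rule Lim_null_comparison)
      show "(\<lambda>k. \<bar>\<tau> (r k) - s\<bar>) \<longlonglongrightarrow> 0"
        using lim by (simp add: LIM_zero tendsto_rabs_zero)
    qed (use \<xi>(2) in auto)
    then have \<xi>s: "\<xi> \<longlonglongrightarrow> s" by (simp add: LIM_zero_iff)
    note Xl = tendsto_X[OF \<xi>(1) s \<xi>s z(1)] and Vl = tendsto_V[OF \<xi>(1) s \<xi>s z(1)]
      and Rl = tendsto_R[OF \<xi>(1) s \<xi>s]
    have "(\<lambda>k. ?q' (\<xi> k) (\<zeta> k)) \<longlonglongrightarrow> ?q' s z"
      by (rule tendsto_inner tendsto_diff tendsto_add tendsto_scaleR tendsto_const Xl Vl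
          bounded_bilinear.tendsto[OF bounded_bilinear_blinfun_apply Rl])+
    then have "?q' s z \<le> 0" using \<xi>(3) by (intro LIMSEQ_le_const2) auto
    then have "V s z \<bullet> V s z \<le> 0" using X0 by simp
    then have "V s z = 0" by (metis inner_eq_zero_iff inner_ge_zero order_antisym)
    then show False using inj[OF s X0] z(2) by simp
  qed
  then show "\<forall>\<^sub>F k in sequentially. 0 < \<sigma> * (\<tau> k - s) \<longrightarrow>
      (\<forall>z\<in>U. z \<noteq> 0 \<longrightarrow> 0 < \<sigma> * ?q (\<tau> k) z)"
    by eventually_elim force
qed

end

lemma sum_le_sum_cover:
  fixes f :: "'b \<Rightarrow> nat"
  assumes "finite D" "finite F" "F \<subseteq> (\<Union>s\<in>D. A s)"
  shows "sum f F \<le> (\<Sum>s\<in>D. sum f (F \<inter> A s))"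
proof -
  have "sum f F \<le> (\<Sum>t\<in>F. \<Sum>s\<in>D. if t \<in> A s then f t else 0)"
  proof (rule sum_mono)
    fix t assume "t \<in> F"
    then obtain s where s: "s \<in> D" "t \<in> A s" using assms(3) by blast
    have "f t \<le> (if t \<in> A s then f t else 0)" using s by simp
    also have "\<dots> \<le> (\<Sum>s\<in>D. if t \<in> A s then f t else 0)"
      using s assms(1) by (intro member_le_sum) auto
    finally show "f t \<le> \<dots>" .
  qed
  also have "\<dots> = (\<Sum>s\<in>D. \<Sum>t\<in>F. if t \<in> A s then f t else 0)" by (rule sum.swap)
  also have "\<dots> = (\<Sum>s\<in>D. sum f (F \<inter> A s))"
    using assms(2) by (simp add: sum.inter_restrict)
  finally show ?thesis .
qed

context jacobi_flow_limit
begin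

text \<open>The centres of a finite subcover serve as \<open>D\<close>, so the bound is itself a
  partial sum of the index of the limit. Overlapping balls can only count focal times more than
  once, which is harmless here. The estimate is uniform in \<open>F\<close>, so no finiteness of
  focal times is presupposed.\<close>

lemma focal_upper_global:
  assumes ab: "{a..b} \<subseteq> I"
  shows "\<exists>D n0. finite D \<and> D \<subseteq> {a..b} \<and> (\<forall>n\<ge>n0. \<forall>F. finite F \<longrightarrow> F \<subseteq> {a..b} \<longrightarrow>
    (\<Sum>t\<in>F. dim (focal_space (Xn n) (Sn n) t)) \<le> (\<Sum>s\<in>D. dim (focal_space X S s)))"
proof -
  define Q where "Q s \<epsilon> n0 \<longleftrightarrow> 0 < \<epsilon> \<and> (\<forall>n\<ge>n0. \<forall>F. finite F \<longrightarrow> F \<subseteq> I \<longrightarrow> (\<forall>t\<in>F. \<bar>t - s\<bar> < \<epsilon>) \<longrightarrow>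
      (\<Sum>t\<in>F. dim (focal_space (Xn n) (Sn n) t)) \<le> dim (focal_space X S s))" for s \<epsilon> n0
  have "\<exists>\<epsilon> n0. Q s \<epsilon> n0" if "s \<in> I" for s
    using focal_upper_local[OF that] unfolding Q_def by blast
  then obtain \<epsilon> n0 where Q: "\<And>s. s \<in> I \<Longrightarrow> Q s (\<epsilon> s) (n0 s)" by metis
  have cover: "{a..b} \<subseteq> (\<Union>s\<in>{a..b}. ball s (\<epsilon> s))"
  proof
    fix s assume s: "s \<in> {a..b}"
    then have "Q s (\<epsilon> s) (n0 s)" using Q ab by blast
    then show "s \<in> (\<Union>s\<in>{a..b}. ball s (\<epsilon> s))" using s by (intro UN_I[of s]) (simp_all add: Q_def)
  qed
  obtain D where D: "D \<subseteq> {a..b}" "finite D" "{a..b} \<subseteq> (\<Union>s\<in>D. ball s (\<epsilon> s))"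
    by (rule compactE_image[OF compact_Icc _ cover]) (rule open_ball, rule that)
  show ?thesis
  proof (intro exI conjI allI impI)
    show "finite D" "D \<subseteq> {a..b}" by fact+
    \<comment> \<open>The inserted 0 gives the maximum a value when \<open>{a..b}\<close>, and with
      it \<open>D\<close>, is empty.\<close>
    fix n F assume n: "Max (insert 0 (n0 ` D)) \<le> n" and F: "finite F" "F \<subseteq> {a..b}"
    let ?f = "\<lambda>t. dim (focal_space (Xn n) (Sn n) t)"
    have "sum ?f F \<le> (\<Sum>s\<in>D. sum ?f (F \<inter> ball s (\<epsilon> s)))"
      using D F by (intro sum_le_sum_cover) auto
    also have "\<dots> \<le> (\<Sum>s\<in>D. dim (focal_space X S s))"
    proof (rule sum_mono)
      fix s assume s: "s \<in> D"
      have "n0 s \<le> n" using n D(2) s by simp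
      moreover have "Q s (\<epsilon> s) (n0 s)" using Q s D(1) ab by blast
      ultimately have "sum ?f G \<le> dim (focal_space X S s)"
        if "finite G" "G \<subseteq> I" "\<forall>t\<in>G. \<bar>t - s\<bar> < \<epsilon> s" for G
        using that by (simp add: Q_def)
      moreover have "F \<inter> ball s (\<epsilon> s) \<subseteq> I" using F(2) ab by blast
      moreover have "\<forall>t\<in>F \<inter> ball s (\<epsilon> s). \<bar>t - s\<bar> < \<epsilon> s"
        by (simp add: dist_real_def abs_minus_commute)
      ultimately show "sum ?f (F \<inter> ball s (\<epsilon> s)) \<le> dim (focal_space X S s)"
        using F(1) by simp
    qed
    finally show "sum ?f F \<le> (\<Sum>s\<in>D. dim (focal_space X S s))" .
  qed
qed

end

text \<open>For the constant sequence the upper bound limits the sum of focal indices over every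
  finite set of times; each focal time contributes at least 1, so the cardinalities are
  bounded.\<close>

lemma (in jacobi_flow) finite_focal_times:
  assumes ab: "{a..b} \<subseteq> I"
  shows "finite {t \<in> {a..b}. dim (focal_space X S t) \<noteq> 0}"
proof -
  interpret L: jacobi_flow_limit I R X V S "\<lambda>_. R" "\<lambda>_. X" "\<lambda>_. V" "\<lambda>_. S" "\<lambda>_ z. z"
    by (rule constant_limit)
  from L.focal_upper_global[OF ab]
  obtain D :: "real set" and n0 :: nat where "\<forall>n\<ge>n0. \<forall>F. finite F \<longrightarrow> F \<subseteq> {a..b} \<longrightarrow>
      (\<Sum>t\<in>F. dim (focal_space X S t)) \<le> (\<Sum>s\<in>D. dim (focal_space X S s))"
    by (elim exE conjE) (rule that)
  then have D: "(\<Sum>t\<in>F. dim (focal_space X S t)) \<le> (\<Sum>s\<in>D. dim (focal_space X S s))"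
    if "finite F" "F \<subseteq> {a..b}" for F
    using that by (metis order_refl)
  have "?thesis \<and> card {t \<in> {a..b}. dim (focal_space X S t) \<noteq> 0} \<le> (\<Sum>s\<in>D. dim (focal_space X S s))"
  proof (rule finite_if_finite_subsets_card_bdd)
    fix F assume F: "F \<subseteq> {t \<in> {a..b}. dim (focal_space X S t) \<noteq> 0}" "finite F"
    have "card F \<le> (\<Sum>t\<in>F. dim (focal_space X S t))"
    proof -
      have "(\<Sum>t\<in>F. 1) \<le> (\<Sum>t\<in>F. dim (focal_space X S t))"
      proof (rule sum_mono)
        fix t assume "t \<in> F"
        then have "dim (focal_space X S t) \<noteq> 0" using F(1) by blast
        then show "1 \<le> dim (focal_space X S t)" by linarith
      qed
      then show ?thesis by simp
    qed
    also have "\<dots> \<le> (\<Sum>s\<in>D. dim (focal_space X S s))"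
      by (rule D) (use F in auto)
    finally show "card F \<le> (\<Sum>s\<in>D. dim (focal_space X S s))" .
  qed
  then show ?thesis ..
qed

context jacobi_flow_limit
begin

lemma tendsto_slope_form_seq:
  assumes "filterlim \<nu> at_top sequentially" "t \<in> I" "\<zeta> \<longlonglongrightarrow> z"
  shows "(\<lambda>k. slope_form (Xn (\<nu> k)) (Vn (\<nu> k)) \<kappa> t (\<zeta> k) (\<zeta> k)) \<longlonglongrightarrow> slope_form X V \<kappa> t z z"
  unfolding slope_form_def
  by (rule tendsto_inner tendsto_diff tendsto_scaleR tendsto_const
      conv_X[OF assms(1) assms(2) assms(2) tendsto_const assms(3)]
      conv_V[OF assms(1) assms(2) assms(2) tendsto_const assms(3)])+

text \<open>A unit limit of degenerate parameters would be an element of \<open>S\<close> of slope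
  \<kappa> at \<open>s\<close>. One \<kappa> thus serves a whole time interval and all large
  \<open>n\<close>, as is needed to follow a single form from one side of \<open>s\<close> to the
  other.\<close>

lemma nondegenerate_slope_nearby:
  assumes s: "s \<in> I" and nondeg: "\<And>z. z \<in> S \<Longrightarrow> V s z = \<kappa> *\<^sub>R X s z \<Longrightarrow> z = 0"
  shows "\<exists>\<delta>>0. \<exists>n0. \<forall>n\<ge>n0. \<forall>t\<in>I. \<bar>t - s\<bar> < \<delta> \<longrightarrow>
    (\<forall>z\<in>Sn n. Vn n t z = \<kappa> *\<^sub>R Xn n t z \<longrightarrow> z = 0)"
proof (rule near_by_sequences2)
  fix \<nu> :: "nat \<Rightarrow> nat" and \<tau> assume \<nu>: "filterlim \<nu> at_top sequentially" and \<tau>: "\<And>k. \<tau> k \<in> I" "\<tau> \<longlonglongrightarrow> s"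
  have "\<forall>\<^sub>F k in sequentially. \<forall>z. z \<in> Sn (\<nu> k) \<and> Vn (\<nu> k) (\<tau> k) z = \<kappa> *\<^sub>R Xn (\<nu> k) (\<tau> k) z \<longrightarrow> z = 0"
  proof (rule eventually_zero_by_compactness)
    fix k z and c :: real
    interpret n: jacobi_flow I "Rn (\<nu> k)" "Xn (\<nu> k)" "Vn (\<nu> k)" "Sn (\<nu> k)" by (rule flow)
    assume "z \<in> Sn (\<nu> k) \<and> Vn (\<nu> k) (\<tau> k) z = \<kappa> *\<^sub>R Xn (\<nu> k) (\<tau> k) z"
    then show "c *\<^sub>R z \<in> Sn (\<nu> k) \<and> Vn (\<nu> k) (\<tau> k) (c *\<^sub>R z) = \<kappa> *\<^sub>R Xn (\<nu> k) (\<tau> k) (c *\<^sub>R z)"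
      using n.subspace_S by (simp add: n.X_scale n.V_scale subspace_scale mult.commute)
  next
    fix r :: "nat \<Rightarrow> nat" and \<zeta> z
    assume r: "strict_mono r" and \<zeta>: "\<And>k. \<zeta> k \<in> Sn (\<nu> (r k)) \<and>
        Vn (\<nu> (r k)) (\<tau> (r k)) (\<zeta> k) = \<kappa> *\<^sub>R Xn (\<nu> (r k)) (\<tau> (r k)) (\<zeta> k)"
      and z: "\<zeta> \<longlonglongrightarrow> z" "norm z = 1"
    have \<nu>r: "filterlim (\<lambda>k. \<nu> (r k)) at_top sequentially"
      by (rule filterlim_compose[OF \<nu> filterlim_subseq[OF r]])
    have lim: "(\<lambda>k. \<tau> (r k)) \<longlonglongrightarrow> s" using LIMSEQ_subseq_LIMSEQ[OF \<tau>(2) r] by (simp add: o_def)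
    have "z \<in> S" by (rule limit_in_S[OF \<nu>r _ z(1)]) (use \<zeta> in blast)
    moreover have "V s z = \<kappa> *\<^sub>R X s z"
    proof (rule LIMSEQ_unique[OF conv_V[OF \<nu>r \<tau>(1) s lim z(1)]])
      show "(\<lambda>k. Vn (\<nu> (r k)) (\<tau> (r k)) (\<zeta> k)) \<longlonglongrightarrow> \<kappa> *\<^sub>R X s z"
        using \<zeta> tendsto_scaleR[OF tendsto_const conv_X[OF \<nu>r \<tau>(1) s lim z(1)], of \<kappa>] by simp
    qed
    ultimately show False using nondeg z(2) by force
  qed
  then show "\<forall>\<^sub>F k in sequentially. \<forall>z\<in>Sn (\<nu> k). Vn (\<nu> k) (\<tau> k) z = \<kappa> *\<^sub>R Xn (\<nu> k) (\<tau> k) z \<longrightarrow> z = 0"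
    by eventually_elim blast
qed

text \<open>On \<open>U\<close> the maps \<open>P n\<close> tend to the identity, so positivity of
  the form at \<open>P n z\<close> for nonzero \<open>z\<close> in \<open>U\<close> is inherited
  from the limit. The same inequality shows that \<open>P n\<close> is injective on
  \<open>U\<close>, since the form vanishes at 0, and hence that the dimension is preserved.\<close>

lemma definite_transfer:
  assumes t: "t \<in> I" and U: "subspace U" "U \<subseteq> S"
    and pos: "\<And>z. z \<in> U \<Longrightarrow> z \<noteq> 0 \<Longrightarrow> 0 < \<sigma> * slope_form X V \<kappa> t z z"
  shows "\<forall>\<^sub>F n in sequentially. subspace (P n ` U) \<and> P n ` U \<subseteq> Sn n \<and> dim (P n ` U) = dim U \<and>
    (\<forall>z\<in>P n ` U. z \<noteq> 0 \<longrightarrow> 0 < \<sigma> * slope_form (Xn n) (Vn n) \<kappa> t z z)"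
proof -
  let ?q = "\<lambda>n z. slope_form (Xn n) (Vn n) \<kappa> t z z"
  have "\<forall>\<^sub>F n in sequentially. \<forall>z. z \<in> U \<and> \<sigma> * ?q n (P n z) \<le> 0 \<longrightarrow> z = 0"
  proof (rule eventually_zero_by_compactness)
    fix n z and c :: real
    interpret n: jacobi_flow I "Rn n" "Xn n" "Vn n" "Sn n" by (rule flow)
    assume *: "z \<in> U \<and> \<sigma> * ?q n (P n z) \<le> 0" "c > 0"
    have "\<sigma> * ?q n (P n (c *\<^sub>R z)) = c\<^sup>2 * (\<sigma> * ?q n (P n z))"
      by (simp add: linear_scale[OF linear_P] n.slope_form_scale)
    also have "\<dots> \<le> 0" by (rule mult_nonneg_nonpos) (use * in auto)
    finally show "c *\<^sub>R z \<in> U \<and> \<sigma> * ?q n (P n (c *\<^sub>R z)) \<le> 0"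
      using * U(1) by (simp add: subspace_scale)
  next
    fix r :: "nat \<Rightarrow> nat" and \<zeta> z
    assume r: "strict_mono r" and \<zeta>: "\<And>k. \<zeta> k \<in> U \<and> \<sigma> * ?q (r k) (P (r k) (\<zeta> k)) \<le> 0"
      and z: "\<zeta> \<longlonglongrightarrow> z" "norm z = 1"
    have zU: "z \<in> U" using closed_sequentially[OF closed_subspace[OF U(1)]] \<zeta> z(1) by blast
    note r' = filterlim_subseq[OF r]
    have "(\<lambda>k. \<sigma> * ?q (r k) (P (r k) (\<zeta> k))) \<longlonglongrightarrow> \<sigma> * slope_form X V \<kappa> t z z"
      using zU U by (intro tendsto_mult[OF tendsto_const] tendsto_slope_form_seq[OF r' t] conv_P[OF r' z(1)]) auto
    then have "\<sigma> * slope_form X V \<kappa> t z z \<le> 0" using \<zeta> by (intro LIMSEQ_le_const2) auto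
    then show False using pos[OF zU] z(2) by force
  qed
  then show ?thesis
  proof eventually_elim
    case (elim n)
    interpret n: jacobi_flow I "Rn n" "Xn n" "Vn n" "Sn n" by (rule flow)
    have inj: "inj_on (P n) U"
    proof (rule inj_onI)
      fix x y assume xy: "x \<in> U" "y \<in> U" "P n x = P n y"
      then have "P n (x - y) = 0" by (simp add: linear_diff[OF linear_P])
      then have "\<sigma> * ?q n (P n (x - y)) \<le> 0" by (simp add: slope_form_def)
      then show "x = y" using elim xy U(1) by (metis eq_iff_diff_eq_0 subspace_diff)
    qed
    have "dim (P n ` U) = dim U"
      using inj U(1) by (intro dim_image_eq[OF linear_P]) (simp add: span_eq_iff[THEN iffD2])
    moreover have "0 < \<sigma> * ?q n (P n z)" if "z \<in> U" "P n z \<noteq> 0" for z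
      using elim that linear_0[OF linear_P, of n] by (metis not_le)
    ultimately show ?case
      using linear_subspace_image[OF linear_P U(1)] P_in U(2) by auto
  qed
qed

text \<open>With \<open>K\<close> the kernel of the form at \<open>s\<close>, the index on
  \<open>Sn n\<close> is at least \<open>dim N + dim K\<close> at a time \<open>u\<close> before
  \<open>s\<close>, because the transferred \<open>N + K\<close> is negative. At a time
  \<open>v\<close> after \<open>s\<close> it is at most \<open>dim N\<close>, because the
  transferred \<open>M\<close> is positive and has codimension \<open>dim N\<close>. The loss
  \<open>dim K\<close> must be paid for by nullities in between.\<close>

lemma focal_lower_local:
  assumes cd: "{c..d} \<subseteq> I" and s: "c < s" "s < d"
    and dim: "dim S = DIM('a)" "\<And>n. dim (Sn n) = DIM('a)"
  shows "\<forall>\<^sub>F n in sequentially. \<exists>F. finite F \<and> F \<subseteq> {c..d} \<and>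
    dim (focal_space X S s) \<le> (\<Sum>t\<in>F. dim (focal_space (Xn n) (Sn n) t))"
proof -
  have sI: "s \<in> I" using cd s by auto
  obtain \<kappa> where \<kappa>: "\<And>z. z \<in> S \<Longrightarrow> V s z = \<kappa> *\<^sub>R X s z \<Longrightarrow> z = 0"
    using ex_nondegenerate_slope[OF sI] by blast
  define b where "b = slope_form X V \<kappa>"
  have rad: "radical (b s) S = focal_space X S s"
    unfolding b_def by (rule radical_slope_form[OF sI dim(1) \<kappa>])
  have bil: "bilinear (b t)" for t unfolding b_def by (rule bilinear_slope_form)
  have sym: "b s z w = b s w z" if "z \<in> S" "w \<in> S" for z w
    unfolding b_def by (rule slope_form_sym[OF sI that])
  obtain N M where N: "negative_on (b s) S N" "dim N = negdim (b s) S"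
    and M: "subspace M" "M \<subseteq> S" "dim N + dim M = dim S" "\<And>z. z \<in> M \<Longrightarrow> b s z z \<ge> 0"
      "\<And>z. z \<in> M \<Longrightarrow> b s z z = 0 \<Longrightarrow> z \<in> radical (b s) S" "radical (b s) S \<subseteq> M"
      "\<And>z w. z \<in> N \<Longrightarrow> w \<in> M \<Longrightarrow> b s z w = 0"
    by (rule negative_decomposition[OF bil[of s] subspace_S]) (erule (1) sym, rule that)
  have sN: "subspace N" "N \<subseteq> S" and neg: "\<And>z. z \<in> N \<Longrightarrow> z \<noteq> 0 \<Longrightarrow> b s z z < 0"
    using N(1) by (auto simp: negative_on_def)
  define K where "K = focal_space X S s"
  have K: "subspace K" "K \<subseteq> S" using subspace_focal_space by (auto simp: K_def focal_space_def)
  \<comment> \<open>On \<open>N + K\<close> the form at \<open>s\<close> is nonpositive with null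
    space exactly \<open>K\<close>. The elements of \<open>K\<close> have a form increasing through
    0 at \<open>s\<close>, so just before \<open>s\<close> all of \<open>U\<close> is negative; for
    the same reason all of \<open>M\<close> is positive just after \<open>s\<close>.\<close>
  define U where "U = {x + y |x y. x \<in> N \<and> y \<in> K}"
  have U: "subspace U" "U \<subseteq> S"
    using subspace_sums[OF sN(1) K(1)] sN(2) K(2) subspace_S by (auto simp: U_def subset_eq subspace_add)
  have bU: "b s (x + y) (x + y) = b s x x" if "x \<in> N" "y \<in> K" for x y
  proof -
    have "b s y w = 0" if "w \<in> S" for w
      using \<open>y \<in> K\<close> that rad by (auto simp: K_def radical_def)
    moreover have "b s x y = 0" using M(6,7) rad that by (auto simp: K_def)
    ultimately show ?thesis
      using that sN(2) K(2) bil[of s] by (simp add: bilinear_ladd bilinear_radd subset_eq)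
  qed
  have NK: "N \<inter> K \<subseteq> {0}"
  proof
    fix z assume z: "z \<in> N \<inter> K"
    then have "b s z z = 0" using rad sN(2) by (auto simp: K_def radical_def)
    then show "z \<in> {0}" using neg[of z] z by force
  qed
  have dimU: "dim U = dim N + dim K"
  proof -
    have "dim (N \<inter> K) = 0" using NK by simp
    then show ?thesis unfolding U_def using dim_sums_Int[OF sN(1) K(1)] by linarith
  qed
  obtain \<delta>1 where \<delta>1: "\<delta>1 > 0" "\<And>t z. t \<in> I \<Longrightarrow> \<bar>t - s\<bar> < \<delta>1 \<Longrightarrow> s < t \<Longrightarrow> z \<in> M \<Longrightarrow> z \<noteq> 0 \<Longrightarrow> 0 < 1 * b t z z"
  proof -
    have "\<exists>\<delta>>0. \<forall>t\<in>I. \<bar>t - s\<bar> < \<delta> \<longrightarrow> 0 < 1 * (t - s) \<longrightarrow> (\<forall>z\<in>M. z \<noteq> 0 \<longrightarrow> 0 < 1 * slope_form X V \<kappa> t z z)"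
      using M(4,5) rad
      by (intro slope_form_definite_nearby[OF sI M(1)]) (auto simp: b_def focal_space_def)
    then show thesis using that unfolding b_def by auto
  qed
  obtain \<delta>2 where \<delta>2: "\<delta>2 > 0" "\<And>t z. t \<in> I \<Longrightarrow> \<bar>t - s\<bar> < \<delta>2 \<Longrightarrow> t < s \<Longrightarrow> z \<in> U \<Longrightarrow> z \<noteq> 0 \<Longrightarrow> 0 < -1 * b t z z"
  proof -
    have le: "b s x x \<le> 0" if "x \<in> N" for x
      using neg[OF that] bilinear_lzero[OF bil] by (cases "x = 0") auto
    have "\<exists>\<delta>>0. \<forall>t\<in>I. \<bar>t - s\<bar> < \<delta> \<longrightarrow> 0 < -1 * (t - s) \<longrightarrow> (\<forall>z\<in>U. z \<noteq> 0 \<longrightarrow> 0 < -1 * slope_form X V \<kappa> t z z)"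
    proof (rule slope_form_definite_nearby[OF sI U(1)])
      fix z assume "z \<in> U"
      then obtain x y where z: "z = x + y" "x \<in> N" "y \<in> K" by (auto simp: U_def)
      show "0 \<le> -1 * slope_form X V \<kappa> s z z" using bU[OF z(2,3)] le[OF z(2)] z(1) by (simp add: b_def)
      assume "slope_form X V \<kappa> s z z = 0"
      then have "x = 0" using bU[OF z(2,3)] neg[OF z(2)] z(1) by (force simp: b_def)
      then show "X s z = 0" using z by (simp add: K_def focal_space_def)
    qed simp
    then show thesis using that unfolding b_def by auto
  qed
  obtain \<delta>3 n0 where \<delta>3: "\<delta>3 > 0" "\<And>n t z. n \<ge> n0 \<Longrightarrow> t \<in> I \<Longrightarrow> \<bar>t - s\<bar> < \<delta>3 \<Longrightarrow> z \<in> Sn n \<Longrightarrow>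
      Vn n t z = \<kappa> *\<^sub>R Xn n t z \<Longrightarrow> z = 0"
    using nondegenerate_slope_nearby[OF sI \<kappa>] by blast
  \<comment> \<open>Besides placing \<open>u\<close> and \<open>v\<close> where the definiteness
    statements hold, \<delta> keeps all of \<open>{u..v}\<close> within \<delta>3 of
    \<open>s\<close>, so that the radicals met on the way are focal spaces of
    \<open>Sn n\<close>.\<close>
  define \<delta> where "\<delta> = Min {\<delta>1, \<delta>2, \<delta>3, s - c, d - s} / 2"
  have \<delta>: "\<delta> > 0" "\<delta> < \<delta>1" "\<delta> < \<delta>2" "\<delta> < \<delta>3" "\<delta> < s - c" "\<delta> < d - s"
    using \<delta>1(1) \<delta>2(1) \<delta>3(1) s by (auto simp: \<delta>_def min_def)
  define u where "u = s - \<delta>"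
  define v where "v = s + \<delta>"
  have uv: "u < s" "s < v" "{u..v} \<subseteq> {c..d}" "u \<in> I" "v \<in> I"
    using \<delta> cd by (auto simp: u_def v_def subset_eq)
  have bu: "0 < -1 * slope_form X V \<kappa> u z z" if "z \<in> U" "z \<noteq> 0" for z
    using \<delta>2(2)[of u z] that \<delta> uv by (simp add: b_def u_def)
  have bv: "0 < 1 * slope_form X V \<kappa> v z z" if "z \<in> M" "z \<noteq> 0" for z
    using \<delta>1(2)[of v z] that \<delta> uv by (simp add: b_def v_def)
  have "\<forall>\<^sub>F n in sequentially. subspace (P n ` U) \<and> P n ` U \<subseteq> Sn n \<and> dim (P n ` U) = dim U \<and>
      (\<forall>z\<in>P n ` U. z \<noteq> 0 \<longrightarrow> 0 < -1 * slope_form (Xn n) (Vn n) \<kappa> u z z)"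
    by (rule definite_transfer[OF uv(4) U]) (rule bu)
  moreover have "\<forall>\<^sub>F n in sequentially. subspace (P n ` M) \<and> P n ` M \<subseteq> Sn n \<and> dim (P n ` M) = dim M \<and>
      (\<forall>z\<in>P n ` M. z \<noteq> 0 \<longrightarrow> 0 < 1 * slope_form (Xn n) (Vn n) \<kappa> v z z)"
    by (rule definite_transfer[OF uv(5) M(1,2)]) (rule bv)
  moreover have "\<forall>\<^sub>F n in sequentially. n \<ge> n0" by (rule eventually_ge_at_top)
  ultimately show ?thesis
  proof eventually_elim
    case (elim n)
    interpret n: jacobi_flow I "Rn n" "Xn n" "Vn n" "Sn n" by (rule flow)
    let ?q = "slope_form (Xn n) (Vn n) \<kappa>"
    define F where "F = {t \<in> {u..v}. dim (focal_space (Xn n) (Sn n) t) \<noteq> 0}"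
    have uvI: "{u..v} \<subseteq> I" using uv(3) cd by blast
    have F: "finite F" "F \<subseteq> {u..v}" unfolding F_def using n.finite_focal_times[OF uvI] by auto
    have rad: "radical (?q t) (Sn n) = focal_space (Xn n) (Sn n) t" if "t \<in> {u..v}" for t
    proof (rule n.radical_slope_form)
      show "t \<in> I" using that uvI by blast
      then show "z = 0" if "z \<in> Sn n" "Vn n t z = \<kappa> *\<^sub>R Xn n t z" for z
        using \<delta>3(2)[OF elim(3) _ _ that] \<open>t \<in> {u..v}\<close> \<delta>(4) by (auto simp: u_def v_def abs_if)
    qed (rule dim(2))
    have "negdim (?q u) (Sn n) \<le> negdim (?q v) (Sn n) + (\<Sum>t\<in>F. dim (radical (?q t) (Sn n)))"
    proof (rule spectral_flow_le)
      show "u \<le> v" using uv by simp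
      show "?q t z w = ?q t w z" if "t \<in> {u..v}" "z \<in> Sn n" "w \<in> Sn n" for t z w
        using n.slope_form_sym that uvI by blast
      show "(\<lambda>k. ?q (\<tau> k) (\<zeta> k) (\<zeta> k)) \<longlonglongrightarrow> ?q t z z"
        if "t \<in> {u..v}" "\<And>k::nat. \<tau> k \<in> {u..v}" "\<tau> \<longlonglongrightarrow> t" "\<zeta> \<longlonglongrightarrow> z" for t \<tau> \<zeta> z
        using that uvI by (intro n.tendsto_slope_form) auto
      show "dim (radical (?q t) (Sn n)) = 0" if "t \<in> {u..v}" "t \<notin> F" for t
        using that rad[OF that(1)] by (simp add: F_def)
    qed (use n.subspace_S n.bilinear_slope_form F in auto)
    also have "(\<Sum>t\<in>F. dim (radical (?q t) (Sn n))) = (\<Sum>t\<in>F. dim (focal_space (Xn n) (Sn n) t))"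
      by (rule sum.cong) (use rad F(2) in auto)
    finally have flow: "negdim (?q u) (Sn n) \<le> negdim (?q v) (Sn n) + \<dots>" .
    have "negative_on (?q u) (Sn n) (P n ` U)" using elim(1) by (auto simp: negative_on_def)
    from negdim_ge[OF this] have low: "dim N + dim K \<le> negdim (?q u) (Sn n)"
      using elim(1) dimU by simp
    obtain N' where N': "negative_on (?q v) (Sn n) N'" "dim N' = negdim (?q v) (Sn n)"
      using negdim_attained[OF n.subspace_S] .
    have "N' \<inter> P n ` M \<subseteq> {0}" using elim(2) N'(1) by (force simp: negative_on_def)
    then have "dim N' + dim (P n ` M) \<le> dim (Sn n)"
      using elim(2) N'(1) n.subspace_S by (intro dim_Int_trivial_le) (auto simp: negative_on_def)
    then have "negdim (?q v) (Sn n) \<le> dim N"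
      using elim(2) N'(2) M(3) dim by simp
    then have "dim K \<le> (\<Sum>t\<in>F. dim (focal_space (Xn n) (Sn n) t))" using low flow by linarith
    then show ?case using F uv(3) unfolding K_def by blast
  qed
qed

text \<open>Around each interior time of \<open>T\<close> the local bound is applied in a window;
  the windows are disjoint, so no focal time of \<open>Sn n\<close> is credited twice. At
  \<open>a\<close> and \<open>b\<close> the set \<open>{s}\<close> itself does the job, by
  \<open>ends\<close>.\<close>

lemma focal_lower_global:
  assumes ab: "{a..b} \<subseteq> I" "a \<le> b"
    and dim: "dim S = DIM('a)" "\<And>n. dim (Sn n) = DIM('a)"
    and ends: "\<forall>\<^sub>F n in sequentially. dim (focal_space (Xn n) (Sn n) a) = dim (focal_space X S a) \<and>
      dim (focal_space (Xn n) (Sn n) b) = dim (focal_space X S b)"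
    and T: "finite T" "T \<subseteq> {a..b}"
  shows "\<forall>\<^sub>F n in sequentially. \<exists>F. finite F \<and> F \<subseteq> {a..b} \<and>
    (\<Sum>t\<in>T. dim (focal_space X S t)) \<le> (\<Sum>t\<in>F. dim (focal_space (Xn n) (Sn n) t))"
proof -
  \<comment> \<open>Including the end points makes \<rho> small also against the distance to
    \<open>a\<close> and \<open>b\<close>, so that windows around interior times stay inside
    \<open>{a..b}\<close>.\<close>
  define D where "D = T \<union> {a, b}"
  have D: "finite D" "D \<subseteq> {a..b}" "a \<in> D" "b \<in> D" using T ab(2) by (auto simp: D_def)
  obtain \<rho> where \<rho>: "\<rho> > 0" "\<And>x y. x \<in> D \<Longrightarrow> y \<in> D \<Longrightarrow> x \<noteq> y \<Longrightarrow> 2 * \<rho> < \<bar>x - y\<bar>"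
  proof -
    \<comment> \<open>The element 1 keeps \<open>A\<close> nonempty when \<open>D\<close> is a
      single point, which happens for \<open>a = b\<close>.\<close>
    define A where "A = insert 1 ((\<lambda>(x, y). \<bar>x - y\<bar>) ` {(x, y). x \<in> D \<and> y \<in> D \<and> x \<noteq> y})"
    have "finite {(x, y). x \<in> D \<and> y \<in> D \<and> x \<noteq> y}"
      by (rule finite_subset[of _ "D \<times> D"]) (use D(1) in auto)
    then have A: "finite A" "A \<noteq> {}" by (auto simp: A_def)
    have "0 < Min A" using A by (auto simp: A_def)
    moreover have "Min A \<le> \<bar>x - y\<bar>" if "x \<in> D" "y \<in> D" "x \<noteq> y" for x y
      by (rule Min_le[OF A(1)]) (use that in \<open>auto simp: A_def\<close>)
    ultimately show thesis by (intro that[of "Min A / 3"]) fastforce+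
  qed
  define Q where "Q n s F \<longleftrightarrow> finite F \<and> F \<subseteq> {a..b} \<and> F \<subseteq> {s - \<rho>..s + \<rho>} \<and>
    dim (focal_space X S s) \<le> (\<Sum>t\<in>F. dim (focal_space (Xn n) (Sn n) t))" for n s F
  have "\<forall>\<^sub>F n in sequentially. \<exists>F. Q n s F" if s: "s \<in> D" for s
  proof (cases "s = a \<or> s = b")
    case True
    from ends show ?thesis
    proof eventually_elim
      case (elim n)
      then have "Q n s {s}" using True D(2) s \<rho>(1) unfolding Q_def by auto
      then show ?case by blast
    qed
  next
    case False
    then have "a < s - \<rho>" "s + \<rho> < b" using \<rho>(2)[OF s D(3)] \<rho>(2)[OF s D(4)] \<rho>(1) D(2) s by auto
    then have sub: "{s - \<rho>..s + \<rho>} \<subseteq> {a..b}" by auto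
    have "\<forall>\<^sub>F n in sequentially. \<exists>F. finite F \<and> F \<subseteq> {s - \<rho>..s + \<rho>} \<and>
        dim (focal_space X S s) \<le> (\<Sum>t\<in>F. dim (focal_space (Xn n) (Sn n) t))"
      by (rule focal_lower_local) (use sub ab(1) \<rho>(1) dim in auto)
    then show ?thesis
      by eventually_elim (use sub in \<open>unfold Q_def, blast\<close>)
  qed
  then have "\<forall>\<^sub>F n in sequentially. \<forall>s\<in>D. \<exists>F. Q n s F"
    using D(1) by (simp add: eventually_ball_finite)
  then show ?thesis
  proof eventually_elim
    case (elim n)
    then obtain F where F: "\<And>s. s \<in> D \<Longrightarrow> Q n s (F s)" by metis
    let ?f = "\<lambda>t. dim (focal_space (Xn n) (Sn n) t)"
    have "F s \<inter> F s' = {}" if "s \<in> D" "s' \<in> D" "s \<noteq> s'" for s s'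
    proof -
      have "F s \<subseteq> {s - \<rho>..s + \<rho>}" "F s' \<subseteq> {s' - \<rho>..s' + \<rho>}"
        using F[OF that(1)] F[OF that(2)] by (auto simp: Q_def)
      moreover have "{s - \<rho>..s + \<rho>} \<inter> {s' - \<rho>..s' + \<rho>} = {}"
        using \<rho>(2)[OF that] by (auto simp: abs_if split: if_splits)
      ultimately show ?thesis by blast
    qed
    then have "sum ?f (\<Union>s\<in>D. F s) = (\<Sum>s\<in>D. sum ?f (F s))"
      using D(1) F by (intro sum.UNION_disjoint) (auto simp: Q_def)
    moreover have "(\<Sum>s\<in>T. dim (focal_space X S s)) \<le> (\<Sum>s\<in>D. dim (focal_space X S s))"
      using D(1) by (intro sum_mono2) (auto simp: D_def)
    moreover have "(\<Sum>s\<in>D. dim (focal_space X S s)) \<le> (\<Sum>s\<in>D. sum ?f (F s))"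
      using F by (intro sum_mono) (auto simp: Q_def)
    moreover have "finite (\<Union>s\<in>D. F s)" "(\<Union>s\<in>D. F s) \<subseteq> {a..b}"
      using D(1) F by (auto simp: Q_def)
    ultimately show ?case by (intro exI[of _ "\<Union>s\<in>D. F s"]) auto
  qed
qed

end

section \<open>The phase flow of the Jacobi equation\<close>

text \<open>The nearest point of a convex set satisfies a variational inequality; on a subspace it
  can be tested with both \<open>w\<close> and \<open>- w\<close> and becomes orthogonality. Hence
  \<open>closest_point\<close> is the orthogonal projection.\<close>

lemma closest_point_subspace:
  fixes S :: "'e::euclidean_space set"
  assumes S: "subspace S"
  shows closest_point_in_subspace: "closest_point S x \<in> S"
    and closest_point_orthogonal: "w \<in> S \<Longrightarrow> (x - closest_point S x) \<bullet> w = 0"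
proof -
  have ne: "S \<noteq> {}" using subspace_0[OF S] by blast
  note cl = closed_subspace[OF S] and cv = subspace_imp_convex[OF S]
  show in_S: "closest_point S x \<in> S" by (rule closest_point_in_set[OF cl ne])
  assume w: "w \<in> S"
  have "(x - closest_point S x) \<bullet> w \<le> 0"
    using closest_point_dot[OF cv cl subspace_add[OF S in_S w], of x] by simp
  moreover have "(x - closest_point S x) \<bullet> (- w) \<le> 0"
    using closest_point_dot[OF cv cl subspace_diff[OF S in_S w], of x] by simp
  ultimately show "(x - closest_point S x) \<bullet> w = 0" by simp
qed

lemma closest_point_eqI:
  fixes S :: "'e::euclidean_space set"
  assumes S: "subspace S" and p: "p \<in> S" "\<And>w. w \<in> S \<Longrightarrow> (x - p) \<bullet> w = 0"
  shows "closest_point S x = p"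
proof -
  let ?d = "closest_point S x - p"
  have d: "?d \<in> S" using closest_point_in_subspace[OF S] p(1) S by (simp add: subspace_diff)
  have "?d \<bullet> ?d = (x - p) \<bullet> ?d - (x - closest_point S x) \<bullet> ?d" by (simp add: inner_diff_left)
  also have "\<dots> = 0" using p(2)[OF d] closest_point_orthogonal[OF S d] by simp
  finally show ?thesis by simp
qed

lemma linear_closest_point:
  fixes S :: "'e::euclidean_space set"
  assumes S: "subspace S"
  shows "linear (closest_point S)"
proof (rule linearI)
  note in_S = closest_point_in_subspace[OF S] and orth = closest_point_orthogonal[OF S]
  fix x y :: 'e and c :: real
  show "closest_point S (x + y) = closest_point S x + closest_point S y"
    using orth[of _ x] orth[of _ y]
    by (intro closest_point_eqI S subspace_add in_S) (simp add: inner_diff_left inner_add_left)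
  show "closest_point S (c *\<^sub>R x) = c *\<^sub>R closest_point S x"
    using orth[of _ x]
    by (intro closest_point_eqI S subspace_scale in_S) (simp add: inner_diff_left)
qed

lemma grassmann_dist_bound:
  assumes "subspace S" "subspace T"
  shows "norm (closest_point S x - closest_point T x) \<le> grassmann_dist S T * norm x"
  unfolding grassmann_dist_def
  by (rule onorm) (intro bounded_linear_sub linear_conv_bounded_linear[THEN iffD1] linear_closest_point assms)

text \<open>The difference of the coefficients is multiplied by \<open>Z\<close> alone, so a bound
  on the reference solution suffices and none on \<open>Y\<close> is required. Taking \<delta> to be
  0 gives uniqueness; taking \<open>Z\<close> to be the limit solution gives continuous
  dependence.\<close>

lemma ode_solution_estimate:
  fixes A B :: "real \<Rightarrow> 'e::euclidean_space \<Rightarrow>\<^sub>L 'e"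
  assumes Y: "\<And>t. t \<in> {c..d} \<Longrightarrow> (Y has_vector_derivative A t (Y t)) (at t within {c..d})"
    and Z: "\<And>t. t \<in> {c..d} \<Longrightarrow> (Z has_vector_derivative B t (Z t)) (at t within {c..d})"
    and t: "t0 \<in> {c..d}" "t \<in> {c..d}"
    and M: "\<And>t. t \<in> {c..d} \<Longrightarrow> norm (A t) \<le> M"
    and \<delta>: "\<And>t. t \<in> {c..d} \<Longrightarrow> norm (A t - B t) * norm (Z t) \<le> \<delta>"
  shows "(norm (Y t - Z t))\<^sup>2 + \<delta>\<^sup>2 \<le> ((norm (Y t0 - Z t0))\<^sup>2 + \<delta>\<^sup>2) * exp ((2 * M + 1) * \<bar>t - t0\<bar>)"
proof (rule gronwall_square[where u = "\<lambda>t. Y t - Z t" and c = c and d = d])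
  show "((\<lambda>t. Y t - Z t) has_vector_derivative A t (Y t) - B t (Z t)) (at t within {c..d})"
    if "t \<in> {c..d}" for t using Y[OF that] Z[OF that] by (rule has_vector_derivative_diff)
  show "norm (A t (Y t) - B t (Z t)) \<le> M * norm (Y t - Z t) + \<delta>" if "t \<in> {c..d}" for t
  proof -
    have "A t (Y t) - B t (Z t) = A t (Y t - Z t) + (A t - B t) (Z t)"
      by (simp add: blinfun.diff_right blinfun.diff_left)
    also have "norm \<dots> \<le> norm (A t (Y t - Z t)) + norm ((A t - B t) (Z t))" by (rule norm_triangle_ineq)
    also have "\<dots> \<le> norm (A t) * norm (Y t - Z t) + norm (A t - B t) * norm (Z t)"
      by (intro add_mono norm_blinfun)
    also have "\<dots> \<le> M * norm (Y t - Z t) + \<delta>"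
      by (intro add_mono mult_right_mono M \<delta> that) auto
    finally show ?thesis .
  qed
  show "0 \<le> M" using M[OF t(1)] norm_ge_zero order_trans by blast
qed (use t in auto)

section \<open>The Jacobi equation as a first-order system on V x V\<close>

definition jacobi_op :: "('a::real_normed_vector \<Rightarrow>\<^sub>L 'a) \<Rightarrow> ('a \<times> 'a) \<Rightarrow>\<^sub>L ('a \<times> 'a)"
  where "jacobi_op A = Blinfun (\<lambda>p. (snd p, - A (fst p)))"

lemma jacobi_op_apply [simp]: "jacobi_op A p = (snd p, - A (fst p))"
  unfolding jacobi_op_def
  by (subst bounded_linear_Blinfun_apply)
    (auto intro!: bounded_linear_Pair bounded_linear_snd bounded_linear_minus
      bounded_linear_compose[OF blinfun.bounded_linear_right bounded_linear_fst])

lemma norm_jacobi_op_diff: "norm (jacobi_op A - jacobi_op B) \<le> norm (A - B)"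
proof (rule norm_blinfun_bound)
  fix p
  have "norm ((jacobi_op A - jacobi_op B) p) = norm ((A - B) (fst p))"
    by (simp add: blinfun.diff_left norm_minus_commute)
  also have "\<dots> \<le> norm (A - B) * norm (fst p)" by (rule norm_blinfun)
  also have "\<dots> \<le> norm (A - B) * norm p"
    by (intro mult_left_mono) (use norm_fst_le[of "fst p" "snd p"] in auto)
  finally show "norm ((jacobi_op A - jacobi_op B) p) \<le> norm (A - B) * norm p" .
qed simp

lemma continuous_on_jacobi_op:
  fixes R :: "'b::topological_space \<Rightarrow> 'a::real_normed_vector \<Rightarrow>\<^sub>L 'a"
  assumes "continuous_on I R"
  shows "continuous_on I (\<lambda>t. jacobi_op (R t))"
proof -
  have "1-lipschitz_on UNIV (jacobi_op :: ('a \<Rightarrow>\<^sub>L 'a) \<Rightarrow> _)"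
    by (rule lipschitz_onI) (simp_all add: dist_norm norm_jacobi_op_diff)
  from continuous_on_compose2[OF lipschitz_on_continuous_on[OF this] assms] show ?thesis by simp
qed

definition phase_flow ::
  "real set \<Rightarrow> (real \<Rightarrow> 'a::euclidean_space \<Rightarrow>\<^sub>L 'a) \<Rightarrow> real \<Rightarrow> 'a \<times> 'a \<Rightarrow> real \<Rightarrow> 'a \<times> 'a"
  where "phase_flow I R t0 z = (SOME Y. Y t0 = z \<and>
    (\<forall>t\<in>I. (Y has_vector_derivative jacobi_op (R t) (Y t)) (at t within I)))"

locale jacobi_equation =
  fixes I :: "real set" and R :: "real \<Rightarrow> 'a::euclidean_space \<Rightarrow>\<^sub>L 'a" and t0 :: real
  assumes interval: "is_interval I" and nontrivial: "interior I \<noteq> {}"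
    and t0: "t0 \<in> I" and cont_R: "continuous_on I R"
begin

abbreviation "\<Phi> \<equiv> phase_flow I R t0"

lemma phase_flow_initial: "\<Phi> z t0 = z"
  and phase_flow_deriv: "t \<in> I \<Longrightarrow> (\<Phi> z has_vector_derivative jacobi_op (R t) (\<Phi> z t)) (at t within I)"
proof -
  obtain Y where "Y t0 = z" "\<And>t. t \<in> I \<Longrightarrow> (Y has_vector_derivative jacobi_op (R t) (Y t)) (at t within I)"
    by (rule linear_ode_exists[OF interval t0 continuous_on_jacobi_op[OF cont_R]]) (rule that)
  then have "\<exists>Y. Y t0 = z \<and> (\<forall>t\<in>I. (Y has_vector_derivative jacobi_op (R t) (Y t)) (at t within I))"
    by blast
  from someI_ex[OF this]
  show "\<Phi> z t0 = z"
    "t \<in> I \<Longrightarrow> (\<Phi> z has_vector_derivative jacobi_op (R t) (\<Phi> z t)) (at t within I)"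
    unfolding phase_flow_def by blast+
qed

lemma compact_nbhd:
  assumes "t \<in> I"
  obtains c d where "{c..d} \<subseteq> I" "t \<in> {c..d}" "t0 \<in> {c..d}" "at t within I = at t within {c..d}"
  by (rule interval_compact_neighbourhood[OF interval assms t0]) (rule that)

lemma solution_unique:
  assumes Y: "\<And>t. t \<in> I \<Longrightarrow> (Y has_vector_derivative jacobi_op (R t) (Y t)) (at t within I)"
    and Z: "\<And>t. t \<in> I \<Longrightarrow> (Z has_vector_derivative jacobi_op (R t) (Z t)) (at t within I)"
    and s: "s \<in> I" "Y s = Z s" and t: "t \<in> I"
  shows "Y t = Z t"
proof -
  obtain c d where cd: "{c..d} \<subseteq> I" "t \<in> {c..d}" "s \<in> {c..d}" "at t within I = at t within {c..d}"
    by (rule interval_compact_neighbourhood[OF interval t s(1)]) (rule that)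
  obtain M where M: "\<And>t. t \<in> {c..d} \<Longrightarrow> norm (jacobi_op (R t)) \<le> M"
    by (rule compact_interval_bound[OF continuous_on_jacobi_op[OF cont_R] cd(1)]) (rule that)
  have "(norm (Y t - Z t))\<^sup>2 + 0\<^sup>2 \<le> ((norm (Y s - Z s))\<^sup>2 + 0\<^sup>2) * exp ((2 * M + 1) * \<bar>t - s\<bar>)"
  proof (rule ode_solution_estimate[where A = "\<lambda>t. jacobi_op (R t)" and B = "\<lambda>t. jacobi_op (R t)"])
    fix t assume "t \<in> {c..d}"
    then have "t \<in> I" using cd(1) by blast
    from has_vector_derivative_within_subset[OF Y[OF this] cd(1)]
      has_vector_derivative_within_subset[OF Z[OF this] cd(1)]
    show "(Y has_vector_derivative jacobi_op (R t) (Y t)) (at t within {c..d})"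
      "(Z has_vector_derivative jacobi_op (R t) (Z t)) (at t within {c..d})" .
  qed (use cd M in auto)
  then show ?thesis using s(2) by simp
qed

lemma linear_phase_flow:
  assumes t: "t \<in> I"
  shows "linear (\<lambda>z. \<Phi> z t)"
proof (rule linearI)
  fix x y :: "'a \<times> 'a" and c :: real
  show "\<Phi> (x + y) t = \<Phi> x t + \<Phi> y t"
  proof (rule solution_unique[OF phase_flow_deriv _ t0 _ t])
    show "((\<lambda>t. \<Phi> x t + \<Phi> y t) has_vector_derivative jacobi_op (R t) (\<Phi> x t + \<Phi> y t)) (at t within I)"
      if "t \<in> I" for t
      unfolding blinfun.add_right by (intro has_vector_derivative_add phase_flow_deriv that)
  qed (simp_all add: phase_flow_initial)
  show "\<Phi> (c *\<^sub>R x) t = c *\<^sub>R \<Phi> x t"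
  proof (rule solution_unique[OF phase_flow_deriv _ t0 _ t])
    show "((\<lambda>t. c *\<^sub>R \<Phi> x t) has_vector_derivative jacobi_op (R t) (c *\<^sub>R \<Phi> x t)) (at t within I)"
      if "t \<in> I" for t
      unfolding blinfun.scaleR_right
      by (rule bounded_linear.has_vector_derivative[OF bounded_linear_scaleR_right phase_flow_deriv[OF that]])
  qed (simp_all add: phase_flow_initial)
qed

text \<open>Outside \<open>I\<close> the phase flow is an arbitrary choice. The value 0 there is
  what \<open>jacobi_fields\<close> demands, and it makes the dependence on \<open>z\<close> linear
  at every real time.\<close>

definition field :: "'a \<times> 'a \<Rightarrow> real \<Rightarrow> 'a"
  where "field z t = (if t \<in> I then fst (\<Phi> z t) else 0)"

definition velocity :: "'a \<times> 'a \<Rightarrow> real \<Rightarrow> 'a"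
  where "velocity z t = (if t \<in> I then snd (\<Phi> z t) else 0)"

text \<open>Guarantees that derivatives within \<open>I\<close> are unique. At an isolated point
  every vector would be a derivative, and \<open>vel\<close> would carry no information.\<close>

lemma at_within_nontrivial: "t \<in> I \<Longrightarrow> at t within I \<noteq> bot"
proof -
  assume t: "t \<in> I"
  obtain x where x: "x \<in> interior I" using nontrivial by blast
  then obtain e where e: "e > 0" "ball x e \<subseteq> I" using mem_interior by blast
  have "x + e / 2 \<in> I" "x - e / 2 \<in> I" using e by (auto intro!: subsetD[OF e(2)] simp: dist_real_def)
  moreover have "x + e / 2 \<noteq> x - e / 2" using e by simp
  ultimately have "I \<noteq> {y}" for y by force
  from connected_imp_perfect[OF is_interval_connected[OF interval] t this] have "t islimpt I" .
  then show ?thesis by (simp add: trivial_limit_within)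
qed

lemma field_deriv:
  assumes t: "t \<in> I"
  shows "(field z has_vector_derivative velocity z t) (at t within I)"
    and "(velocity z has_vector_derivative - R t (field z t)) (at t within I)"
proof -
  note d = phase_flow_deriv[OF t, of z]
  have "((\<lambda>t. fst (\<Phi> z t)) has_vector_derivative fst (jacobi_op (R t) (\<Phi> z t))) (at t within I)"
    by (rule bounded_linear.has_vector_derivative[OF bounded_linear_fst d])
  from has_vector_derivative_transform[OF t _ this, of "field z"]
  show "(field z has_vector_derivative velocity z t) (at t within I)"
    using t by (simp add: field_def velocity_def)
  have "((\<lambda>t. snd (\<Phi> z t)) has_vector_derivative snd (jacobi_op (R t) (\<Phi> z t))) (at t within I)"
    by (rule bounded_linear.has_vector_derivative[OF bounded_linear_snd d])
  from has_vector_derivative_transform[OF t _ this, of "velocity z"]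
  show "(velocity z has_vector_derivative - R t (field z t)) (at t within I)"
    using t by (simp add: field_def velocity_def)
qed

lemma vel_eq: "t \<in> I \<Longrightarrow> (J has_vector_derivative v) (at t within I) \<Longrightarrow> vel I J t = v"
  unfolding vel_def by (rule vector_derivative_within[OF at_within_nontrivial])

lemma vel_field: "t \<in> I \<Longrightarrow> vel I (field z) t = velocity z t"
  by (rule vel_eq[OF _ field_deriv(1)])

lemma field_in_jacobi_fields: "field z \<in> jacobi_fields I R"
proof -
  have "(vel I (field z) has_vector_derivative - R t (field z t)) (at t within I)" if "t \<in> I" for t
    by (rule has_vector_derivative_transform[OF that vel_field field_deriv(2)[OF that]])
  moreover have "(field z has_vector_derivative vel I (field z) t) (at t within I)" if "t \<in> I" for t
    unfolding vel_field[OF that] by (rule field_deriv(1)[OF that])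
  moreover have "field z t = 0" if "t \<notin> I" for t using that by (simp add: field_def)
  ultimately show ?thesis unfolding jacobi_fields_def by blast
qed

lemma phase_field: "phase I t0 (field z) = z"
proof -
  have "field z t0 = fst z" "vel I (field z) t0 = snd z"
    unfolding vel_field[OF t0] using t0 by (simp_all add: field_def velocity_def phase_flow_initial)
  then show ?thesis by (simp add: phase_def)
qed

lemma field_phase:
  assumes J: "J \<in> jacobi_fields I R"
  shows "field (phase I t0 J) = J"
proof
  fix t
  let ?Y = "\<lambda>t. (J t, vel I J t)"
  have Y: "(?Y has_vector_derivative jacobi_op (R t) (?Y t)) (at t within I)" if "t \<in> I" for t
    using J that by (auto simp: jacobi_fields_def intro!: has_vector_derivative_Pair)
  show "field (phase I t0 J) t = J t"
  proof (cases "t \<in> I")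
    case True
    have "\<Phi> (phase I t0 J) t = ?Y t"
      by (rule solution_unique[OF phase_flow_deriv Y t0 _ True])
        (simp_all add: phase_flow_initial phase_def)
    then show ?thesis using True by (simp add: field_def)
  qed (use J in \<open>simp add: field_def jacobi_fields_def\<close>)
qed

lemma linear_field_at: "linear (\<lambda>z. field z t)" and linear_velocity_at: "linear (\<lambda>z. velocity z t)"
  using linear_compose[OF linear_phase_flow linear_fst] linear_compose[OF linear_phase_flow linear_snd]
  by (cases "t \<in> I"; simp add: field_def velocity_def o_def linear_zero)+

lemma linear_field: "linear field"
  by (rule linearI)
    (simp_all add: fun_eq_iff linear_add[OF linear_field_at] linear_scale[OF linear_field_at] scaleR_fun_def)

lemma inj_field: "inj field"
  by (rule injI) (metis phase_field)

definition params :: "(real \<Rightarrow> 'a) set \<Rightarrow> ('a \<times> 'a) set"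
  where "params W = phase I t0 ` W"

text \<open>\<open>field\<close> and \<open>phase I t0\<close> are mutually inverse between initial
  data and Jacobi fields. As a preimage under the linear map \<open>field\<close>, the parameter set
  is a subspace.\<close>

lemma params_eq:
  assumes W: "W \<subseteq> jacobi_fields I R"
  shows "params W = field -` W"
proof (intro set_eqI iffI)
  fix z assume "z \<in> params W"
  then obtain J where "J \<in> W" "z = phase I t0 J" by (auto simp: params_def)
  then show "z \<in> field -` W" using field_phase[of J] W by auto
next
  fix z assume "z \<in> field -` W"
  then show "z \<in> params W"
    unfolding params_def by (intro image_eqI[of _ _ "field z"]) (auto simp: phase_field)
qed

lemma field_params:
  assumes W: "W \<subseteq> jacobi_fields I R"
  shows "field ` params W = W"
proof -
  have "field ` params W = (\<lambda>J. field (phase I t0 J)) ` W" by (simp add: params_def image_image)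
  also have "\<dots> = (\<lambda>J. J) ` W"
    by (rule image_cong[OF refl]) (use field_phase W in blast)
  finally show ?thesis by simp
qed

lemma dim_field_image: "subspace U \<Longrightarrow> dim (field ` U) = dim U"
  using inj_field by (intro dim_image_eq[OF linear_field]) (simp add: inj_on_subset[OF _ subset_UNIV])

lemma symp_form:
  assumes "\<And>t. t \<in> I \<Longrightarrow> symmetric_endo (R t)" "t \<in> I"
  shows "symp I (field z) (field w) = field z t \<bullet> velocity w t - velocity z t \<bullet> field w t"
  using symp_eq[OF interval assms(1) field_in_jacobi_fields field_in_jacobi_fields assms(2)]
  by (simp add: vel_field[OF assms(2)])

lemma jacobi_flow_isotropic:
  assumes sym: "\<And>t. t \<in> I \<Longrightarrow> symmetric_endo (R t)" and W: "isotropic I R W"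
  shows "jacobi_flow I R (\<lambda>t z. field z t) (\<lambda>t z. velocity z t) (params W)"
proof (rule jacobi_flow.intro)
  have W': "subspace W" "W \<subseteq> jacobi_fields I R" "W \<subseteq> symp_orth I R W"
    using W by (auto simp: isotropic_def)
  show "subspace (params W)"
    unfolding params_eq[OF W'(2)] by (rule linear_subspace_vimage[OF linear_field W'(1)])
  show "z = 0" if t: "t \<in> I" "field z t = 0" "velocity z t = 0" for t z
  proof -
    have "\<Phi> z t = \<Phi> 0 t"
      using that linear_0[OF linear_phase_flow[OF t(1)]] by (simp add: field_def velocity_def prod_eq_iff)
    from solution_unique[OF phase_flow_deriv phase_flow_deriv t(1) this t0]
    have "\<Phi> z t0 = \<Phi> 0 t0" by blast
    then show ?thesis by (simp add: phase_flow_initial)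
  qed
  show "field z t \<bullet> velocity w t = velocity z t \<bullet> field w t"
    if "t \<in> I" "z \<in> params W" "w \<in> params W" for t z w
  proof -
    have "field z \<in> W" "field w \<in> W" using that(2,3) params_eq[OF W'(2)] by auto
    then have "symp I (field z) (field w) = 0" using W'(3) by (auto simp: symp_orth_def)
    then show ?thesis using symp_form[OF sym that(1)] by simp
  qed
qed (rule interval linear_field_at linear_velocity_at field_deriv cont_R; assumption)+

lemma focal_index_eq:
  assumes W: "isotropic I R W" and t: "t \<in> I"
  shows "focal_index W t = dim (focal_space (\<lambda>t z. field z t) (params W) t)"
proof -
  have W': "subspace W" "W \<subseteq> jacobi_fields I R" using W by (auto simp: isotropic_def)
  have "{J \<in> W. J t = 0} = field ` focal_space (\<lambda>t z. field z t) (params W) t"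
    using field_params[OF W'(2)] by (auto simp: focal_space_def)
  moreover have "subspace (focal_space (\<lambda>t z. field z t) (params W) t)"
    using linear_subspace_vimage[OF linear_field W'(1)] params_eq[OF W'(2)]
    by (auto simp: focal_space_def subspace_def linear_add[OF linear_field_at]
        linear_scale[OF linear_field_at] linear_0[OF linear_field_at])
  ultimately show ?thesis using dim_field_image by (simp add: focal_index_def)
qed

lemma dim_params: "isotropic I R W \<Longrightarrow> dim (params W) = dim W"
proof -
  assume "isotropic I R W"
  then have W: "subspace W" "W \<subseteq> jacobi_fields I R" by (auto simp: isotropic_def)
  have "subspace (params W)"
    unfolding params_eq[OF W(2)] by (rule linear_subspace_vimage[OF linear_field W(1)])
  from dim_field_image[OF this] show ?thesis using field_params[OF W(2)] by simp
qed

text \<open>In initial data the symplectic form is the inner product twisted by the quarter turn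
  \<open>j\<close>. A Lagrangian space is thus the orthogonal complement of its own image under the
  injective map \<open>j\<close>, and its dimension is half that of V x V.\<close>

lemma lagrangian_dim:
  assumes sym: "\<And>t. t \<in> I \<Longrightarrow> symmetric_endo (R t)" and W: "lagrangian I R W"
  shows "dim (params W) = DIM('a)"
proof -
  have W': "subspace W" "W \<subseteq> jacobi_fields I R" "W = symp_orth I R W"
    using W by (auto simp: lagrangian_def)
  let ?S = "params W"
  define j :: "'a \<times> 'a \<Rightarrow> 'a \<times> 'a" where "j w = (snd w, - fst w)" for w
  have j: "linear j" by (rule linearI) (auto simp: j_def)
  have "inj j" by (rule injI) (auto simp: j_def prod_eq_iff)
  have sS: "subspace ?S"
    unfolding params_eq[OF W'(2)] by (rule linear_subspace_vimage[OF linear_field W'(1)])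
  have form: "symp I (field z) (field w) = j w \<bullet> z" for z w
    using symp_form[OF sym t0, of z w] t0
    by (simp add: field_def velocity_def phase_flow_initial j_def inner_prod_def inner_commute)
  have mem: "z \<in> ?S \<longleftrightarrow> (\<forall>w\<in>?S. symp I (field z) (field w) = 0)" for z
  proof -
    have "z \<in> ?S \<longleftrightarrow> field z \<in> symp_orth I R W" unfolding params_eq[OF W'(2)] W'(3)[symmetric] by simp
    also have "\<dots> \<longleftrightarrow> (\<forall>K\<in>field ` ?S. symp I (field z) K = 0)"
      unfolding field_params[OF W'(2)] using field_in_jacobi_fields by (simp add: symp_orth_def)
    finally show ?thesis by simp
  qed
  have "z \<in> ?S \<longleftrightarrow> z \<in> {z \<in> UNIV. \<forall>x\<in>j ` ?S. orthogonal x z}" for z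
    by (subst mem) (simp add: form orthogonal_def)
  then have "?S = {z \<in> UNIV. \<forall>x\<in>j ` ?S. orthogonal x z}" by (rule set_eqI)
  moreover have "dim {z \<in> UNIV. \<forall>x\<in>j ` ?S. orthogonal x z} + dim (j ` ?S) = dim (UNIV :: ('a \<times> 'a) set)"
    by (rule dim_subspace_orthogonal_to_vectors[OF linear_subspace_image[OF j sS]]) auto
  moreover have "dim (j ` ?S) = dim ?S"
    using \<open>inj j\<close> by (intro dim_image_eq[OF j]) (simp add: inj_on_subset[OF _ subset_UNIV])
  ultimately have "dim ?S + dim ?S = DIM('a \<times> 'a)" by (metis dim_UNIV)
  then show ?thesis by simp
qed

end

section \<open>Continuous dependence and the main result\<close>

lemma smooth_on_imp_continuous_on: "smooth_on I f \<Longrightarrow> continuous_on I f"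
proof -
  assume "smooth_on I f"
  then obtain D where D: "\<forall>t\<in>I. D 0 t = f t"
      "\<forall>k. \<forall>t\<in>I. (D k has_vector_derivative D (Suc k) t) (at t within I)"
    unfolding smooth_on_def by blast
  then have "continuous_on I (D 0)"
    by (meson continuous_on_eq_continuous_within has_vector_derivative_continuous)
  then show ?thesis using D(1) by (simp cong: continuous_on_cong)
qed

text \<open>Equal filters at \<open>t\<close> mean that near \<open>t\<close> every point of
  \<open>I\<close> lies in \<open>K\<close>; the point \<open>t\<close> itself, which the filters
  ignore, is covered by \<open>t \<in> K\<close>.\<close>

lemma eventually_in_same_at_within:
  fixes \<tau> :: "nat \<Rightarrow> real"
  assumes "at t within I = at t within K" "t \<in> K" "\<And>k. \<tau> k \<in> I" "\<tau> \<longlonglongrightarrow> t"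
  shows "\<forall>\<^sub>F k in sequentially. \<tau> k \<in> K"
proof -
  have "\<forall>\<^sub>F x in at t within I. x \<in> K" unfolding assms(1) by (simp add: eventually_at_filter)
  then have "\<forall>\<^sub>F x in nhds t. x \<noteq> t \<longrightarrow> x \<in> I \<longrightarrow> x \<in> K" by (simp add: eventually_at_filter)
  from eventually_compose_filterlim[OF this assms(4)] show ?thesis
    by eventually_elim (use assms in metis)
qed

lemma C0_converges_eventually:
  assumes "C0_converges I Rn R" "{c..d} \<subseteq> I" "filterlim \<nu> at_top sequentially" "e > 0"
  shows "\<forall>\<^sub>F k in sequentially. \<forall>s\<in>{c..d}. dist (Rn (\<nu> k) s) (R s) < e"
proof -
  have "\<forall>\<^sub>F n in sequentially. \<forall>s\<in>{c..d}. dist (Rn n s) (R s) < e"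
    using assms(1,2,4) unfolding C0_converges_def uniform_limit_iff by blast
  from eventually_compose_filterlim[OF this assms(3)] show ?thesis .
qed

lemma C0_converges_tendsto:
  fixes R :: "real \<Rightarrow> 'b::real_normed_vector"
  assumes lim: "C0_converges I Rn R" and I: "is_interval I" and R: "continuous_on I R"
    and \<nu>: "filterlim \<nu> at_top sequentially" and \<tau>: "\<And>k. \<tau> k \<in> I" "t \<in> I" "\<tau> \<longlonglongrightarrow> t"
  shows "(\<lambda>k. Rn (\<nu> k) (\<tau> k)) \<longlonglongrightarrow> R t"
proof -
  obtain c d where cd: "{c..d} \<subseteq> I" "t \<in> {c..d}" "t \<in> {c..d}" "at t within I = at t within {c..d}"
    by (rule interval_compact_neighbourhood[OF I \<tau>(2,2)]) (rule that)
  have "(\<lambda>k. R (\<tau> k)) \<longlonglongrightarrow> R t"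
    using R \<tau> unfolding continuous_on_sequentially by (auto simp: o_def)
  moreover have "(\<lambda>k. Rn (\<nu> k) (\<tau> k) - R (\<tau> k)) \<longlonglongrightarrow> 0"
  proof (rule tendstoI)
    fix e :: real assume "e > 0"
    from C0_converges_eventually[OF lim cd(1) \<nu> this]
      eventually_in_same_at_within[OF cd(4,2) \<tau>(1,3)]
    show "\<forall>\<^sub>F k in sequentially. dist (Rn (\<nu> k) (\<tau> k) - R (\<tau> k)) 0 < e"
      by eventually_elim (auto simp: dist_norm)
  qed
  ultimately show ?thesis by (rule Lim_transform)
qed

text \<open>The perturbed solutions are compared with the limit solution \<open>?Z\<close> at the
  moving time, on a compact interval that contains \<open>t\<close>, \<open>t0\<close> and
  eventually all \<open>\<tau> k\<close>. Continuity of \<open>?Z\<close> then moves the time to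
  \<open>t\<close>.\<close>

lemma phase_flow_tendsto:
  assumes L: "jacobi_equation I R t0" and N: "\<And>n. jacobi_equation I (Rn n) t0"
    and lim: "C0_converges I Rn R" and \<nu>: "filterlim \<nu> at_top sequentially"
    and \<tau>: "\<And>k. \<tau> k \<in> I" "t \<in> I" "\<tau> \<longlonglongrightarrow> t" and \<zeta>: "\<zeta> \<longlonglongrightarrow> z"
  shows "(\<lambda>k. phase_flow I (Rn (\<nu> k)) t0 (\<zeta> k) (\<tau> k)) \<longlonglongrightarrow> phase_flow I R t0 z t"
proof -
  interpret L: jacobi_equation I R t0 by (rule L)
  interpret N: jacobi_equation I "Rn n" t0 for n by (rule N)
  let ?Z = "phase_flow I R t0 z" and ?Y = "\<lambda>k. phase_flow I (Rn (\<nu> k)) t0 (\<zeta> k)"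
  have contZ: "continuous_on I ?Z"
    using L.phase_flow_deriv by (meson continuous_on_eq_continuous_within has_vector_derivative_continuous)
  obtain c d where cd: "{c..d} \<subseteq> I" "t \<in> {c..d}" "t0 \<in> {c..d}" "at t within I = at t within {c..d}"
    by (rule L.compact_nbhd[OF \<tau>(2)]) (rule that)
  obtain M where M: "M > 0" "\<And>s. s \<in> {c..d} \<Longrightarrow> norm (jacobi_op (R s)) \<le> M"
    by (rule compact_interval_bound[OF continuous_on_jacobi_op[OF L.cont_R] cd(1)]) (rule that)
  obtain K where K: "K > 0" "\<And>s. s \<in> {c..d} \<Longrightarrow> norm (?Z s) \<le> K"
    by (rule compact_interval_bound[OF contZ cd(1)]) (rule that)
  define E where "E = exp ((2 * (M + 1) + 1) * (d - c))"
  have E: "E \<ge> 1" unfolding E_def using M(1) cd(2) by auto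
  have "(\<lambda>k. norm (?Y k (\<tau> k) - ?Z (\<tau> k))) \<longlonglongrightarrow> 0"
  proof (rule tendstoI)
    fix e :: real assume e: "e > 0"
    \<comment> \<open>Initial error and perturbation will each contribute at most
      \<open>\<eta>\<^sup>2\<close>, amplified by at most \<open>E\<close>; since
      \<open>E \<ge> 1\<close>, this choice makes \<open>2 * \<eta>\<^sup>2 * E\<close> smaller than
      \<open>e\<^sup>2\<close>.\<close>
    define \<eta> where "\<eta> = e / (2 * E)"
    have \<eta>: "\<eta> > 0" using e E by (simp add: \<eta>_def)
    have small: "2 * \<eta>\<^sup>2 * E < e\<^sup>2"
    proof -
      have "2 * \<eta>\<^sup>2 * E = e\<^sup>2 / (2 * E)" using E by (simp add: \<eta>_def field_simps power2_eq_square)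
      also have "\<dots> < e\<^sup>2" using e E by (simp add: divide_less_eq)
      finally show ?thesis .
    qed
    have "\<forall>\<^sub>F k in sequentially. norm (\<zeta> k - z) < \<eta>"
      using tendstoD[OF \<zeta> \<eta>] by (simp add: dist_norm)
    \<comment> \<open>The bound 1 keeps the perturbed coefficients below \<open>M + 1\<close>; the
      bound \<open>\<eta> / K\<close> makes the coefficient error times \<open>norm (?Z s)\<close>
      at most \<eta>.\<close>
    moreover have "\<forall>\<^sub>F k in sequentially. \<forall>s\<in>{c..d}. dist (Rn (\<nu> k) s) (R s) < min 1 (\<eta> / K)"
      using \<eta> K(1) by (intro C0_converges_eventually[OF lim cd(1) \<nu>]) auto
    moreover note eventually_in_same_at_within[OF cd(4,2) \<tau>(1,3)]
    ultimately show "\<forall>\<^sub>F k in sequentially. dist (norm (?Y k (\<tau> k) - ?Z (\<tau> k))) 0 < e"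
    proof eventually_elim
      case (elim k)
      have close: "norm (jacobi_op (Rn (\<nu> k) s) - jacobi_op (R s)) < min 1 (\<eta> / K)" if "s \<in> {c..d}" for s
        using norm_jacobi_op_diff[of "Rn (\<nu> k) s" "R s"] elim(2) that
        by (metis dist_norm order_le_less_trans)
      have "(norm (?Y k (\<tau> k) - ?Z (\<tau> k)))\<^sup>2 + \<eta>\<^sup>2
          \<le> ((norm (?Y k t0 - ?Z t0))\<^sup>2 + \<eta>\<^sup>2) * exp ((2 * (M + 1) + 1) * \<bar>\<tau> k - t0\<bar>)"
      proof (rule ode_solution_estimate[where A = "\<lambda>s. jacobi_op (Rn (\<nu> k) s)" and B = "\<lambda>s. jacobi_op (R s)"])
        fix s assume s: "s \<in> {c..d}"
        then have sI: "s \<in> I" using cd(1) by blast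
        show "(?Y k has_vector_derivative jacobi_op (Rn (\<nu> k) s) (?Y k s)) (at s within {c..d})"
          by (rule has_vector_derivative_within_subset[OF N.phase_flow_deriv[OF sI] cd(1)])
        show "(?Z has_vector_derivative jacobi_op (R s) (?Z s)) (at s within {c..d})"
          by (rule has_vector_derivative_within_subset[OF L.phase_flow_deriv[OF sI] cd(1)])
        show "norm (jacobi_op (Rn (\<nu> k) s)) \<le> M + 1"
          using close[OF s] M(2)[OF s] norm_triangle_sub[of "jacobi_op (Rn (\<nu> k) s)" "jacobi_op (R s)"]
          by linarith
        have "norm (jacobi_op (Rn (\<nu> k) s) - jacobi_op (R s)) * norm (?Z s) \<le> \<eta> / K * K"
          using close[OF s] K(2)[OF s] \<eta> K(1) by (intro mult_mono) auto
        then show "norm (jacobi_op (Rn (\<nu> k) s) - jacobi_op (R s)) * norm (?Z s) \<le> \<eta>"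
          using K(1) by simp
      qed (use cd(3) elim(3) in auto)
      also have "\<dots> \<le> (\<eta>\<^sup>2 + \<eta>\<^sup>2) * E"
      proof (rule mult_mono)
        show "(norm (?Y k t0 - ?Z t0))\<^sup>2 + \<eta>\<^sup>2 \<le> \<eta>\<^sup>2 + \<eta>\<^sup>2"
          using elim(1) by (simp add: L.phase_flow_initial N.phase_flow_initial power_mono)
        have "\<bar>\<tau> k - t0\<bar> \<le> d - c" using elim(3) cd(3) by auto
        then show "exp ((2 * (M + 1) + 1) * \<bar>\<tau> k - t0\<bar>) \<le> E"
          unfolding E_def using M(1) by (simp add: mult_left_mono)
      qed auto
      also have "\<dots> = 2 * \<eta>\<^sup>2 * E" by simp
      finally have "(norm (?Y k (\<tau> k) - ?Z (\<tau> k)))\<^sup>2 < e\<^sup>2"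
        using small zero_le_power2[of \<eta>] by linarith
      then show ?case using e by (simp add: power2_less_imp_less)
    qed
  qed
  then have diff: "(\<lambda>k. ?Y k (\<tau> k) - ?Z (\<tau> k)) \<longlonglongrightarrow> 0" by (rule tendsto_norm_zero_cancel)
  have "(\<lambda>k. ?Z (\<tau> k)) \<longlonglongrightarrow> ?Z t"
    using contZ \<tau> unfolding continuous_on_sequentially by (auto simp: o_def)
  then show ?thesis by (rule Lim_transform[OF _ diff])
qed

lemma sum_enat: "(\<Sum>t\<in>F. enat (f t)) = enat (sum f F)"
  by (induction F rule: infinite_finite_induct) (auto simp: zero_enat_def)

text \<open>Unordered sums in \<open>enat\<close> are suprema of finite partial sums, so both
  inequalities between indices reduce to finite sums, without deciding beforehand whether an index
  is finite.\<close>

lemma ind_eq_SUP: "ind W A = (SUP F\<in>{F. finite F \<and> F \<subseteq> A}. enat (\<Sum>t\<in>F. focal_index W t))"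
  unfolding ind_def by (subst nonneg_infsum_complete) (simp_all add: sum_enat)

lemma sum_focal_index_le_ind: "finite F \<Longrightarrow> F \<subseteq> A \<Longrightarrow> enat (\<Sum>t\<in>F. focal_index W t) \<le> ind W A"
  unfolding ind_eq_SUP by (rule SUP_upper) simp

lemma ind_le: "(\<And>F. finite F \<Longrightarrow> F \<subseteq> A \<Longrightarrow> enat (\<Sum>t\<in>F. focal_index W t) \<le> c) \<Longrightarrow> ind W A \<le> c"
  unfolding ind_eq_SUP by (rule SUP_least) simp

text \<open>Everything about subspaces follows from one fact, \<open>proj\<close>: the orthogonal
  projections onto the parameter spaces converge, even at moving arguments, to the projection onto
  the limit. These projections play the role of \<open>P n\<close>.\<close>

lemma jacobi_flow_limit_of_subspaces:
  fixes Rn :: "nat \<Rightarrow> real \<Rightarrow> 'a::euclidean_space \<Rightarrow>\<^sub>L 'a"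
  assumes L: "jacobi_equation I R t0" and N: "\<And>n. jacobi_equation I (Rn n) t0"
    and sym: "\<And>t. t \<in> I \<Longrightarrow> symmetric_endo (R t)" "\<And>n t. t \<in> I \<Longrightarrow> symmetric_endo (Rn n t)"
    and lim: "C0_converges I Rn R"
    and W: "isotropic I R W" "\<And>n. isotropic I (Rn n) (Wn n)"
    and grass: "(\<lambda>n. grassmann_dist (phase I t0 ` Wn n) (phase I t0 ` W)) \<longlonglongrightarrow> 0"
  shows "jacobi_flow_limit I R (\<lambda>t z. jacobi_equation.field I R t0 z t)
    (\<lambda>t z. jacobi_equation.velocity I R t0 z t) (jacobi_equation.params I t0 W) Rn
    (\<lambda>n t z. jacobi_equation.field I (Rn n) t0 z t) (\<lambda>n t z. jacobi_equation.velocity I (Rn n) t0 z t)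
    (\<lambda>n. jacobi_equation.params I t0 (Wn n)) (\<lambda>n. closest_point (jacobi_equation.params I t0 (Wn n)))"
proof -
  interpret L: jacobi_equation I R t0 by (rule L)
  interpret N: jacobi_equation I "Rn n" t0 for n by (rule N)
  interpret LF: jacobi_flow I R "\<lambda>t z. L.field z t" "\<lambda>t z. L.velocity z t" "L.params W"
    by (rule L.jacobi_flow_isotropic[OF sym(1) W(1)])
  let ?S = "L.params W" and ?Sn = "\<lambda>n. L.params (Wn n)"
  have flow: "jacobi_flow I (Rn n) (\<lambda>t z. N.field n z t) (\<lambda>t z. N.velocity n z t) (?Sn n)" for n
    by (rule N.jacobi_flow_isotropic[OF sym(2) W(2)])
  have sub: "subspace (?Sn n)" for n using flow by (rule jacobi_flow.subspace_S)
  note subS = LF.subspace_S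
  have fix_S: "closest_point ?S z = z" if "z \<in> ?S" for z using that by (rule closest_point_self)
  have proj: "(\<lambda>k. closest_point (?Sn (\<nu> k)) (\<zeta> k)) \<longlonglongrightarrow> closest_point ?S z"
    if \<nu>: "filterlim \<nu> at_top sequentially" and \<zeta>: "\<zeta> \<longlonglongrightarrow> z" for \<nu> :: "nat \<Rightarrow> nat" and \<zeta> z
  proof -
    have "(\<lambda>k. closest_point ?S (\<zeta> k)) \<longlonglongrightarrow> closest_point ?S z"
      by (rule bounded_linear.tendsto[OF _ \<zeta>])
        (rule linear_conv_bounded_linear[THEN iffD1, OF linear_closest_point[OF subS]])
    moreover have "(\<lambda>k. closest_point (?Sn (\<nu> k)) (\<zeta> k) - closest_point ?S (\<zeta> k)) \<longlonglongrightarrow> 0"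
    proof (rule Lim_null_comparison)
      show "\<forall>\<^sub>F k in sequentially. norm (closest_point (?Sn (\<nu> k)) (\<zeta> k) - closest_point ?S (\<zeta> k))
          \<le> grassmann_dist (?Sn (\<nu> k)) ?S * norm (\<zeta> k)"
        by (intro always_eventually allI grassmann_dist_bound sub subS)
      have "(\<lambda>k. grassmann_dist (?Sn (\<nu> k)) ?S) \<longlonglongrightarrow> 0"
        using filterlim_compose[OF grass \<nu>] by (simp add: L.params_def)
      from tendsto_mult[OF this tendsto_norm[OF \<zeta>]]
      show "(\<lambda>k. grassmann_dist (?Sn (\<nu> k)) ?S * norm (\<zeta> k)) \<longlonglongrightarrow> 0" by simp
    qed
    ultimately show ?thesis by (rule Lim_transform)
  qed
  show ?thesis
  proof (intro jacobi_flow_limit.intro jacobi_flow_limit_axioms.intro LF.jacobi_flow_axioms flow)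
    fix \<nu> :: "nat \<Rightarrow> nat" and \<tau> t and \<zeta> :: "nat \<Rightarrow> 'a \<times> 'a" and z
    assume \<nu>: "filterlim \<nu> at_top sequentially" and \<tau>: "\<And>k. \<tau> k \<in> I" "t \<in> I" "\<tau> \<longlonglongrightarrow> t"
      and \<zeta>: "\<zeta> \<longlonglongrightarrow> z"
    note flow_lim = phase_flow_tendsto[OF L N lim \<nu> \<tau> \<zeta>]
    show "(\<lambda>k. N.field (\<nu> k) (\<zeta> k) (\<tau> k)) \<longlonglongrightarrow> L.field z t"
      using tendsto_fst[OF flow_lim] \<tau>(1,2) by (simp add: L.field_def N.field_def)
    show "(\<lambda>k. N.velocity (\<nu> k) (\<zeta> k) (\<tau> k)) \<longlonglongrightarrow> L.velocity z t"
      using tendsto_snd[OF flow_lim] \<tau>(1,2) by (simp add: L.velocity_def N.velocity_def)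
  next
    fix \<nu> :: "nat \<Rightarrow> nat" and \<tau> t
    assume "filterlim \<nu> at_top sequentially" "\<And>k. \<tau> k \<in> I" "t \<in> I" "\<tau> \<longlonglongrightarrow> t"
    then show "(\<lambda>k. Rn (\<nu> k) (\<tau> k)) \<longlonglongrightarrow> R t"
      by (rule C0_converges_tendsto[OF lim L.interval L.cont_R])
  next
    fix \<nu> :: "nat \<Rightarrow> nat" and \<zeta> z
    assume \<nu>: "filterlim \<nu> at_top sequentially" and \<zeta>: "\<And>k. \<zeta> k \<in> ?Sn (\<nu> k)" "\<zeta> \<longlonglongrightarrow> z"
    \<comment> \<open>Elements of \<open>?Sn (\<nu> k)\<close> are fixed by their projection, so the
      limit is fixed by the limit projection, that is, it lies in \<open>?S\<close>.\<close>
    have "(\<lambda>k. closest_point (?Sn (\<nu> k)) (\<zeta> k)) = \<zeta>" using \<zeta>(1) by (simp add: closest_point_self)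
    then have "\<zeta> \<longlonglongrightarrow> closest_point ?S z" using proj[OF \<nu> \<zeta>(2)] by simp
    then have "z = closest_point ?S z" by (rule LIMSEQ_unique[OF \<zeta>(2)])
    then show "z \<in> ?S" using closest_point_in_subspace[OF subS, of z] by simp
  next
    fix n and z assume "z \<in> ?S"
    show "closest_point (?Sn n) z \<in> ?Sn n" by (rule closest_point_in_subspace[OF sub])
  next
    fix n show "linear (closest_point (?Sn n))" by (rule linear_closest_point[OF sub])
  next
    fix \<nu> :: "nat \<Rightarrow> nat" and \<zeta> z
    assume "filterlim \<nu> at_top sequentially" "\<zeta> \<longlonglongrightarrow> z" and z: "z \<in> ?S"
    from proj[OF this(1,2)] show "(\<lambda>k. closest_point (?Sn (\<nu> k)) (\<zeta> k)) \<longlonglongrightarrow> z"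
      unfolding fix_S[OF z] .
  qed
qed

theorem proposition1p4:
  fixes I :: "real set"
    and Rn :: "nat \<Rightarrow> real \<Rightarrow> 'a::euclidean_space \<Rightarrow>\<^sub>L 'a"
    and R :: "real \<Rightarrow> 'a \<Rightarrow>\<^sub>L 'a"
    and Wn :: "nat \<Rightarrow> (real \<Rightarrow> 'a) set"
    and W :: "(real \<Rightarrow> 'a) set"
    and a b :: real
  assumes "is_interval I" and "interior I \<noteq> {}"
    and "\<And>n. smooth_symmetric_family I (Rn n)"
    and "smooth_symmetric_family I R"
    and "C0_converges I Rn R"
    and "\<And>n. isotropic I (Rn n) (Wn n)"
    and "isotropic I R W"
    and "subspaces_converge I Wn W"
    and "a \<le> b" and "{a..b} \<subseteq> I"
    and "\<forall>\<^sub>F n in sequentially.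
           focal_index (Wn n) a = focal_index W a \<and> focal_index (Wn n) b = focal_index W b"
  shows "(\<forall>\<^sub>F n in sequentially. ind W {a..b} \<ge> ind (Wn n) {a..b}) \<and>
         ((\<forall>n. lagrangian I (Rn n) (Wn n)) \<longrightarrow>
           (\<forall>\<^sub>F n in sequentially. ind W {a..b} = ind (Wn n) {a..b}))"
proof -
  obtain t0 where t0: "t0 \<in> I"
    and grass: "(\<lambda>n. grassmann_dist (phase I t0 ` Wn n) (phase I t0 ` W)) \<longlonglongrightarrow> 0"
    and dims: "\<forall>\<^sub>F n in sequentially. dim (Wn n) = dim W"
    using assms(8) unfolding subspaces_converge_def by blast
  have sym: "\<And>t. t \<in> I \<Longrightarrow> symmetric_endo (R t)" "\<And>n t. t \<in> I \<Longrightarrow> symmetric_endo (Rn n t)"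
    using assms(3,4) by (auto simp: smooth_symmetric_family_def)
  have L: "jacobi_equation I R t0" and N: "jacobi_equation I (Rn n) t0" for n
    using assms(1-4) t0
    by (auto simp: smooth_symmetric_family_def intro!: jacobi_equation.intro smooth_on_imp_continuous_on)
  interpret L: jacobi_equation I R t0 by (rule L)
  interpret N: jacobi_equation I "Rn n" t0 for n by (rule N)
  let ?X = "\<lambda>t z. L.field z t" and ?Xn = "\<lambda>n t z. N.field n z t"
  let ?S = "L.params W" and ?Sn = "\<lambda>n. L.params (Wn n)"
  interpret lim: jacobi_flow_limit I R ?X "\<lambda>t z. L.velocity z t" ?S Rn ?Xn "\<lambda>n t z. N.velocity n z t"
    ?Sn "\<lambda>n. closest_point (?Sn n)"
    by (rule jacobi_flow_limit_of_subspaces[OF L N sym assms(5,7,6) grass])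
  have focal: "focal_index W t = dim (focal_space ?X ?S t)"
    "focal_index (Wn n) t = dim (focal_space (?Xn n) (?Sn n) t)" if "t \<in> I" for t n
    using L.focal_index_eq[OF assms(7) that] N.focal_index_eq[OF assms(6) that] by auto
  have sum_focal: "(\<Sum>t\<in>F. focal_index W t) = (\<Sum>t\<in>F. dim (focal_space ?X ?S t))"
    "(\<Sum>t\<in>F. focal_index (Wn n) t) = (\<Sum>t\<in>F. dim (focal_space (?Xn n) (?Sn n) t))"
    if "F \<subseteq> {a..b}" for F n
    using that assms(10) focal by (auto intro!: sum.cong)
  obtain D n0 where D: "finite D" "D \<subseteq> {a..b}" and n0: "\<forall>n\<ge>n0. \<forall>F. finite F \<longrightarrow> F \<subseteq> {a..b} \<longrightarrow>
      (\<Sum>t\<in>F. dim (focal_space (?Xn n) (?Sn n) t)) \<le> (\<Sum>s\<in>D. dim (focal_space ?X ?S s))"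
    using lim.focal_upper_global[OF assms(10)] by (elim exE conjE)
  have upper: "ind (Wn n) {a..b} \<le> ind W {a..b}" if "n \<ge> n0" for n
  proof (rule ind_le)
    fix F :: "real set" assume F: "finite F" "F \<subseteq> {a..b}"
    then have "(\<Sum>t\<in>F. focal_index (Wn n) t) \<le> (\<Sum>t\<in>D. focal_index W t)"
      unfolding sum_focal[OF F(2)] sum_focal[OF D(2)] using n0 that by metis
    then have "enat (\<Sum>t\<in>F. focal_index (Wn n) t) \<le> enat (\<Sum>t\<in>D. focal_index W t)" by simp
    also have "\<dots> \<le> ind W {a..b}" by (rule sum_focal_index_le_ind[OF D])
    finally show "enat (\<Sum>t\<in>F. focal_index (Wn n) t) \<le> ind W {a..b}" .
  qed
  then have ev_upper: "\<forall>\<^sub>F n in sequentially. ind (Wn n) {a..b} \<le> ind W {a..b}"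
    unfolding eventually_sequentially by blast
  have "\<forall>\<^sub>F n in sequentially. ind W {a..b} = ind (Wn n) {a..b}"
    if lag: "\<And>n. lagrangian I (Rn n) (Wn n)"
  proof -
    have dimn: "dim (?Sn n) = DIM('a)" for n by (rule N.lagrangian_dim[OF sym(2) lag])
    obtain n where "dim (Wn n) = dim W" using dims by (auto simp: eventually_sequentially)
    then have dim: "dim ?S = DIM('a)"
      using dimn[of n] L.dim_params[OF assms(7)] N.dim_params[OF assms(6)] by simp
    define T where "T = {t \<in> {a..b}. dim (focal_space ?X ?S t) \<noteq> 0}"
    have T: "finite T" "T \<subseteq> {a..b}"
      unfolding T_def by (rule lim.finite_focal_times[OF assms(10)]) blast
    have ind_T: "ind W {a..b} \<le> enat (\<Sum>t\<in>T. focal_index W t)"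
    proof (rule ind_le)
      fix F :: "real set" assume F: "finite F" "F \<subseteq> {a..b}"
      have zero: "focal_index W t = 0" if "t \<in> F - F \<inter> T" for t
      proof -
        have t: "t \<in> {a..b}" "t \<notin> T" using that F(2) by auto
        then have "dim (focal_space ?X ?S t) = 0" unfolding T_def by blast
        moreover have "t \<in> I" using t(1) assms(10) by blast
        ultimately show ?thesis by (simp only: focal(1))
      qed
      have "(\<Sum>t\<in>F. focal_index W t) = (\<Sum>t\<in>F \<inter> T. focal_index W t)"
        by (rule sum.mono_neutral_right) (use F(1) zero in auto)
      also have "\<dots> \<le> (\<Sum>t\<in>T. focal_index W t)" using T(1) by (intro sum_mono2) auto
      finally show "enat (\<Sum>t\<in>F. focal_index W t) \<le> enat (\<Sum>t\<in>T. focal_index W t)" by simp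
    qed
    have "a \<in> I" "b \<in> I" using assms(9,10) by auto
    then have ends: "\<forall>\<^sub>F n in sequentially. dim (focal_space (?Xn n) (?Sn n) a) = dim (focal_space ?X ?S a) \<and>
        dim (focal_space (?Xn n) (?Sn n) b) = dim (focal_space ?X ?S b)"
      using assms(11) by (simp only: focal)
    from lim.focal_lower_global[OF assms(10,9) dim dimn ends T] ev_upper
    show ?thesis
    proof eventually_elim
      case (elim n)
      then obtain F where F: "finite F" "F \<subseteq> {a..b}"
        "(\<Sum>t\<in>T. dim (focal_space ?X ?S t)) \<le> (\<Sum>t\<in>F. dim (focal_space (?Xn n) (?Sn n) t))" by metis
      have "ind W {a..b} \<le> enat (\<Sum>t\<in>F. focal_index (Wn n) t)"
        using ind_T F(3) unfolding sum_focal[OF F(2)] sum_focal[OF T(2)]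
        by (meson enat_ord_simps(1) order_trans)
      also have "\<dots> \<le> ind (Wn n) {a..b}" by (rule sum_focal_index_le_ind[OF F(1,2)])
      finally show ?case using elim(2) by (rule antisym)
    qed
  qed
  then show ?thesis using ev_upper by blast
qed

end
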